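(* Let $T$ be a complete affine $L$-theory. Then there is a model $M\vDash T$ which omits every non-extreme type in $S_n(T)$, for every $n\geqslant 1$.
   Context: Affine (linear) continuous logic. A language $L$ consists of constant symbols, function symbols $F$ (each with an arity and a Lipschitz constant $\lambda_F\geqslant0$) and relation symbols $R$ (each with an arity and a Lipschitz constant $\lambda_R\geqslant 0$), always including a distinguished binary relation symbol $d$ for the metric; $L$ may have any cardinality. An $L$-structure is a complete metric space $(M,d)$ with $c^M\in M$, $F^M:M^n\to M$ $\lambda_F$-Lipschitz, and $R^M:M^n\to\mathbb R$ $\lambda_R$-Lipschitz with $\|R^M\|_\infty\leqslant1$ (so $d\leqslant 1$); $M^n$ carries the metric $\sum_{i<n}2^{-i}d(x_i,y_i)$. Affine formulas are generated by $r$, $d(t_1,t_2)$, $R(t_1,\dots,t_n)$, $r\phi$, $\phi+\psi$, $\sup_x\phi$, $\inf_x\phi$ ($r\in\mathbb R$, $t_i$ terms) and are interpreted as real-valued functions $\phi^M$. A condition is an expression $\phi\leqslant\psi$ (and $\phi=\psi$ abbreviates the two inequalities); an (affine) theory is a set of conditions between sentences; $M\vDash T$ means all conditions of $T$ hold in $M$. $T$ is complete if it has a model and for every sentence $\sigma$ there is a unique $r\in\mathbb R$ with $\sigma=r$ in $T$. For complete $T$, $\mathbb D_n(T)$ is the ordered vector space of formulas $\phi(x_1,\dots,x_n)$ modulo $T$-equivalence, i.e. $\{\phi^M\}$ for any $M\vDash T$, with pointwise order and sup-norm. An $n$-type is a positive linear functional $p:\mathbb D_n(T)\to\mathbb R$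 with $p(1)=1$; $S_n(T)$ is the compact convex set of all $n$-types. A tuple $\bar a\in M^n$ realizes $p$ if $p=tp(\bar a)$, where $tp(\bar a)(\phi)=\phi^M(\bar a)$; $M$ omits $p$ if no tuple of $M$ realizes $p$. A type $p$ is extreme if it is an extreme point of $S_n(T)$, and non-extreme otherwise. *)

theory Defs
  imports "HOL-Analysis.Analysis" "HOL-Library.Function_Algebras"
begin

text \<open>Real-valued functions form a real vector space, so that the library notion
  \<^const>\<open>extreme_point_of\<close> applies to sets of functionals.\<close>

instantiation "fun" :: (type, real_vector) real_vector
begin

definition scaleR_fun_def: "scaleR r f = (\<lambda>x. scaleR r (f x))"

instance
  by standard (simp_all add: scaleR_fun_def fun_eq_iff scaleR_add_right scaleR_add_left)

end


section \<open>Languages, formulas and theories\<close>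

text \<open>The symbols of a language are arbitrary subsets of the types \<open>'c\<close>, \<open>'f\<close>, \<open>'r\<close>
  (any of them may be empty). The metric symbol \<open>d\<close> is not among the relation symbols:
  it belongs to every language and has its own formula constructor. Its Lipschitz property
  is a consequence of the triangle inequality.\<close>

record ('c, 'f, 'r) language =
  csyms :: "'c set"
  fsyms :: "'f set"
  rsyms :: "'r set"
  farity :: "'f \<Rightarrow> nat"
  rarity :: "'r \<Rightarrow> nat"
  flip :: "'f \<Rightarrow> real"
  rlip :: "'r \<Rightarrow> real"

definition is_language :: "('c, 'f, 'r) language \<Rightarrow> bool" where
  "is_language L \<longleftrightarrow> (\<forall>F\<in>fsyms L. 0 \<le> flip L F) \<and> (\<forall>R\<in>rsyms L. 0 \<le> rlip L R)"

datatype ('c, 'f) trm = Var nat | Cst 'c | App 'f "('c, 'f) trm list"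

datatype ('c, 'f, 'r) fm =
    Num real
  | Dist "('c, 'f) trm" "('c, 'f) trm"
  | Rel 'r "('c, 'f) trm list"
  | Scale real "('c, 'f, 'r) fm"
  | Add "('c, 'f, 'r) fm" "('c, 'f, 'r) fm"
  | SupF nat "('c, 'f, 'r) fm"
  | InfF nat "('c, 'f, 'r) fm"

fun wf_trm :: "('c, 'f, 'r) language \<Rightarrow> ('c, 'f) trm \<Rightarrow> bool" where
  "wf_trm L (Var i) \<longleftrightarrow> True"
| "wf_trm L (Cst c) \<longleftrightarrow> c \<in> csyms L"
| "wf_trm L (App F ts) \<longleftrightarrow> F \<in> fsyms L \<and> length ts = farity L F \<and> (\<forall>t\<in>set ts. wf_trm L t)"

fun wf_fm :: "('c, 'f, 'r) language \<Rightarrow> ('c, 'f, 'r) fm \<Rightarrow> bool" where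
  "wf_fm L (Num r) \<longleftrightarrow> True"
| "wf_fm L (Dist s t) \<longleftrightarrow> wf_trm L s \<and> wf_trm L t"
| "wf_fm L (Rel R ts) \<longleftrightarrow> R \<in> rsyms L \<and> length ts = rarity L R \<and> (\<forall>t\<in>set ts. wf_trm L t)"
| "wf_fm L (Scale r \<phi>) \<longleftrightarrow> wf_fm L \<phi>"
| "wf_fm L (Add \<phi> \<psi>) \<longleftrightarrow> wf_fm L \<phi> \<and> wf_fm L \<psi>"
| "wf_fm L (SupF i \<phi>) \<longleftrightarrow> wf_fm L \<phi>"
| "wf_fm L (InfF i \<phi>) \<longleftrightarrow> wf_fm L \<phi>"

fun tvars :: "('c, 'f) trm \<Rightarrow> nat set" where
  "tvars (Var i) = {i}"
| "tvars (Cst c) = {}"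
| "tvars (App F ts) = (\<Union>t\<in>set ts. tvars t)"

fun fvars :: "('c, 'f, 'r) fm \<Rightarrow> nat set" where
  "fvars (Num r) = {}"
| "fvars (Dist s t) = tvars s \<union> tvars t"
| "fvars (Rel R ts) = (\<Union>t\<in>set ts. tvars t)"
| "fvars (Scale r \<phi>) = fvars \<phi>"
| "fvars (Add \<phi> \<psi>) = fvars \<phi> \<union> fvars \<psi>"
| "fvars (SupF i \<phi>) = fvars \<phi> - {i}"
| "fvars (InfF i \<phi>) = fvars \<phi> - {i}"

text \<open>\<open>fms L n\<close> is the set of formulas \<open>\<phi>(x\<^sub>1, \<dots>, x\<^sub>n)\<close>, where \<open>x\<^sub>1, \<dots>, x\<^sub>n\<close> are
  \<open>Var 0, \<dots>, Var (n - 1)\<close>; sentences are the elements of \<open>fms L 0\<close>.\<close>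

definition fms :: "('c, 'f, 'r) language \<Rightarrow> nat \<Rightarrow> ('c, 'f, 'r) fm set" where
  "fms L n = {\<phi>. wf_fm L \<phi> \<and> fvars \<phi> \<subseteq> {..<n}}"

text \<open>A pair \<open>(\<phi>, \<psi>)\<close> stands for the condition \<open>\<phi> \<le> \<psi>\<close>.\<close>

type_synonym ('c, 'f, 'r) thy = "(('c, 'f, 'r) fm \<times> ('c, 'f, 'r) fm) set"

definition is_theory :: "('c, 'f, 'r) language \<Rightarrow> ('c, 'f, 'r) thy \<Rightarrow> bool" where
  "is_theory L T \<longleftrightarrow> T \<subseteq> fms L 0 \<times> fms L 0"


section \<open>Structures\<close>

record ('c, 'f, 'r, 'u) lstruct =
  dom :: "'u set"
  mdist :: "'u \<Rightarrow> 'u \<Rightarrow> real"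
  cint :: "'c \<Rightarrow> 'u"
  fint :: "'f \<Rightarrow> 'u list \<Rightarrow> 'u"
  rint :: "'r \<Rightarrow> 'u list \<Rightarrow> real"

definition tuples :: "('c, 'f, 'r, 'u) lstruct \<Rightarrow> nat \<Rightarrow> 'u list set" where
  "tuples M n = {as. length as = n \<and> set as \<subseteq> dom M}"

definition tdist :: "('c, 'f, 'r, 'u) lstruct \<Rightarrow> nat \<Rightarrow> 'u list \<Rightarrow> 'u list \<Rightarrow> real" where
  "tdist M n as bs = (\<Sum>i<n. (1 / 2) ^ i * mdist M (as ! i) (bs ! i))"

definition is_structure ::
  "('c, 'f, 'r) language \<Rightarrow> ('c, 'f, 'r, 'u) lstruct \<Rightarrow> bool" where
  "is_structure L M \<longleftrightarrow>
     dom M \<noteq> {} \<and>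
     Metric_space (dom M) (mdist M) \<and>
     Metric_space.mcomplete (dom M) (mdist M) \<and>
     (\<forall>x\<in>dom M. \<forall>y\<in>dom M. mdist M x y \<le> 1) \<and>
     (\<forall>c\<in>csyms L. cint M c \<in> dom M) \<and>
     (\<forall>F\<in>fsyms L. \<forall>as\<in>tuples M (farity L F). fint M F as \<in> dom M) \<and>
     (\<forall>F\<in>fsyms L. \<forall>as\<in>tuples M (farity L F). \<forall>bs\<in>tuples M (farity L F).
        mdist M (fint M F as) (fint M F bs) \<le> flip L F * tdist M (farity L F) as bs) \<and>
     (\<forall>R\<in>rsyms L. \<forall>as\<in>tuples M (rarity L R). \<bar>rint M R as\<bar> \<le> 1) \<and>
     (\<forall>R\<in>rsyms L. \<forall>as\<in>tuples M (rarity L R). \<forall>bs\<in>tuples M (rarity L R).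
        \<bar>rint M R as - rint M R bs\<bar> \<le> rlip L R * tdist M (rarity L R) as bs)"

fun teval :: "('c, 'f, 'r, 'u) lstruct \<Rightarrow> (nat \<Rightarrow> 'u) \<Rightarrow> ('c, 'f) trm \<Rightarrow> 'u" where
  "teval M v (Var i) = v i"
| "teval M v (Cst c) = cint M c"
| "teval M v (App F ts) = fint M F (map (teval M v) ts)"

fun feval :: "('c, 'f, 'r, 'u) lstruct \<Rightarrow> (nat \<Rightarrow> 'u) \<Rightarrow> ('c, 'f, 'r) fm \<Rightarrow> real" where
  "feval M v (Num r) = r"
| "feval M v (Dist s t) = mdist M (teval M v s) (teval M v t)"
| "feval M v (Rel R ts) = rint M R (map (teval M v) ts)"
| "feval M v (Scale r \<phi>) = r * feval M v \<phi>"
| "feval M v (Add \<phi> \<psi>) = feval M v \<phi> + feval M v \<psi>"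
| "feval M v (SupF i \<phi>) = (SUP a\<in>dom M. feval M (v(i := a)) \<phi>)"
| "feval M v (InfF i \<phi>) = (INF a\<in>dom M. feval M (v(i := a)) \<phi>)"

text \<open>\<open>fval M \<phi> as\<close> is \<open>\<phi>\<^sup>M(as)\<close>. It is used only for \<open>\<phi> \<in> fms L n\<close> and \<open>as \<in> tuples M n\<close>;
  then the unspecified entries \<open>as ! i\<close> with \<open>i \<ge> n\<close> play no role.\<close>

definition fval :: "('c, 'f, 'r, 'u) lstruct \<Rightarrow> ('c, 'f, 'r) fm \<Rightarrow> 'u list \<Rightarrow> real" where
  "fval M \<phi> as = feval M (\<lambda>i. as ! i) \<phi>"

definition models ::
  "('c, 'f, 'r) language \<Rightarrow> ('c, 'f, 'r) thy \<Rightarrow> ('c, 'f, 'r, 'u) lstruct set" where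
  "models L T = {M. is_structure L M \<and> (\<forall>(\<phi>, \<psi>)\<in>T. fval M \<phi> [] \<le> fval M \<psi> [])}"


section \<open>Consequence and complete theories\<close>

text \<open>HOL cannot quantify over types inside a formula, so "all models" means all models whose
  underlying set lies in a fixed type \<open>'u\<close>, passed as an argument of type \<open>'u itself\<close>.
  By the downward Loewenheim-Skolem theorem nothing is lost once \<open>'u\<close> has at least
  \<open>(|L| + \<aleph>\<^sub>0)\<close> to the power \<open>\<aleph>\<^sub>0\<close> elements, the bound on the size of a complete structure
  of density character at most \<open>|L| + \<aleph>\<^sub>0\<close>. The following condition, in which real
  coefficients of formulas contribute at most the continuum, guarantees this.\<close>

definition large_universe ::
  "'u itself \<Rightarrow> ('c, 'f, 'r) language \<Rightarrow> bool" where
  "large_universe U L \<longleftrightarrow> (\<exists>j :: (nat \<Rightarrow> ('c, 'f, 'r) fm) \<Rightarrow> 'u. inj j)"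

definition entails_le ::
  "'u itself \<Rightarrow> ('c, 'f, 'r) language \<Rightarrow> ('c, 'f, 'r) thy \<Rightarrow> nat \<Rightarrow>
     ('c, 'f, 'r) fm \<Rightarrow> ('c, 'f, 'r) fm \<Rightarrow> bool" where
  "entails_le U L T n \<phi> \<psi> \<longleftrightarrow>
     (\<forall>M :: ('c, 'f, 'r, 'u) lstruct. M \<in> models L T \<longrightarrow>
        (\<forall>as\<in>tuples M n. fval M \<phi> as \<le> fval M \<psi> as))"

definition entails_eq ::
  "'u itself \<Rightarrow> ('c, 'f, 'r) language \<Rightarrow> ('c, 'f, 'r) thy \<Rightarrow> nat \<Rightarrow>
     ('c, 'f, 'r) fm \<Rightarrow> ('c, 'f, 'r) fm \<Rightarrow> bool" where
  "entails_eq U L T n \<phi> \<psi> \<longleftrightarrow> entails_le U L T n \<phi> \<psi> \<and> entails_le U L T n \<psi> \<phi>"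

text \<open>That \<open>\<sigma> = r\<close> is in \<open>T\<close> is read up to consequence, so that \<open>T\<close> need not be
  deductively closed.\<close>

definition complete_theory ::
  "'u itself \<Rightarrow> ('c, 'f, 'r) language \<Rightarrow> ('c, 'f, 'r) thy \<Rightarrow> bool" where
  "complete_theory U L T \<longleftrightarrow>
     is_theory L T \<and>
     (\<exists>M :: ('c, 'f, 'r, 'u) lstruct. M \<in> models L T) \<and>
     (\<forall>\<sigma>\<in>fms L 0. \<exists>!r. entails_eq U L T 0 \<sigma> (Num r))"


section \<open>Types\<close>

definition T_equiv ::
  "'u itself \<Rightarrow> ('c, 'f, 'r) language \<Rightarrow> ('c, 'f, 'r) thy \<Rightarrow> nat \<Rightarrow>
     (('c, 'f, 'r) fm \<times> ('c, 'f, 'r) fm) set" where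
  "T_equiv U L T n = {(\<phi>, \<psi>). \<phi> \<in> fms L n \<and> \<psi> \<in> fms L n \<and> entails_eq U L T n \<phi> \<psi>}"

text \<open>The underlying set of \<open>\<D>\<^sub>n(T)\<close>, and the class of a formula in it.\<close>

definition D_space ::
  "'u itself \<Rightarrow> ('c, 'f, 'r) language \<Rightarrow> ('c, 'f, 'r) thy \<Rightarrow> nat \<Rightarrow>
     ('c, 'f, 'r) fm set set" where
  "D_space U L T n = fms L n // T_equiv U L T n"

definition fclass ::
  "'u itself \<Rightarrow> ('c, 'f, 'r) language \<Rightarrow> ('c, 'f, 'r) thy \<Rightarrow> nat \<Rightarrow>
     ('c, 'f, 'r) fm \<Rightarrow> ('c, 'f, 'r) fm set" where
  "fclass U L T n \<phi> = T_equiv U L T n `` {\<phi>}"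

text \<open>\<open>S_space U L T n\<close> is \<open>S\<^sub>n(T)\<close>. The operations and the order of \<open>\<D>\<^sub>n(T)\<close> are those
  induced by representatives. A functional on \<open>\<D>\<^sub>n(T)\<close> is extended by \<open>0\<close> to a
  function on all sets of formulas, so that it is determined by its values on \<open>\<D>\<^sub>n(T)\<close>.\<close>

definition S_space ::
  "'u itself \<Rightarrow> ('c, 'f, 'r) language \<Rightarrow> ('c, 'f, 'r) thy \<Rightarrow> nat \<Rightarrow>
     (('c, 'f, 'r) fm set \<Rightarrow> real) set" where
  "S_space U L T n = {p.
     (\<forall>X. X \<notin> D_space U L T n \<longrightarrow> p X = 0) \<and>
     (\<forall>\<phi>\<in>fms L n. \<forall>\<psi>\<in>fms L n.
        p (fclass U L T n (Add \<phi> \<psi>)) = p (fclass U L T n \<phi>) + p (fclass U L T n \<psi>)) \<and>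
     (\<forall>r. \<forall>\<phi>\<in>fms L n. p (fclass U L T n (Scale r \<phi>)) = r * p (fclass U L T n \<phi>)) \<and>
     (\<forall>\<phi>\<in>fms L n. entails_le U L T n (Num 0) \<phi> \<longrightarrow> 0 \<le> p (fclass U L T n \<phi>)) \<and>
     p (fclass U L T n (Num 1)) = 1}"

definition realizes ::
  "('c, 'f, 'r) language \<Rightarrow> ('c, 'f, 'r) thy \<Rightarrow> nat \<Rightarrow> ('c, 'f, 'r, 'u) lstruct \<Rightarrow> 'u list \<Rightarrow>
     (('c, 'f, 'r) fm set \<Rightarrow> real) \<Rightarrow> bool" where
  "realizes L T n M as p \<longleftrightarrow>
     (\<forall>\<phi>\<in>fms L n. p (fclass TYPE('u) L T n \<phi>) = fval M \<phi> as)"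

definition omits ::
  "('c, 'f, 'r) language \<Rightarrow> ('c, 'f, 'r) thy \<Rightarrow> nat \<Rightarrow> ('c, 'f, 'r, 'u) lstruct \<Rightarrow>
     (('c, 'f, 'r) fm set \<Rightarrow> real) \<Rightarrow> bool" where
  "omits L T n M p \<longleftrightarrow> \<not> (\<exists>as\<in>tuples M n. realizes L T n M as p)"

end

theory Submission
  imports Defs
begin

text \<open>
  Extremeness of a type can be read off its values alone. Call a positive normalized functional
  \<open>p\<close> on a space of bounded functions \<^emph>\<open>pure\<close> if every \<open>f\<close> with \<open>p f = 0\<close> lies
  below some \<open>g \<ge> 0\<close> of the space with \<open>p g\<close> arbitrarily small. If \<open>p\<close> is pure and \<open>q\<close> is a
  component of \<open>p\<close> in a convex combination, then \<open>q \<le> p / c\<close> on nonnegative functions for some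
  \<open>c > 0\<close>, hence \<open>q f \<le> q g \<le> p g / c\<close>, so that \<open>q\<close> is \<open>\<le> 0\<close>, and by symmetry \<open>0\<close>, on the
  kernel of \<open>p\<close>: then \<open>q = p\<close>.

  Purity has two advantages over extremeness. It passes from a type in many variables to the type
  of a subtuple: if \<open>g\<close> dominates a formula \<open>f\<close> in fewer variables, so does the infimum of \<open>g\<close> over
  the other variables, which is again an affine formula. It passes to metric limits in the same
  way: the infimum over \<open>y\<close> of \<open>g(y) + C d(x, y)\<close> dominates \<open>f(x)\<close> when \<open>g\<close> dominates \<open>f\<close> and
  \<open>C\<close> is a Lipschitz constant of \<open>f\<close>. Both are combined in \<open>tuples_pure\<close>. Therefore it suffices
  to find a model with a dense set of elements that jointly realize one pure type, in as many
  variables as necessary.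

  This is a Henkin construction. Fix some model \<open>M\<close> of \<open>T\<close>. The variables are indexed by formulas,
  and a syntactic code (\<open>witness\<close>) reserves for each formula \<open>\<phi>\<close>, variable \<open>x\<^sub>i\<close> and choice of
  parameters among the variables a variable \<open>w\<close> at which \<open>sup\<^sub>x \<phi>\<close> is to be attained.
  Types in these variables are states on the space of functions of valuations into \<open>M\<close> that
  formulas define. Since \<open>sup\<^sub>x \<phi> - \<phi>(w)\<close> is nonnegative, the states that vanish on all these
  functions form a closed face of the state space. It is not empty, as almost optimal witnesses can
  be chosen in \<open>M\<close> by recursion (\<open>henkin_vals_nonempty\<close>). A minimal closed face inside it consists
  of one pure state \<open>p\<close>; the existence proof (\<open>ex_pure_state\<close>) applies Zorn's lemma to cones of
  functions, which stand for faces. Finally the variables with the distance \<open>p (d(x\<^sub>i, x\<^sub>j))\<close> are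
  completed to a structure \<open>N\<close>, in which formulas take the values prescribed by \<open>p\<close>
  (\<open>feval_N\<close>). The points of \<open>N\<close> are limits of sequences of formulas, so that \<open>N\<close> fits
  into the given universe.
\<close>


section \<open>Pure states of spaces of bounded functions\<close>

locale function_space =
  fixes V :: "('x \<Rightarrow> real) set" and X :: "'x set"
  assumes const_mem: "(\<lambda>_. c) \<in> V"
    and add_mem: "\<lbrakk>f \<in> V; g \<in> V\<rbrakk> \<Longrightarrow> (\<lambda>x. f x + g x) \<in> V"
    and scale_mem: "f \<in> V \<Longrightarrow> (\<lambda>x. c * f x) \<in> V"
    and bounded_mem: "f \<in> V \<Longrightarrow> \<exists>B. \<forall>x\<in>X. \<bar>f x\<bar> \<le> B"
begin

lemma diff_mem: "\<lbrakk>f \<in> V; g \<in> V\<rbrakk> \<Longrightarrow> (\<lambda>x. f x - g x) \<in> V"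
  using add_mem[of f "\<lambda>x. (-1) * g x"] scale_mem[of g "-1"] by simp

lemma sum_mem: "(\<And>k. k < n \<Longrightarrow> f k \<in> V) \<Longrightarrow> (\<lambda>x. \<Sum>k<(n::nat). f k x) \<in> V"
proof (induction n)
  case 0
  show ?case using const_mem[of 0] by simp
next
  case (Suc n)
  have "(\<lambda>x. (\<Sum>k<n. f k x) + f n x) \<in> V"
    using Suc by (intro add_mem) auto
  then show ?case by simp
qed

definition state :: "(('x \<Rightarrow> real) \<Rightarrow> real) \<Rightarrow> bool" where
  "state p \<longleftrightarrow>
     (\<forall>f\<in>V. \<forall>g\<in>V. p (\<lambda>x. f x + g x) = p f + p g) \<and>
     (\<forall>c. \<forall>f\<in>V. p (\<lambda>x. c * f x) = c * p f) \<and>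
     (\<forall>f\<in>V. (\<forall>x\<in>X. 0 \<le> f x) \<longrightarrow> 0 \<le> p f) \<and>
     p (\<lambda>_. 1) = 1"

lemma stateD:
  assumes "state p"
  shows state_add: "\<lbrakk>f \<in> V; g \<in> V\<rbrakk> \<Longrightarrow> p (\<lambda>x. f x + g x) = p f + p g"
    and state_scale: "f \<in> V \<Longrightarrow> p (\<lambda>x. c * f x) = c * p f"
    and state_nonneg: "\<lbrakk>f \<in> V; \<And>x. x \<in> X \<Longrightarrow> 0 \<le> f x\<rbrakk> \<Longrightarrow> 0 \<le> p f"
    and state_one: "p (\<lambda>_. 1) = 1"
  using assms by (simp_all add: state_def)

lemma state_const: "state p \<Longrightarrow> p (\<lambda>_. c) = c"
  using state_scale[of p "\<lambda>_. 1" c] state_one[of p] const_mem by simp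

lemma state_diff: "\<lbrakk>state p; f \<in> V; g \<in> V\<rbrakk> \<Longrightarrow> p (\<lambda>x. f x - g x) = p f - p g"
  using state_add[of p f "\<lambda>x. (-1) * g x"] state_scale[of p g "-1"] scale_mem[of g "-1"] by simp

lemma state_mono: "\<lbrakk>state p; f \<in> V; g \<in> V; \<And>x. x \<in> X \<Longrightarrow> f x \<le> g x\<rbrakk> \<Longrightarrow> p f \<le> p g"
  using state_nonneg[of p "\<lambda>x. g x - f x"] state_diff[of p g f] diff_mem[of g f] by simp

lemma state_sum:
  assumes "state p" "\<And>k. k < n \<Longrightarrow> f k \<in> V"
  shows "p (\<lambda>x. \<Sum>k<(n::nat). f k x) = (\<Sum>k<n. p (f k))"
  using assms(2)
proof (induction n)
  case 0
  show ?case using state_const[OF assms(1), of 0] by simp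
next
  case (Suc n)
  have "p (\<lambda>x. (\<Sum>k<n. f k x) + f n x) = p (\<lambda>x. \<Sum>k<n. f k x) + p (f n)"
    using Suc.prems by (intro state_add[OF assms(1)] sum_mem) auto
  then show ?case using Suc by simp
qed

text \<open>For states this is an intrinsic form of being an extreme point of the set of all states,
  in the spirit of the pure states of an operator algebra.\<close>
definition pure :: "(('x \<Rightarrow> real) \<Rightarrow> real) \<Rightarrow> bool" where
  "pure p \<longleftrightarrow> (\<forall>f\<in>V. p f = 0 \<longrightarrow>
     (\<forall>\<epsilon>>0. \<exists>g\<in>V. (\<forall>x\<in>X. 0 \<le> g x \<and> f x \<le> g x) \<and> p g \<le> \<epsilon>))"

text \<open>A cone \<open>P\<close> of this kind encodes the closed set of the states that are \<open>\<le> 0\<close> on it. The last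
  clause makes this set a face: if a mixture of states is \<open>\<le> 0\<close> on \<open>P\<close>, its value at the
  nonnegative \<open>g\<close> is at most \<open>\<epsilon>\<close>, so that each component is small at \<open>g\<close> and hence almost
  nonpositive at \<open>f \<le> g\<close>. Clause five keeps the set nonempty. Larger cones encode smaller faces.\<close>
definition split_cone :: "('x \<Rightarrow> real) set \<Rightarrow> bool" where
  "split_cone P \<longleftrightarrow>
     P \<subseteq> V \<and>
     (\<forall>f\<in>V. (\<forall>x\<in>X. f x \<le> 0) \<longrightarrow> f \<in> P) \<and>
     (\<forall>f\<in>P. \<forall>g\<in>P. (\<lambda>x. f x + g x) \<in> P) \<and>
     (\<forall>c\<ge>0. \<forall>f\<in>P. (\<lambda>x. c * f x) \<in> P) \<and>
     (\<forall>c. (\<lambda>_. c) \<in> P \<longrightarrow> c \<le> 0) \<and>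
     (\<forall>f\<in>P. \<forall>\<epsilon>>0. \<exists>g\<in>V. (\<forall>x\<in>X. 0 \<le> g x \<and> f x \<le> g x) \<and> (\<lambda>x. g x - \<epsilon>) \<in> P)"

lemma split_coneD:
  assumes "split_cone P"
  shows split_cone_mem: "f \<in> P \<Longrightarrow> f \<in> V"
    and split_cone_nonpos: "\<lbrakk>f \<in> V; \<And>x. x \<in> X \<Longrightarrow> f x \<le> 0\<rbrakk> \<Longrightarrow> f \<in> P"
    and split_cone_add: "\<lbrakk>f \<in> P; g \<in> P\<rbrakk> \<Longrightarrow> (\<lambda>x. f x + g x) \<in> P"
    and split_cone_scale: "\<lbrakk>0 \<le> c; f \<in> P\<rbrakk> \<Longrightarrow> (\<lambda>x. c * f x) \<in> P"
    and split_cone_proper: "(\<lambda>_. c) \<in> P \<Longrightarrow> c \<le> 0"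
    and split_cone_split: "\<lbrakk>f \<in> P; 0 < \<epsilon>\<rbrakk> \<Longrightarrow>
       \<exists>g\<in>V. (\<forall>x\<in>X. 0 \<le> g x \<and> f x \<le> g x) \<and> (\<lambda>x. g x - \<epsilon>) \<in> P"
  using assms by (simp_all add: split_cone_def subset_iff)

lemma split_cone_down:
  assumes P: "split_cone P" and "f \<in> P" "g \<in> V" and le: "\<And>x. x \<in> X \<Longrightarrow> g x \<le> f x"
  shows "g \<in> P"
proof -
  have "(\<lambda>x. g x - f x) \<in> P"
    using assms by (intro split_cone_nonpos[OF P] diff_mem) (auto intro: split_cone_mem[OF P])
  from split_cone_add[OF P \<open>f \<in> P\<close> this] show ?thesis by simp
qed

lemma split_cone_Union:
  assumes "\<C> \<noteq> {}" and chain: "subset.chain (Collect split_cone) \<C>"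
  shows "split_cone (\<Union>\<C>)"
proof -
  have P: "split_cone P" if "P \<in> \<C>" for P
    using chain that by (auto simp: subset.chain_def)
  have two: "\<exists>P\<in>\<C>. f \<in> P \<and> g \<in> P" if "f \<in> \<Union>\<C>" "g \<in> \<Union>\<C>" for f g
    using chain that unfolding subset.chain_def by blast
  show ?thesis
    unfolding split_cone_def
  proof (intro conjI ballI allI impI)
    show "\<Union>\<C> \<subseteq> V" using split_cone_mem[OF P] by blast
    show "f \<in> \<Union>\<C>" if "f \<in> V" "\<forall>x\<in>X. f x \<le> 0" for f
      using that \<open>\<C> \<noteq> {}\<close> split_cone_nonpos[OF P] by blast
    show "(\<lambda>x. f x + g x) \<in> \<Union>\<C>" if "f \<in> \<Union>\<C>" "g \<in> \<Union>\<C>" for f g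
      using two[OF that] split_cone_add[OF P] by blast
    show "(\<lambda>x. c * f x) \<in> \<Union>\<C>" if "0 \<le> c" "f \<in> \<Union>\<C>" for c f
      using that split_cone_scale[OF P] by blast
    show "c \<le> 0" if "(\<lambda>_. c) \<in> \<Union>\<C>" for c
      using that split_cone_proper[OF P] by blast
    show "\<exists>g\<in>V. (\<forall>x\<in>X. 0 \<le> g x \<and> f x \<le> g x) \<and> (\<lambda>x. g x - \<epsilon>) \<in> \<Union>\<C>"
      if "f \<in> \<Union>\<C>" "0 < \<epsilon>" for f \<epsilon>
      using that split_cone_split[OF P] by (meson UnionE UnionI)
  qed
qed

text \<open>If the states of the face have supremum \<open>0\<close> at \<open>h\<close>, those with value \<open>0\<close> at \<open>h\<close> form a
  smaller face. This is its cone: \<open>f\<close> is nonpositive on the smaller face when \<open>f + t h\<close> is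
  nonpositive on the larger one for some multiplier \<open>t \<ge> 0\<close>, up to arbitrarily small constants.\<close>
lemma split_cone_extend:
  assumes P: "split_cone P" and h: "h \<in> V"
    and below: "\<And>\<epsilon>. 0 < \<epsilon> \<Longrightarrow> (\<lambda>x. h x - \<epsilon>) \<in> P"
    and above: "\<And>\<epsilon>. 0 < \<epsilon> \<Longrightarrow> (\<lambda>x. h x + \<epsilon>) \<notin> P"
  defines "P' \<equiv> {f \<in> V. \<exists>t\<ge>0. \<forall>\<epsilon>>0. (\<lambda>x. f x + t * h x - \<epsilon>) \<in> P}"
  shows "split_cone P'"
  unfolding split_cone_def
proof (intro conjI ballI allI impI)
  show "P' \<subseteq> V" by (auto simp: P'_def)
next
  fix f assume f: "f \<in> V" "\<forall>x\<in>X. f x \<le> 0"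
  have "(\<lambda>x. f x - \<epsilon>) \<in> P" if "\<epsilon> > 0" for \<epsilon>
    using f that by (intro split_cone_nonpos[OF P] diff_mem const_mem) force+
  then show "f \<in> P'"
    using f by (auto simp: P'_def intro!: exI[of _ 0])
next
  fix f g assume "f \<in> P'" "g \<in> P'"
  then obtain s t where fg: "f \<in> V" "g \<in> V" and st: "0 \<le> s" "0 \<le> t"
    and f: "\<And>\<epsilon>. \<epsilon> > 0 \<Longrightarrow> (\<lambda>x. f x + s * h x - \<epsilon>) \<in> P"
    and g: "\<And>\<epsilon>. \<epsilon> > 0 \<Longrightarrow> (\<lambda>x. g x + t * h x - \<epsilon>) \<in> P"
    by (auto simp: P'_def)
  have "(\<lambda>x. f x + g x + (s + t) * h x - \<epsilon>) \<in> P" if "\<epsilon> > 0" for \<epsilon>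
    using split_cone_add[OF P f[of "\<epsilon>/2"] g[of "\<epsilon>/2"]] that by (simp add: algebra_simps)
  then show "(\<lambda>x. f x + g x) \<in> P'"
    using fg st by (auto simp: P'_def intro!: exI[of _ "s + t"] add_mem)
next
  fix c :: real and f assume c: "0 \<le> c" and "f \<in> P'"
  then obtain t where fV: "f \<in> V" and t: "0 \<le> t"
    and f: "\<And>\<epsilon>. \<epsilon> > 0 \<Longrightarrow> (\<lambda>x. f x + t * h x - \<epsilon>) \<in> P"
    by (auto simp: P'_def)
  have "(\<lambda>x. c * f x + (c * t) * h x - \<epsilon>) \<in> P" if e: "\<epsilon> > 0" for \<epsilon>
  proof (cases "c = 0")
    case True
    then show ?thesis
      using e split_cone_nonpos[OF P const_mem, of "-\<epsilon>"] by simp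
  next
    case False
    with c e split_cone_scale[OF P c f[of "\<epsilon>/c"]] show ?thesis by (simp add: algebra_simps)
  qed
  then show "(\<lambda>x. c * f x) \<in> P'"
    using fV t c by (auto simp: P'_def intro!: exI[of _ "c * t"] scale_mem)
next
  fix c :: real assume "(\<lambda>_. c) \<in> P'"
  then obtain t where t: "0 \<le> t" and *: "\<And>\<epsilon>. \<epsilon> > 0 \<Longrightarrow> (\<lambda>x. c + t * h x - \<epsilon>) \<in> P"
    by (auto simp: P'_def)
  show "c \<le> 0"
  proof (rule ccontr)
    assume c: "\<not> c \<le> 0"
    show False
    proof (cases "t = 0")
      case True
      with *[of "c/2"] split_cone_proper[OF P, of "c/2"] c show ?thesis by simp
    next
      case False
      with t have t: "t > 0" by simp
      have "(\<lambda>x. (1/t) * (c + t * h x - c/2)) \<in> P"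
        using t c by (intro split_cone_scale[OF P] *) auto
      moreover have "(\<lambda>x. (1/t) * (c + t * h x - c/2)) = (\<lambda>x. h x + c / (2*t))"
        using t by (simp add: field_simps)
      ultimately show ?thesis
        using above[of "c/(2*t)"] t c by simp
    qed
  qed
next
  fix f and \<delta> :: real assume "f \<in> P'" and \<delta>: "0 < \<delta>"
  then obtain t where fV: "f \<in> V" and t: "0 \<le> t"
    and f: "\<And>\<epsilon>. \<epsilon> > 0 \<Longrightarrow> (\<lambda>x. f x + t * h x - \<epsilon>) \<in> P"
    by (auto simp: P'_def)
  define \<epsilon> where "\<epsilon> = \<delta> / (2 * (1 + t))"
  have \<epsilon>: "0 < \<epsilon>" using \<delta> t by (simp add: \<epsilon>_def)
  have \<epsilon>\<delta>: "2 * \<epsilon> + 2 * t * \<epsilon> = \<delta>"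
  proof -
    have "2 * (1 + t) * \<epsilon> = \<delta>" using t by (simp add: \<epsilon>_def)
    then show ?thesis by (simp add: algebra_simps)
  qed
  obtain g1 where g1: "g1 \<in> V" "\<forall>x\<in>X. 0 \<le> g1 x \<and> f x + t * h x - \<epsilon> \<le> g1 x"
    and g1P: "(\<lambda>x. g1 x - \<epsilon>) \<in> P"
    using split_cone_split[OF P f[OF \<epsilon>] \<epsilon>] by auto
  obtain g2 where g2: "g2 \<in> V" "\<forall>x\<in>X. 0 \<le> g2 x \<and> h x - \<epsilon> \<le> g2 x"
    and g2P: "(\<lambda>x. g2 x - \<epsilon>) \<in> P"
    using split_cone_split[OF P below[OF \<epsilon>] \<epsilon>] by auto
  \<comment> \<open>\<open>g1\<close> majorizes \<open>f + t h\<close>, not \<open>f\<close>. Since \<open>h\<close> is approximately below the almost null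
    \<open>g2\<close>, adding the nonnegative \<open>t (g2 - h)\<close> corrects this.\<close>
  define G where "G = (\<lambda>x. g1 x + \<epsilon> + t * (g2 x + \<epsilon> - h x))"
  have GV: "G \<in> V"
    unfolding G_def by (intro add_mem scale_mem diff_mem const_mem g1 g2 h)
  have "0 \<le> G x \<and> f x \<le> G x" if "x \<in> X" for x
  proof -
    have "0 \<le> t * (g2 x + \<epsilon> - h x)" "0 \<le> t * g2 x" "0 \<le> t * \<epsilon>"
      using g2 that t \<epsilon> by (auto intro!: mult_nonneg_nonneg simp: diff_le_eq)
    moreover have "0 \<le> g1 x" "f x + t * h x - \<epsilon> \<le> g1 x"
      using g1 that by auto
    ultimately show ?thesis
      using \<epsilon> by (auto simp: G_def algebra_simps)
  qed
  moreover have "(\<lambda>x. G x - \<delta>) \<in> P'"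
  proof -
    have "(\<lambda>x. (G x - \<delta>) + t * h x - \<eta>) \<in> P" if "\<eta> > 0" for \<eta>
    proof (rule split_cone_down[OF P])
      show "(\<lambda>x. (g1 x - \<epsilon>) + t * (g2 x - \<epsilon>)) \<in> P"
        using t by (intro split_cone_add[OF P] split_cone_scale[OF P] g1P g2P) 
      show "(\<lambda>x. (G x - \<delta>) + t * h x - \<eta>) \<in> V"
        by (intro diff_mem add_mem scale_mem GV h const_mem)
      show "G x - \<delta> + t * h x - \<eta> \<le> g1 x - \<epsilon> + t * (g2 x - \<epsilon>)" for x
        using \<epsilon>\<delta> that by (simp add: G_def algebra_simps)
    qed
    then show ?thesis
      using t by (auto simp: P'_def intro!: exI[of _ t] diff_mem GV const_mem)
  qed
  ultimately show "\<exists>g\<in>V. (\<forall>x\<in>X. 0 \<le> g x \<and> f x \<le> g x) \<and> (\<lambda>x. g x - \<delta>) \<in> P'"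
    using GV by blast
qed

text \<open>For a maximal cone \<open>P\<close> the extension of \<open>split_cone_extend\<close> is \<open>P\<close> itself, which puts
  \<open>- h\<close> into \<open>P\<close>. So every \<open>f\<close> differs by a constant from an element of the lineality space
  of \<open>P\<close>, and that constant is \<open>p f\<close>. Purity of \<open>p\<close> is the last clause of
  \<open>split_cone\<close>.\<close>
theorem ex_pure_state:
  assumes P0: "split_cone P0"
  shows "\<exists>p. state p \<and> pure p \<and> (\<forall>f\<in>P0. p f \<le> 0)"
proof -
  let ?A = "{P. split_cone P \<and> P0 \<subseteq> P}"
  have "\<exists>P\<in>?A. \<forall>Q\<in>?A. P \<subseteq> Q \<longrightarrow> Q = P"
  proof (rule subset_Zorn_nonempty)
    show "?A \<noteq> {}" using P0 by blast
    show "\<Union>\<C> \<in> ?A" if "\<C> \<noteq> {}" "subset.chain ?A \<C>" for \<C>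
      using split_cone_Union[of \<C>] that unfolding subset.chain_def by blast
  qed
  then obtain P where "P \<in> ?A" and max': "\<forall>Q\<in>?A. P \<subseteq> Q \<longrightarrow> Q = P"
    by (rule bexE)
  then have P: "split_cone P" and "P0 \<subseteq> P" by simp_all
  have max: "Q = P" if "split_cone Q" "P \<subseteq> Q" for Q
    using max' that \<open>P0 \<subseteq> P\<close> by auto
  note [intro] = split_cone_mem[OF P]
  have null: "h \<in> P \<and> (\<lambda>x. - h x) \<in> P"
    if h: "h \<in> V" and below: "\<And>\<epsilon>. 0 < \<epsilon> \<Longrightarrow> (\<lambda>x. h x - \<epsilon>) \<in> P"
      and above: "\<And>\<epsilon>. 0 < \<epsilon> \<Longrightarrow> (\<lambda>x. h x + \<epsilon>) \<notin> P" for h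
  proof -
    let ?P' = "{f \<in> V. \<exists>t\<ge>0. \<forall>\<epsilon>>0. (\<lambda>x. f x + t * h x - \<epsilon>) \<in> P}"
    have neg: "(\<lambda>x. - \<epsilon>) \<in> P" if "\<epsilon> > 0" for \<epsilon>
      using that by (intro split_cone_nonpos[OF P] const_mem) auto
    have "P \<subseteq> ?P'"
    proof
      fix f assume f: "f \<in> P"
      have "(\<lambda>x. f x - \<epsilon>) \<in> P" if "\<epsilon> > 0" for \<epsilon>
        using split_cone_add[OF P f neg[OF that]] by simp
      then show "f \<in> ?P'"
        using f by (auto intro!: exI[of _ 0])
    qed
    with split_cone_extend[OF P h below above] have eq: "?P' = P"
      by (intro max) 
    have "h \<in> ?P'"
      using h below by (auto intro!: exI[of _ 0])
    moreover have "(\<lambda>x. - h x) \<in> ?P'"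
      using diff_mem[OF const_mem[of 0] h] neg by (auto intro!: exI[of _ 1])
    ultimately show ?thesis unfolding eq by blast
  qed
  have ex: "\<exists>r. (\<lambda>x. f x - r) \<in> P \<and> (\<lambda>x. r - f x) \<in> P" if f: "f \<in> V" for f
  proof -
    \<comment> \<open>The constant is the supremum of \<open>f\<close> over the face.\<close>
    let ?R = "{r. (\<lambda>x. f x - r) \<in> P}"
    obtain B where B: "\<And>x. x \<in> X \<Longrightarrow> \<bar>f x\<bar> \<le> B" using bounded_mem[OF f] by blast
    have "B \<in> ?R"
      using B by (auto intro!: split_cone_nonpos[OF P] diff_mem f const_mem simp: abs_le_iff)
    have lower: "- B \<le> r" if "r \<in> ?R" for r
    proof -
      have "(\<lambda>x. - B - f x) \<in> P"
        using B by (intro split_cone_nonpos[OF P] diff_mem f const_mem) (force simp: abs_le_iff)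
      with that have "(\<lambda>x. (f x - r) + (- B - f x)) \<in> P"
        by (intro split_cone_add[OF P]) auto
      then show ?thesis using split_cone_proper[OF P, of "- r - B"] by simp
    qed
    define r where "r = Inf ?R"
    have bdd: "bdd_below ?R" using lower by (meson bdd_belowI)
    have "(\<lambda>x. f x - r) \<in> P \<and> (\<lambda>x. - (f x - r)) \<in> P"
    proof (rule null)
      show "(\<lambda>x. f x - r) \<in> V" by (intro diff_mem f const_mem)
      fix \<epsilon> :: real assume \<epsilon>: "0 < \<epsilon>"
      then have "Inf ?R < r + \<epsilon>" by (simp add: r_def)
      then obtain s where s: "s \<in> ?R" "s < r + \<epsilon>"
        using \<open>B \<in> ?R\<close> cInf_lessD[of ?R "r + \<epsilon>"] by blast
      show "(\<lambda>x. f x - r - \<epsilon>) \<in> P"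
        using s diff_mem[OF diff_mem[OF f const_mem] const_mem]
        by (auto intro: split_cone_down[OF P, of "\<lambda>x. f x - s"])
      show "(\<lambda>x. f x - r + \<epsilon>) \<notin> P"
      proof
        assume "(\<lambda>x. f x - r + \<epsilon>) \<in> P"
        then have "r - \<epsilon> \<in> ?R" by (simp add: algebra_simps)
        then have "r \<le> r - \<epsilon>" unfolding r_def by (rule cInf_lower) (rule bdd)
        with \<epsilon> show False by simp
      qed
    qed
    then show ?thesis by auto
  qed
  have unique: "r = s" if "(\<lambda>x. f x - r) \<in> P" "(\<lambda>x. r - f x) \<in> P"
    "(\<lambda>x. f x - s) \<in> P" "(\<lambda>x. s - f x) \<in> P" for f r s
  proof -
    have "(\<lambda>x. (f x - r) + (s - f x)) \<in> P" "(\<lambda>x. (f x - s) + (r - f x)) \<in> P"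
      by (intro split_cone_add[OF P] that)+
    then show ?thesis
      using split_cone_proper[OF P, of "s - r"] split_cone_proper[OF P, of "r - s"] by simp
  qed
  define p where "p f = (THE r. (\<lambda>x. f x - r) \<in> P \<and> (\<lambda>x. r - f x) \<in> P)" for f
  have p_eqI: "p f = r" if "(\<lambda>x. f x - r) \<in> P" "(\<lambda>x. r - f x) \<in> P" for f r
    unfolding p_def using that unique by (intro the_equality) blast+
  have p: "(\<lambda>x. f x - p f) \<in> P \<and> (\<lambda>x. p f - f x) \<in> P" if "f \<in> V" for f
    using ex[OF that] p_eqI by blast
  have p_le: "p f \<le> 0" if f: "f \<in> P" for f
  proof -
    have "(\<lambda>x. f x + (p f - f x)) \<in> P"
      using f p[of f] by (intro split_cone_add[OF P]) auto
    then show ?thesis using split_cone_proper[OF P] by simp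
  qed
  have p_add: "p (\<lambda>x. f x + g x) = p f + p g" if "f \<in> V" "g \<in> V" for f g
  proof (rule p_eqI)
    show "(\<lambda>x. f x + g x - (p f + p g)) \<in> P"
      using split_cone_add[OF P, of "\<lambda>x. f x - p f" "\<lambda>x. g x - p g"] p that
      by (simp add: algebra_simps)
    show "(\<lambda>x. p f + p g - (f x + g x)) \<in> P"
      using split_cone_add[OF P, of "\<lambda>x. p f - f x" "\<lambda>x. p g - g x"] p that
      by (simp add: algebra_simps)
  qed
  have p_scale: "p (\<lambda>x. c * f x) = c * p f" if "f \<in> V" for c f
  proof (cases "0 \<le> c")
    case True
    then show ?thesis
      using split_cone_scale[OF P, of c "\<lambda>x. f x - p f"] split_cone_scale[OF P, of c "\<lambda>x. p f - f x"] p[OF that]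
      by (intro p_eqI) (simp_all add: algebra_simps)
  next
    case False
    then show ?thesis
      using split_cone_scale[OF P, of "-c" "\<lambda>x. f x - p f"] split_cone_scale[OF P, of "-c" "\<lambda>x. p f - f x"] p[OF that]
      by (intro p_eqI) (simp_all add: algebra_simps)
  qed
  have p_const: "p (\<lambda>_. c) = c" for c
    using split_cone_nonpos[OF P const_mem, of 0] by (intro p_eqI) auto
  have "state p"
    unfolding state_def
  proof (intro conjI ballI allI impI)
    fix f assume f: "f \<in> V" "\<forall>x\<in>X. 0 \<le> f x"
    have "p (\<lambda>x. (-1) * f x) \<le> 0"
      using f by (intro p_le split_cone_nonpos[OF P] scale_mem) auto
    with p_scale[OF f(1), of "-1"] show "0 \<le> p f" by simp
  qed (use p_add p_scale p_const in auto)
  moreover have "pure p"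
    unfolding pure_def
  proof (intro ballI impI allI)
    fix f and \<epsilon> :: real assume f: "f \<in> V" "p f = 0" and \<epsilon>: "0 < \<epsilon>"
    have "f \<in> P" using p[OF f(1)] f(2) by simp
    then obtain g where g: "g \<in> V" "\<forall>x\<in>X. 0 \<le> g x \<and> f x \<le> g x" "(\<lambda>x. g x - \<epsilon>) \<in> P"
      using split_cone_split[OF P _ \<epsilon>] by blast
    have "p (\<lambda>x. g x + - \<epsilon>) \<le> 0" using g p_le by simp
    then have "p g \<le> \<epsilon>" using p_add[OF g(1) const_mem, of "- \<epsilon>"] p_const[of "- \<epsilon>"] by simp
    with g show "\<exists>g\<in>V. (\<forall>x\<in>X. 0 \<le> g x \<and> f x \<le> g x) \<and> p g \<le> \<epsilon>" by blast
  qed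
  ultimately show ?thesis
    using p_le \<open>P0 \<subseteq> P\<close> by blast
qed

end


section \<open>Metric completions and extension of Lipschitz maps\<close>

text \<open>A point of the completion is determined by a sequence that converges to it, which bounds the
  number of points: any type with room for all sequences can carry the completion.\<close>
lemma metric_completion_embedded:
  fixes D :: "'i \<Rightarrow> 'i \<Rightarrow> real" and j :: "(nat \<Rightarrow> 'i) \<Rightarrow> 'u"
  assumes D0: "\<And>x. D x x = 0" and Dpos: "\<And>x y. 0 \<le> D x y" and Dsym: "\<And>x y. D x y = D y x"
    and Dtri: "\<And>x y z. D x z \<le> D x y + D y z" and j: "inj j"
  obtains Q d and e :: "'i \<Rightarrow> 'u" where "Metric_space Q d" "Metric_space.mcomplete Q d"
    "\<And>x. e x \<in> Q" "\<And>x y. d (e x) (e y) = D x y"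
    "\<And>q \<epsilon>. \<lbrakk>q \<in> Q; 0 < \<epsilon>\<rbrakk> \<Longrightarrow> \<exists>x. d q (e x) < \<epsilon>"
proof -
  \<comment> \<open>\<open>\<rho>\<close> picks representatives of the points at distance \<open>0\<close>, so that \<open>D\<close> is a metric on its range.\<close>
  define \<rho> where "\<rho> x = (SOME y. D x y = 0)" for x
  have \<rho>0: "D x (\<rho> x) = 0" for x
    unfolding \<rho>_def by (rule someI[of _ x]) (rule D0)
  have D\<rho>: "D (\<rho> x) (\<rho> y) = D x y" for x y
    using Dtri[of x y "\<rho> x"] Dtri[of "\<rho> x" y "\<rho> y"] Dtri[of "\<rho> x" "\<rho> y" y]
      Dtri[of "\<rho> x" y x] \<rho>0[of x] \<rho>0[of y] Dsym[of x "\<rho> x"] Dsym[of y "\<rho> y"] by linarith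
  have \<rho>_eq: "\<rho> x = \<rho> y" if "D x y = 0" for x y
  proof -
    have "D x z = D y z" for z
      using Dtri[of x z y] Dtri[of y z x] that Dsym[of x y] by linarith
    then show ?thesis by (simp add: \<rho>_def)
  qed
  interpret R: Metric_space "range \<rho>" D
  proof
    show "0 \<le> D x y" "D x y = D y x" for x y by (fact Dpos, fact Dsym)
    show "D x z \<le> D x y + D y z" for x y z by (fact Dtri)
    show "D x y = 0 \<longleftrightarrow> x = y" if "x \<in> range \<rho>" "y \<in> range \<rho>" for x y
    proof -
      from that obtain a b where ab: "x = \<rho> a" "y = \<rho> b" by blast
      then show ?thesis using D\<rho>[of a b] \<rho>_eq[of a b] by (auto simp: D0)
    qed
  qed
  obtain f :: "['i,'i] \<Rightarrow> real" and m where complete: "mcomplete_of m"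
    and f: "f \<in> range \<rho> \<rightarrow> mspace m" and dense: "mtopology_of m closure_of f ` range \<rho> = mspace m"
    and fd: "\<And>x y. \<lbrakk>x \<in> range \<rho>; y \<in> range \<rho>\<rbrakk> \<Longrightarrow> Abstract_Metric_Spaces.mdist m (f x) (f y) = D x y"
    using R.metric_completion by metis
  interpret S: Metric_space "mspace m" "Abstract_Metric_Spaces.mdist m" by simp
  have near: "\<exists>x. Abstract_Metric_Spaces.mdist m q (f (\<rho> x)) < \<epsilon>" if "q \<in> mspace m" "0 < \<epsilon>" for q \<epsilon>
  proof -
    have "q \<in> S.mtopology closure_of f ` range \<rho>"
      using dense that by (simp add: mtopology_of_def)
    then show ?thesis
      using that by (auto simp: S.metric_closure_of)
  qed
  have "\<exists>s. \<forall>k::nat. Abstract_Metric_Spaces.mdist m q (f (\<rho> (s k))) < 1 / Suc k" if "q \<in> mspace m" for q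
    using near[OF that] by (intro choice allI) auto
  then obtain s where s: "\<And>q k. q \<in> mspace m \<Longrightarrow> Abstract_Metric_Spaces.mdist m q (f (\<rho> (s q k))) < 1 / Suc k"
    by metis
  define E where "E q = j (s q)" for q
  have inj: "inj_on E (mspace m)"
  proof
    fix q r assume qr: "q \<in> mspace m" "r \<in> mspace m" "E q = E r"
    then have "s q = s r" using j by (simp add: E_def inj_eq)
    have "Abstract_Metric_Spaces.mdist m q r \<le> 2 * (1 / Suc k)" for k
    proof -
      have "Abstract_Metric_Spaces.mdist m q r \<le> Abstract_Metric_Spaces.mdist m q (f (\<rho> (s q k))) + Abstract_Metric_Spaces.mdist m (f (\<rho> (s q k))) r"
        using qr f by (intro S.triangle) auto
      also have "Abstract_Metric_Spaces.mdist m (f (\<rho> (s q k))) r = Abstract_Metric_Spaces.mdist m r (f (\<rho> (s r k)))"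
        using \<open>s q = s r\<close> S.commute by simp
      finally show ?thesis using s[OF qr(1), of k] s[OF qr(2), of k] by linarith
    qed
    moreover have "(\<lambda>k. 2 * (1 / real (Suc k))) \<longlonglongrightarrow> 2 * 0"
      by (intro tendsto_intros LIMSEQ_Suc[OF lim_1_over_n])
    ultimately have "Abstract_Metric_Spaces.mdist m q r \<le> 2 * 0"
      by (intro LIMSEQ_le_const) auto
    then have "Abstract_Metric_Spaces.mdist m q r = 0" using S.nonneg[of q r] by linarith
    then show "q = r" using qr by simp
  qed
  define E' where "E' = the_inv_into (mspace m) E"
  have E': "E' (E q) = q" if "q \<in> mspace m" for q
    using that inj by (simp add: E'_def the_inv_into_f_f)
  define d where "d x y = Abstract_Metric_Spaces.mdist m (E' x) (E' y)" for x y
  define Q where "Q = E ` mspace m"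
  define e where "e x = E (f (\<rho> x))" for x
  have M: "Metric_space Q d"
    by unfold_locales (auto simp: d_def Q_def E' S.commute S.triangle)
  interpret Q: Metric_space Q d by (rule M)
  have "Q.mcomplete"
    unfolding Q.mcomplete_def
  proof (intro allI impI)
    fix \<sigma> assume \<sigma>: "Q.MCauchy \<sigma>"
    then have \<sigma>Q: "\<sigma> n \<in> Q" for n by (auto simp: Q.MCauchy_def)
    have E'Q: "E' x \<in> mspace m" if "x \<in> Q" for x using that by (auto simp: Q_def E')
    have "S.MCauchy (E' \<circ> \<sigma>)"
      using \<sigma> E'Q \<sigma>Q by (auto simp: S.MCauchy_def Q.MCauchy_def d_def)
    then obtain x where x: "limitin S.mtopology (E' \<circ> \<sigma>) x sequentially"
      using complete by (auto simp: mcomplete_of_def S.mcomplete_def)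
    then have "limitin Q.mtopology \<sigma> (E x) sequentially"
      using \<sigma>Q unfolding S.limit_metric_sequentially Q.limit_metric_sequentially
      by (auto simp: d_def E' Q_def) blast
    then show "\<exists>x. limitin Q.mtopology \<sigma> x sequentially" ..
  qed
  moreover have "e x \<in> Q" for x using f by (auto simp: e_def Q_def)
  moreover have "d (e x) (e y) = D x y" for x y
    using f by (auto simp: d_def e_def E' Pi_iff fd D\<rho>)
  moreover have "\<exists>x. d q (e x) < \<epsilon>" if "q \<in> Q" "0 < \<epsilon>" for q \<epsilon>
    using that near f by (auto simp: d_def Q_def e_def E' Pi_iff)
  ultimately show thesis using M by (intro that[of Q d e])
qed

text \<open>The value at a new point of the Lipschitz extension of a map \<open>G\<close> defined on a dense set.
  The new point and the space it lives in enter only through the distances \<open>c b\<close> to the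
  dense points \<open>b\<close>, so that one statement covers tuples of any length.\<close>
lemma (in Metric_space) lipschitz_limit:
  fixes G :: "'b \<Rightarrow> 'a" and c :: "'b \<Rightarrow> real" and l :: real
  assumes "mcomplete" "0 \<le> l" and mem: "\<And>b. b \<in> B \<Longrightarrow> G b \<in> M"
    and lip: "\<And>b b'. \<lbrakk>b \<in> B; b' \<in> B\<rbrakk> \<Longrightarrow> d (G b) (G b') \<le> l * (c b + c b')"
    and near: "\<And>\<epsilon>. 0 < \<epsilon> \<Longrightarrow> \<exists>b\<in>B. c b < \<epsilon>"
  shows "\<exists>y\<in>M. \<forall>b\<in>B. d y (G b) \<le> l * c b"
proof -
  have "\<exists>s. \<forall>k::nat. s k \<in> B \<and> c (s k) < 1 / Suc k"
    using near by (intro choice allI) (metis divide_pos_pos of_nat_0_less_iff zero_less_Suc zero_less_one)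
  then obtain s where s: "\<And>k::nat. s k \<in> B" "\<And>k. c (s k) < 1 / Suc k" by blast
  have 1: "(\<lambda>k. l * (c0 + 1 / real (Suc k))) \<longlonglongrightarrow> l * (c0 + 0)" for c0
    by (intro tendsto_intros LIMSEQ_Suc[OF lim_1_over_n])
  have "MCauchy (G \<circ> s)"
    unfolding MCauchy_def
  proof (intro conjI allI impI)
    show "range (G \<circ> s) \<subseteq> M" using s mem by auto
    fix \<epsilon> :: real assume "0 < \<epsilon>"
    have "(\<lambda>k. 2 * (l * (0 + 1 / real (Suc k)))) \<longlonglongrightarrow> 2 * (l * (0 + 0))"
      by (intro tendsto_mult_left 1)
    then have "\<forall>\<^sub>F k in sequentially. 2 * (l * (0 + 1 / real (Suc k))) < \<epsilon>"
      using \<open>0 < \<epsilon>\<close> by (intro order_tendstoD) auto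
    then obtain N where N: "2 * (l * (0 + 1 / real (Suc N))) < \<epsilon>"
      by (auto simp: eventually_sequentially)
    have "d ((G \<circ> s) n) ((G \<circ> s) n') < \<epsilon>" if "N \<le> n" "N \<le> n'" for n n'
    proof -
      have "c (s k) \<le> 1 / Suc N" if "N \<le> k" for k
        using s(2)[of k] that by (smt (verit) frac_le of_nat_0_less_iff of_nat_le_iff Suc_le_mono zero_less_Suc)
      then have "c (s n) + c (s n') \<le> 2 * (1 / Suc N)"
        using that by (smt (verit))
      then have "l * (c (s n) + c (s n')) \<le> l * (2 * (1 / Suc N))"
        using \<open>0 \<le> l\<close> by (rule mult_left_mono)
      also have "l * (2 * (1 / Suc N)) < \<epsilon>"
        using N by (simp add: mult.commute)
      finally show ?thesis
        using lip[OF s(1)[of n] s(1)[of n']] by simp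
    qed
    then show "\<exists>N. \<forall>n n'. N \<le> n \<longrightarrow> N \<le> n' \<longrightarrow> d ((G \<circ> s) n) ((G \<circ> s) n') < \<epsilon>" by blast
  qed
  then obtain y where y: "limitin mtopology (G \<circ> s) y sequentially"
    using \<open>mcomplete\<close> by (auto simp: mcomplete_def)
  then have "y \<in> M" using limit_metric_sequentially by blast
  have "d y (G b) \<le> l * c b" if b: "b \<in> B" for b
  proof (rule field_le_epsilon)
    fix \<epsilon> :: real assume \<epsilon>: "0 < \<epsilon>"
    obtain N1 where N1: "\<And>n. n \<ge> N1 \<Longrightarrow> d (G (s n)) y < \<epsilon>/2"
      using y \<epsilon> unfolding limit_metric_sequentially by (metis comp_apply half_gt_zero)
    have "\<forall>\<^sub>F k in sequentially. l * (c b + 1 / real (Suc k)) < l * c b + \<epsilon>/2"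
      using \<epsilon> by (intro order_tendstoD[OF 1]) auto
    then obtain N2 where N2: "\<And>k. k \<ge> N2 \<Longrightarrow> l * (c b + 1 / real (Suc k)) < l * c b + \<epsilon>/2"
      by (auto simp: eventually_sequentially)
    define n where "n = max N1 N2"
    have "d y (G b) \<le> d y (G (s n)) + d (G (s n)) (G b)"
      using \<open>y \<in> M\<close> mem s b by (intro triangle) auto
    also have "d (G (s n)) (G b) \<le> l * (c (s n) + c b)"
      by (rule lip) (use s b in auto)
    also have "\<dots> \<le> l * (c b + 1 / real (Suc n))"
      using s(2)[of n] \<open>0 \<le> l\<close> by (intro mult_left_mono) auto
    finally show "d y (G b) \<le> l * c b + \<epsilon>"
      using N1[of n] N2[of n] commute[of y] by (simp add: n_def)
  qed
  with \<open>y \<in> M\<close> show ?thesis by blast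
qed

text \<open>The values obtained from \<open>lipschitz_limit\<close> at two points at distance \<open>t\<close> satisfy the
  Lipschitz estimate.\<close>
lemma (in Metric_space) lipschitz_limits_dist:
  fixes G :: "'b \<Rightarrow> 'a" and c c' :: "'b \<Rightarrow> real" and l t :: real
  assumes "0 \<le> l" "y \<in> M" "y' \<in> M" and mem: "\<And>b. b \<in> B \<Longrightarrow> G b \<in> M"
    and y: "\<And>b. b \<in> B \<Longrightarrow> d y (G b) \<le> l * c b" and y': "\<And>b. b \<in> B \<Longrightarrow> d y' (G b) \<le> l * c' b"
    and c': "\<And>b. b \<in> B \<Longrightarrow> c' b \<le> t + c b"
    and near: "\<And>\<epsilon>. 0 < \<epsilon> \<Longrightarrow> \<exists>b\<in>B. c b < \<epsilon>"
  shows "d y y' \<le> l * t"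
proof (rule field_le_epsilon)
  fix \<epsilon> :: real assume \<epsilon>: "0 < \<epsilon>"
  then have "0 < \<epsilon> / (2 * l + 1)" using \<open>0 \<le> l\<close> by (intro divide_pos_pos) auto
  from near[OF this] obtain b where b: "b \<in> B" "c b < \<epsilon> / (2 * l + 1)" by blast
  have "2 * l * c b \<le> 2 * l * (\<epsilon> / (2 * l + 1))"
    using b \<open>0 \<le> l\<close> by (intro mult_left_mono) auto
  also have "\<dots> \<le> \<epsilon>" using \<open>0 \<le> l\<close> \<epsilon> by (simp add: field_simps)
  finally have small: "2 * l * c b \<le> \<epsilon>" .
  have "d y y' \<le> d y (G b) + d (G b) y'"
    using assms b by (intro triangle) auto
  also have "\<dots> \<le> l * c b + l * c' b"
    using y[OF b(1)] y'[OF b(1)] commute[of "G b"] by simp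
  also have "\<dots> \<le> l * c b + l * (t + c b)"
    using c'[OF b(1)] \<open>0 \<le> l\<close> by (intro add_left_mono mult_left_mono)
  finally show "d y y' \<le> l * t + \<epsilon>" using small by (simp add: algebra_simps)
qed


section \<open>Renaming, formulas and their moduli of continuity\<close>

fun tren :: "(nat \<Rightarrow> nat) \<Rightarrow> ('c, 'f) trm \<Rightarrow> ('c, 'f) trm" where
  "tren f (Var i) = Var (f i)"
| "tren f (Cst c) = Cst c"
| "tren f (App F ts) = App F (map (tren f) ts)"

fun fren :: "(nat \<Rightarrow> nat) \<Rightarrow> ('c, 'f, 'r) fm \<Rightarrow> ('c, 'f, 'r) fm" where
  "fren f (Num r) = Num r"
| "fren f (Dist s t) = Dist (tren f s) (tren f t)"
| "fren f (Rel R ts) = Rel R (map (tren f) ts)"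
| "fren f (Scale r \<phi>) = Scale r (fren f \<phi>)"
| "fren f (Add \<phi> \<psi>) = Add (fren f \<phi>) (fren f \<psi>)"
| "fren f (SupF i \<phi>) = SupF (f i) (fren f \<phi>)"
| "fren f (InfF i \<phi>) = InfF (f i) (fren f \<phi>)"

lemma wf_tren [simp]: "wf_trm L (tren f t) = wf_trm L t"
  by (induction t) auto

lemma tvars_tren [simp]: "tvars (tren f t) = f ` tvars t"
  by (induction t) auto

lemma teval_tren [simp]: "teval M v (tren f t) = teval M (v \<circ> f) t"
  by (induction t) (simp_all cong: map_cong)

lemma wf_fren [simp]: "wf_fm L (fren f \<phi>) = wf_fm L \<phi>"
  by (induction \<phi>) auto

lemma fvars_fren: "inj f \<Longrightarrow> fvars (fren f \<phi>) = f ` fvars \<phi>"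
  by (induction \<phi>) (auto simp: image_Un inj_image_mem_iff dest: injD)

text \<open>Bound variables are renamed together with the free ones, so an injective renaming cannot
  capture a variable.\<close>
lemma feval_fren: "inj f \<Longrightarrow> feval M v (fren f \<phi>) = feval M (v \<circ> f) \<phi>"
proof (induction \<phi> arbitrary: v)
  case (SupF i \<phi>)
  have "v(f i := a) \<circ> f = (v \<circ> f)(i := a)" for a
    using SupF.prems by (auto simp: fun_eq_iff inj_eq)
  then have "feval M (v(f i := a)) (fren f \<phi>) = feval M ((v \<circ> f)(i := a)) \<phi>" for a
    by (simp only: SupF.IH[OF SupF.prems])
  then show ?case by (simp only: fren.simps feval.simps)
next
  case (InfF i \<phi>)
  have "v(f i := a) \<circ> f = (v \<circ> f)(i := a)" for a
    using InfF.prems by (auto simp: fun_eq_iff inj_eq)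
  then have "feval M (v(f i := a)) (fren f \<phi>) = feval M ((v \<circ> f)(i := a)) \<phi>" for a
    by (simp only: InfF.IH[OF InfF.prems])
  then show ?case by (simp only: fren.simps feval.simps)
qed (simp_all add: comp_def)

lemma teval_cong: "(\<And>k. k \<in> tvars t \<Longrightarrow> v k = w k) \<Longrightarrow> teval M v t = teval M w t"
proof (induction t)
  case (App F ts)
  have "map (teval M v) ts = map (teval M w) ts"
    by (intro map_cong refl App.IH) (use App.prems in auto)
  then show ?case by (simp only: teval.simps)
qed auto

lemma map_teval_cong:
  assumes "\<And>k. k \<in> (\<Union>t\<in>set ts. tvars t) \<Longrightarrow> v k = w k"
  shows "map (teval M v) ts = map (teval M w) ts"
  using assms by (intro map_cong refl teval_cong) auto

lemma feval_cong: "(\<And>k. k \<in> fvars \<phi> \<Longrightarrow> v k = w k) \<Longrightarrow> feval M v \<phi> = feval M w \<phi>"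
proof (induction \<phi> arbitrary: v w)
  case (Dist s t)
  have "teval M v s = teval M w s" "teval M v t = teval M w t"
    by (rule teval_cong, use Dist.prems in auto)+
  then show ?case by simp
next
  case (Rel R ts)
  then have "map (teval M v) ts = map (teval M w) ts"
    by (intro map_teval_cong) auto
  then show ?case by (simp only: feval.simps)
next
  case (Add \<phi> \<psi>)
  have "feval M v \<phi> = feval M w \<phi>" "feval M v \<psi> = feval M w \<psi>"
    by (rule Add.IH, use Add.prems in auto)+
  then show ?case by simp
next
  case (SupF i \<phi>)
  have "feval M (v(i := a)) \<phi> = feval M (w(i := a)) \<phi>" for a
    by (rule SupF.IH) (use SupF.prems in auto)
  then show ?case by simp
next
  case (InfF i \<phi>)
  have "feval M (v(i := a)) \<phi> = feval M (w(i := a)) \<phi>" for a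
    by (rule InfF.IH) (use InfF.prems in auto)
  then show ?case by simp
next
  case (Scale r \<phi>)
  have "feval M v \<phi> = feval M w \<phi>"
    by (rule Scale.IH) (use Scale.prems in auto)
  then show ?case by simp
qed simp

lemma finite_tvars [simp]: "finite (tvars t)"
  by (induction t) auto

lemma finite_fvars [simp]: "finite (fvars \<phi>)"
  by (induction \<phi>) auto

lemma ex_fvars_bound: "\<exists>n. fvars \<phi> \<subseteq> {..<n}"
  using finite_nat_iff_bounded[of "fvars \<phi>"] by simp

fun sum_fm :: "('c, 'f, 'r) fm list \<Rightarrow> ('c, 'f, 'r) fm" where
  "sum_fm [] = Num 0"
| "sum_fm (\<phi> # \<phi>s) = Add \<phi> (sum_fm \<phi>s)"

lemma wf_sum_fm [simp]: "wf_fm L (sum_fm \<phi>s) \<longleftrightarrow> (\<forall>\<phi>\<in>set \<phi>s. wf_fm L \<phi>)"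
  by (induction \<phi>s) auto

lemma fvars_sum_fm [simp]: "fvars (sum_fm \<phi>s) = (\<Union>\<phi>\<in>set \<phi>s. fvars \<phi>)"
  by (induction \<phi>s) auto

lemma feval_sum_fm [simp]: "feval M v (sum_fm \<phi>s) = (\<Sum>\<phi>\<leftarrow>\<phi>s. feval M v \<phi>)"
  by (induction \<phi>s) auto

lemma wf_foldr_InfF [simp]: "wf_fm L (foldr InfF ks \<phi>) = wf_fm L \<phi>"
  by (induction ks) auto

lemma fvars_foldr_InfF [simp]: "fvars (foldr InfF ks \<phi>) = fvars \<phi> - set ks"
  by (induction ks) auto

locale lstructure =
  fixes L :: "('c, 'f, 'r) language" and M :: "('c, 'f, 'r, 'u) lstruct"
  assumes language: "is_language L" and is_struct: "is_structure L M"
begin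

sublocale Metric_space "dom M" "mdist M"
  using is_struct by (simp add: is_structure_def)

lemma dom_nonempty: "dom M \<noteq> {}"
  and mdist_le_1: "\<lbrakk>x \<in> dom M; y \<in> dom M\<rbrakk> \<Longrightarrow> mdist M x y \<le> 1"
  and cint_mem: "c \<in> csyms L \<Longrightarrow> cint M c \<in> dom M"
  and fint_mem: "\<lbrakk>F \<in> fsyms L; as \<in> tuples M (farity L F)\<rbrakk> \<Longrightarrow> fint M F as \<in> dom M"
  and fint_lipschitz: "\<lbrakk>F \<in> fsyms L; as \<in> tuples M (farity L F); bs \<in> tuples M (farity L F)\<rbrakk> \<Longrightarrow>
    mdist M (fint M F as) (fint M F bs) \<le> flip L F * tdist M (farity L F) as bs"
  and rint_bounded: "\<lbrakk>R \<in> rsyms L; as \<in> tuples M (rarity L R)\<rbrakk> \<Longrightarrow> \<bar>rint M R as\<bar> \<le> 1"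
  and rint_lipschitz: "\<lbrakk>R \<in> rsyms L; as \<in> tuples M (rarity L R); bs \<in> tuples M (rarity L R)\<rbrakk> \<Longrightarrow>
    \<bar>rint M R as - rint M R bs\<bar> \<le> rlip L R * tdist M (rarity L R) as bs"
  using is_struct by (simp_all add: is_structure_def)

lemma flip_nonneg: "F \<in> fsyms L \<Longrightarrow> 0 \<le> flip L F"
  and rlip_nonneg: "R \<in> rsyms L \<Longrightarrow> 0 \<le> rlip L R"
  using language by (simp_all add: is_language_def)

text \<open>Valuations of any index type: of the variables \<open>Var k\<close>, but also of the reserved variables
  of the Henkin construction.\<close>
definition vals :: "('i \<Rightarrow> 'u) set" where
  "vals = {v. \<forall>k. v k \<in> dom M}"

lemma vals_mem: "v \<in> vals \<Longrightarrow> v k \<in> dom M"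
  and vals_upd: "\<lbrakk>v \<in> vals; a \<in> dom M\<rbrakk> \<Longrightarrow> v(k := a) \<in> vals"
  and vals_comp: "v \<in> vals \<Longrightarrow> v \<circ> f \<in> vals"
  by (simp_all add: vals_def)

lemma vals_nonempty: "vals \<noteq> {}"
proof -
  obtain a where "a \<in> dom M" using dom_nonempty by blast
  then have "(\<lambda>_. a) \<in> vals" by (simp add: vals_def)
  then show ?thesis by blast
qed

lemma teval_mem: "\<lbrakk>wf_trm L t; v \<in> vals\<rbrakk> \<Longrightarrow> teval M v t \<in> dom M"
proof (induction t)
  case (App F ts)
  then show ?case by (auto intro!: fint_mem simp: tuples_def)
qed (auto simp: vals_mem cint_mem)

lemma map_teval_mem:
  "\<lbrakk>\<And>t. t \<in> set ts \<Longrightarrow> wf_trm L t; v \<in> vals\<rbrakk> \<Longrightarrow> map (teval M v) ts \<in> tuples M (length ts)"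
  by (auto simp: tuples_def teval_mem)

lemma feval_bounded: "wf_fm L \<phi> \<Longrightarrow> \<exists>B. \<forall>v\<in>vals. \<bar>feval M v \<phi>\<bar> \<le> B"
proof (induction \<phi>)
  case (Num r)
  show ?case by auto
next
  case (Dist s t)
  then show ?case by (auto intro!: exI[of _ 1] mdist_le_1 teval_mem)
next
  case (Rel R ts)
  have "\<bar>rint M R (map (teval M v) ts)\<bar> \<le> 1" if "v \<in> vals" for v
    using map_teval_mem[of ts v] Rel.prems that by (intro rint_bounded) auto
  then show ?case by auto
next
  case (Scale r \<phi>)
  then obtain B where "\<forall>v\<in>vals. \<bar>feval M v \<phi>\<bar> \<le> B" by auto
  then show ?case by (auto simp: abs_mult intro!: exI[of _ "\<bar>r\<bar> * B"] mult_left_mono)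
next
  case (Add \<phi> \<psi>)
  then obtain B C where "\<forall>v\<in>vals. \<bar>feval M v \<phi>\<bar> \<le> B" "\<forall>v\<in>vals. \<bar>feval M v \<psi>\<bar> \<le> C" by auto
  then have "\<forall>v\<in>vals. \<bar>feval M v (Add \<phi> \<psi>)\<bar> \<le> B + C"
    by (auto intro!: order_trans[OF abs_triangle_ineq] add_mono)
  then show ?case by blast
next
  case (SupF i \<phi>)
  then obtain B where B: "\<forall>v\<in>vals. \<bar>feval M v \<phi>\<bar> \<le> B" by auto
  have "\<bar>feval M v (SupF i \<phi>)\<bar> \<le> B" if "v \<in> vals" for v
    using B that dom_nonempty unfolding feval.simps
    by (intro cSup_abs_le) (auto intro: vals_upd)
  then show ?case by blast
next
  case (InfF i \<phi>)
  then obtain B where B: "\<forall>v\<in>vals. \<bar>feval M v \<phi>\<bar> \<le> B" by auto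
  have "\<bar>feval M v (InfF i \<phi>)\<bar> \<le> B" if "v \<in> vals" for v
    using B that dom_nonempty unfolding feval.simps
    by (intro cInf_abs_ge) (auto intro: vals_upd)
  then show ?case by blast
qed

lemma SupF_upper:
  assumes "wf_fm L \<phi>" "v \<in> vals" "a \<in> dom M"
  shows "feval M (v(i := a)) \<phi> \<le> feval M v (SupF i \<phi>)"
proof -
  obtain B where "\<forall>v\<in>vals. \<bar>feval M v \<phi>\<bar> \<le> B" using feval_bounded assms(1) by blast
  then have "bdd_above ((\<lambda>a. feval M (v(i := a)) \<phi>) ` dom M)"
    using vals_upd[OF assms(2)] by (intro bdd_aboveI2[of _ _ B]) (auto simp: abs_le_iff)
  then show ?thesis using assms(3) by (auto intro: cSUP_upper)
qed

lemma SupF_least: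
  assumes "\<And>a. a \<in> dom M \<Longrightarrow> feval M (v(i := a)) \<phi> \<le> c"
  shows "feval M v (SupF i \<phi>) \<le> c"
  using assms dom_nonempty by (auto intro: cSUP_least)

lemma InfF_lower:
  assumes "wf_fm L \<phi>" "v \<in> vals" "a \<in> dom M"
  shows "feval M v (InfF i \<phi>) \<le> feval M (v(i := a)) \<phi>"
proof -
  obtain B where "\<forall>v\<in>vals. \<bar>feval M v \<phi>\<bar> \<le> B" using feval_bounded assms(1) by blast
  then have "\<bar>feval M (v(i := x)) \<phi>\<bar> \<le> B" if "x \<in> dom M" for x
    using vals_upd[OF assms(2) that] by blast
  then have "bdd_below ((\<lambda>a. feval M (v(i := a)) \<phi>) ` dom M)"
    by (intro bdd_belowI2[of _ "-B"]) (simp add: abs_le_iff minus_le_iff)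
  then show ?thesis using assms(3) by (auto intro: cINF_lower)
qed

lemma InfF_greatest:
  assumes "\<And>a. a \<in> dom M \<Longrightarrow> c \<le> feval M (v(i := a)) \<phi>"
  shows "c \<le> feval M v (InfF i \<phi>)"
  using assms dom_nonempty by (auto intro: cINF_greatest)

lemma foldr_InfF_lower:
  assumes "wf_fm L \<phi>" "v \<in> vals" "u \<in> vals" "\<And>k. k \<notin> set ks \<Longrightarrow> u k = v k"
  shows "feval M v (foldr InfF ks \<phi>) \<le> feval M u \<phi>"
  using assms(2,4)
proof (induction ks arbitrary: v)
  case Nil
  then have "u = v" by auto
  then show ?case by simp
next
  case (Cons k ks)
  have upd: "v(k := u k) \<in> vals"
    using Cons.prems assms by (intro vals_upd vals_mem)
  have "feval M v (foldr InfF (k # ks) \<phi>) \<le> feval M (v(k := u k)) (foldr InfF ks \<phi>)"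
    unfolding foldr_Cons comp_apply
    by (rule InfF_lower) (use assms Cons.prems in \<open>auto simp: vals_mem\<close>)
  also have "\<dots> \<le> feval M u \<phi>"
    by (rule Cons.IH[OF upd]) (use Cons.prems in auto)
  finally show ?case .
qed

lemma foldr_InfF_greatest:
  assumes "v \<in> vals" "\<And>u. \<lbrakk>u \<in> vals; \<And>k. k \<notin> set ks \<Longrightarrow> u k = v k\<rbrakk> \<Longrightarrow> c \<le> feval M u \<phi>"
  shows "c \<le> feval M v (foldr InfF ks \<phi>)"
  using assms
proof (induction ks arbitrary: v)
  case Nil
  then show ?case by simp
next
  case (Cons k ks)
  show ?case
    unfolding foldr_Cons comp_apply
  proof (rule InfF_greatest)
    fix a assume "a \<in> dom M"
    then show "c \<le> feval M (v(k := a)) (foldr InfF ks \<phi>)"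
      using Cons.prems by (intro Cons.IH vals_upd) auto
  qed
qed

lemma tdist_le:
  assumes "\<And>i. i < n \<Longrightarrow> mdist M (as ! i) (bs ! i) \<le> c i"
  shows "tdist M n as bs \<le> (\<Sum>i<n. c i)"
  unfolding tdist_def
proof (rule sum_mono)
  fix i assume i: "i \<in> {..<n}"
  have "(1/2) ^ i * mdist M (as ! i) (bs ! i) \<le> 1 * mdist M (as ! i) (bs ! i)"
    by (intro mult_right_mono power_le_one) auto
  then show "(1/2) ^ i * mdist M (as ! i) (bs ! i) \<le> c i"
    using assms[of i] i by simp
qed

lemma teval_lipschitz:
  assumes "wf_trm L t"
  shows "\<exists>C\<ge>0. \<forall>v\<in>vals. \<forall>w\<in>vals. \<forall>\<delta>\<ge>0. (\<forall>k\<in>tvars t. mdist M (v k) (w k) \<le> \<delta>) \<longrightarrow>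
    mdist M (teval M v t) (teval M w t) \<le> C * \<delta>"
  using assms
proof (induction t)
  case (Var i)
  show ?case by (auto intro: exI[of _ 1])
next
  case (Cst c)
  then show ?case by (auto simp: cint_mem intro: exI[of _ 0])
next
  case (App F ts)
  then have "\<forall>t\<in>set ts. \<exists>C\<ge>0. \<forall>v\<in>vals. \<forall>w\<in>vals. \<forall>\<delta>\<ge>0. (\<forall>k\<in>tvars t. mdist M (v k) (w k) \<le> \<delta>) \<longrightarrow>
    mdist M (teval M v t) (teval M w t) \<le> C * \<delta>" by simp
  then obtain C where C0: "\<And>t. t \<in> set ts \<Longrightarrow> 0 \<le> C t"
    and C: "\<And>t v w \<delta>. \<lbrakk>t \<in> set ts; v \<in> vals; w \<in> vals; 0 \<le> \<delta>; \<forall>k\<in>tvars t. mdist M (v k) (w k) \<le> \<delta>\<rbrakk> \<Longrightarrow>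
      mdist M (teval M v t) (teval M w t) \<le> C t * \<delta>"
    by metis
  have F: "F \<in> fsyms L" "farity L F = length ts" using App.prems by auto
  let ?C = "flip L F * (\<Sum>i<length ts. C (ts ! i))"
  have "mdist M (teval M v (App F ts)) (teval M w (App F ts)) \<le> ?C * \<delta>"
    if vw: "v \<in> vals" "w \<in> vals" "0 \<le> \<delta>" "\<forall>k\<in>tvars (App F ts). mdist M (v k) (w k) \<le> \<delta>" for v w \<delta>
  proof -
    have "mdist M (teval M v (App F ts)) (teval M w (App F ts)) \<le>
        flip L F * tdist M (length ts) (map (teval M v) ts) (map (teval M w) ts)"
      using fint_lipschitz[OF F(1)] map_teval_mem[of ts] App.prems vw F by auto
    also have "\<dots> \<le> flip L F * (\<Sum>i<length ts. C (ts ! i) * \<delta>)"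
      using vw flip_nonneg[OF F(1)] by (intro mult_left_mono tdist_le) (auto intro!: C)
    finally show ?thesis by (simp add: sum_distrib_right mult.assoc)
  qed
  moreover have "0 \<le> ?C"
    using C0 flip_nonneg[OF F(1)] by (intro mult_nonneg_nonneg sum_nonneg) auto
  ultimately show ?case by blast
qed

text \<open>Stated with a common bound \<open>\<delta>\<close> of the coordinate distances, because \<open>\<delta>\<close> will itself be the value
  of a formula: a sum of distances that is added to another formula.\<close>
lemma feval_lipschitz:
  assumes "wf_fm L \<phi>"
  shows "\<exists>C\<ge>0. \<forall>v\<in>vals. \<forall>w\<in>vals. \<forall>\<delta>\<ge>0. (\<forall>k\<in>fvars \<phi>. mdist M (v k) (w k) \<le> \<delta>) \<longrightarrow>
    feval M v \<phi> \<le> feval M w \<phi> + C * \<delta>"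
  using assms
proof (induction \<phi>)
  case (Num r)
  show ?case by auto
next
  case (Dist s t)
  then have wf: "wf_trm L s" "wf_trm L t" by auto
  obtain A where A: "0 \<le> A" "\<And>v w \<delta>. \<lbrakk>v \<in> vals; w \<in> vals; 0 \<le> \<delta>; \<forall>k\<in>tvars s. mdist M (v k) (w k) \<le> \<delta>\<rbrakk> \<Longrightarrow>
      mdist M (teval M v s) (teval M w s) \<le> A * \<delta>"
    using teval_lipschitz[OF wf(1)] by blast
  obtain B where B: "0 \<le> B" "\<And>v w \<delta>. \<lbrakk>v \<in> vals; w \<in> vals; 0 \<le> \<delta>; \<forall>k\<in>tvars t. mdist M (v k) (w k) \<le> \<delta>\<rbrakk> \<Longrightarrow>
      mdist M (teval M v t) (teval M w t) \<le> B * \<delta>"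
    using teval_lipschitz[OF wf(2)] by blast
  have "feval M v (Dist s t) \<le> feval M w (Dist s t) + (A + B) * \<delta>"
    if vw: "v \<in> vals" "w \<in> vals" "0 \<le> \<delta>" "\<forall>k\<in>fvars (Dist s t). mdist M (v k) (w k) \<le> \<delta>" for v w \<delta>
  proof -
    have mem: "teval M v s \<in> dom M" "teval M v t \<in> dom M" "teval M w s \<in> dom M" "teval M w t \<in> dom M"
      using vw wf by (auto intro: teval_mem)
    have "mdist M (teval M v s) (teval M v t) \<le> mdist M (teval M v s) (teval M w s) + mdist M (teval M w s) (teval M v t)"
      using mem by (intro triangle)
    also have "mdist M (teval M w s) (teval M v t) \<le> mdist M (teval M w s) (teval M w t) + mdist M (teval M w t) (teval M v t)"
      using mem by (intro triangle)
    finally show ?thesis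
      using A(2)[of v w \<delta>] B(2)[of v w \<delta>] vw commute[of "teval M w t"] by (simp add: distrib_right)
  qed
  then show ?case using A B by (intro exI[of _ "A + B"]) auto
next
  case (Rel R ts)
  then have wf: "\<And>t. t \<in> set ts \<Longrightarrow> wf_trm L t" and R: "R \<in> rsyms L" "rarity L R = length ts" by auto
  have "\<forall>t\<in>set ts. \<exists>C\<ge>0. \<forall>v\<in>vals. \<forall>w\<in>vals. \<forall>\<delta>\<ge>0. (\<forall>k\<in>tvars t. mdist M (v k) (w k) \<le> \<delta>) \<longrightarrow>
    mdist M (teval M v t) (teval M w t) \<le> C * \<delta>"
    using wf teval_lipschitz by blast
  then obtain C where C0: "\<And>t. t \<in> set ts \<Longrightarrow> 0 \<le> C t"
    and C: "\<And>t v w \<delta>. \<lbrakk>t \<in> set ts; v \<in> vals; w \<in> vals; 0 \<le> \<delta>; \<forall>k\<in>tvars t. mdist M (v k) (w k) \<le> \<delta>\<rbrakk> \<Longrightarrow>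
      mdist M (teval M v t) (teval M w t) \<le> C t * \<delta>"
    by metis
  let ?C = "rlip L R * (\<Sum>i<length ts. C (ts ! i))"
  have "feval M v (Rel R ts) \<le> feval M w (Rel R ts) + ?C * \<delta>"
    if vw: "v \<in> vals" "w \<in> vals" "0 \<le> \<delta>" "\<forall>k\<in>fvars (Rel R ts). mdist M (v k) (w k) \<le> \<delta>" for v w \<delta>
  proof -
    have "\<bar>feval M v (Rel R ts) - feval M w (Rel R ts)\<bar> \<le>
        rlip L R * tdist M (length ts) (map (teval M v) ts) (map (teval M w) ts)"
      using rint_lipschitz[OF R(1)] map_teval_mem[of ts] wf vw R by auto
    also have "\<dots> \<le> rlip L R * (\<Sum>i<length ts. C (ts ! i) * \<delta>)"
      using vw rlip_nonneg[OF R(1)] by (intro mult_left_mono tdist_le) (auto intro!: C)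
    also have "\<dots> = ?C * \<delta>" by (simp add: sum_distrib_right mult.assoc)
    finally show ?thesis by linarith
  qed
  moreover have "0 \<le> ?C"
    using C0 rlip_nonneg[OF R(1)] by (intro mult_nonneg_nonneg sum_nonneg) auto
  ultimately show ?case by blast
next
  case (Scale r \<phi>)
  then obtain C where C: "0 \<le> C" "\<And>v w \<delta>. \<lbrakk>v \<in> vals; w \<in> vals; 0 \<le> \<delta>; \<forall>k\<in>fvars \<phi>. mdist M (v k) (w k) \<le> \<delta>\<rbrakk> \<Longrightarrow>
      feval M v \<phi> \<le> feval M w \<phi> + C * \<delta>"
    by fastforce
  have "r * feval M v \<phi> \<le> r * feval M w \<phi> + \<bar>r\<bar> * C * \<delta>"
    if vw: "v \<in> vals" "w \<in> vals" "0 \<le> \<delta>" "\<forall>k\<in>fvars \<phi>. mdist M (v k) (w k) \<le> \<delta>" for v w \<delta>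
  proof -
    have "\<bar>feval M v \<phi> - feval M w \<phi>\<bar> \<le> C * \<delta>"
      using C(2)[of v w \<delta>] C(2)[of w v \<delta>] vw commute by (auto simp: abs_le_iff)
    then have "\<bar>r\<bar> * \<bar>feval M v \<phi> - feval M w \<phi>\<bar> \<le> \<bar>r\<bar> * (C * \<delta>)"
      by (rule mult_left_mono) simp
    then have "\<bar>r * (feval M v \<phi> - feval M w \<phi>)\<bar> \<le> \<bar>r\<bar> * C * \<delta>"
      by (simp add: abs_mult mult.assoc)
    then show ?thesis by (simp add: right_diff_distrib)
  qed
  then show ?case using C(1) by (intro exI[of _ "\<bar>r\<bar> * C"]) auto
next
  case (Add \<phi> \<psi>)
  then obtain A where A: "0 \<le> A" "\<And>v w \<delta>. \<lbrakk>v \<in> vals; w \<in> vals; 0 \<le> \<delta>; \<forall>k\<in>fvars \<phi>. mdist M (v k) (w k) \<le> \<delta>\<rbrakk> \<Longrightarrow>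
      feval M v \<phi> \<le> feval M w \<phi> + A * \<delta>"
    by fastforce
  obtain B where B: "0 \<le> B" "\<And>v w \<delta>. \<lbrakk>v \<in> vals; w \<in> vals; 0 \<le> \<delta>; \<forall>k\<in>fvars \<psi>. mdist M (v k) (w k) \<le> \<delta>\<rbrakk> \<Longrightarrow>
      feval M v \<psi> \<le> feval M w \<psi> + B * \<delta>"
    using Add by fastforce
  have "feval M v (Add \<phi> \<psi>) \<le> feval M w (Add \<phi> \<psi>) + (A + B) * \<delta>"
    if "v \<in> vals" "w \<in> vals" "0 \<le> \<delta>" "\<forall>k\<in>fvars (Add \<phi> \<psi>). mdist M (v k) (w k) \<le> \<delta>" for v w \<delta>
    using A(2)[of v w \<delta>] B(2)[of v w \<delta>] that by (simp add: distrib_right)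
  then show ?case using A B by (intro exI[of _ "A + B"]) auto
next
  case (SupF i \<phi>)
  then obtain C where C: "0 \<le> C" "\<And>v w \<delta>. \<lbrakk>v \<in> vals; w \<in> vals; 0 \<le> \<delta>; \<forall>k\<in>fvars \<phi>. mdist M (v k) (w k) \<le> \<delta>\<rbrakk> \<Longrightarrow>
      feval M v \<phi> \<le> feval M w \<phi> + C * \<delta>"
    by fastforce
  have "feval M v (SupF i \<phi>) \<le> feval M w (SupF i \<phi>) + C * \<delta>"
    if vw: "v \<in> vals" "w \<in> vals" "0 \<le> \<delta>" "\<forall>k\<in>fvars (SupF i \<phi>). mdist M (v k) (w k) \<le> \<delta>" for v w \<delta>
  proof (rule SupF_least)
    fix a assume a: "a \<in> dom M"
    have "feval M (v(i := a)) \<phi> \<le> feval M (w(i := a)) \<phi> + C * \<delta>"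
      using vw a by (intro C(2) vals_upd) auto
    also have "feval M (w(i := a)) \<phi> \<le> feval M w (SupF i \<phi>)"
      using SupF.prems vw a by (intro SupF_upper) auto
    finally show "feval M (v(i := a)) \<phi> \<le> feval M w (SupF i \<phi>) + C * \<delta>" by simp
  qed
  then show ?case using C(1) by blast
next
  case (InfF i \<phi>)
  then obtain C where C: "0 \<le> C" "\<And>v w \<delta>. \<lbrakk>v \<in> vals; w \<in> vals; 0 \<le> \<delta>; \<forall>k\<in>fvars \<phi>. mdist M (v k) (w k) \<le> \<delta>\<rbrakk> \<Longrightarrow>
      feval M v \<phi> \<le> feval M w \<phi> + C * \<delta>"
    by fastforce
  have "feval M v (InfF i \<phi>) - C * \<delta> \<le> feval M w (InfF i \<phi>)"
    if vw: "v \<in> vals" "w \<in> vals" "0 \<le> \<delta>" "\<forall>k\<in>fvars (InfF i \<phi>). mdist M (v k) (w k) \<le> \<delta>" for v w \<delta>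
  proof (rule InfF_greatest)
    fix a assume a: "a \<in> dom M"
    have "feval M v (InfF i \<phi>) \<le> feval M (v(i := a)) \<phi>"
      using InfF.prems vw a by (intro InfF_lower) auto
    also have "\<dots> \<le> feval M (w(i := a)) \<phi> + C * \<delta>"
      using vw a by (intro C(2) vals_upd) auto
    finally show "feval M v (InfF i \<phi>) - C * \<delta> \<le> feval M (w(i := a)) \<phi>" by simp
  qed
  then show ?case using C(1) by (intro exI[of _ C]) (force simp: diff_le_eq)
qed

end


section \<open>A pure type with witnesses\<close>

lemma sum_fm_inject [simp]: "sum_fm \<phi>s = sum_fm \<psi>s \<longleftrightarrow> \<phi>s = \<psi>s"
proof (induction \<phi>s arbitrary: \<psi>s)
  case Nil
  show ?case by (cases \<psi>s) auto
next
  case (Cons \<phi> \<phi>s)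
  show ?case by (cases \<psi>s) (auto simp: Cons.IH)
qed

lemma size_sum_fm: "\<phi> \<in> set \<phi>s \<Longrightarrow> size \<phi> < size (sum_fm \<phi>s)"
  by (induction \<phi>s) auto

definition var_bound :: "('c, 'f, 'r) fm \<Rightarrow> nat" where
  "var_bound \<phi> = (SOME n. fvars \<phi> \<subseteq> {..<n})"

lemma var_bound: "k \<in> fvars \<phi> \<Longrightarrow> k < var_bound \<phi>"
  using someI_ex[OF ex_fvars_bound[of \<phi>]] unfolding var_bound_def by blast

text \<open>The function \<open>sum_fm\<close> is an injective coding of lists of formulas by formulas in which the
  entries are smaller than the code. This makes the type of formulas itself an index set for the
  variables, on which witnesses can be chosen by recursion on the size.\<close>
definition witness :: "nat \<Rightarrow> ('c, 'f, 'r) fm \<Rightarrow> (nat \<Rightarrow> ('c, 'f, 'r) fm) \<Rightarrow> ('c, 'f, 'r) fm" where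
  "witness i \<phi> \<sigma> = sum_fm (SupF i \<phi> # map \<sigma> [0..<var_bound \<phi>])"

lemma witness_inject:
  assumes "witness i \<phi> \<sigma> = witness j \<psi> \<tau>"
  shows "i = j" "\<phi> = \<psi>" "k < var_bound \<phi> \<Longrightarrow> \<sigma> k = \<tau> k"
proof -
  have "SupF i \<phi> # map \<sigma> [0..<var_bound \<phi>] = SupF j \<psi> # map \<tau> [0..<var_bound \<psi>]"
    using assms unfolding witness_def sum_fm_inject .
  then show "i = j" "\<phi> = \<psi>" "k < var_bound \<phi> \<Longrightarrow> \<sigma> k = \<tau> k" by auto
qed

lemma size_witness: "k < var_bound \<phi> \<Longrightarrow> size (\<sigma> k) < size (witness i \<phi> \<sigma>)"
  unfolding witness_def by (rule size_sum_fm) auto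

context lstructure
begin

text \<open>Formulas only know the variables \<open>Var k\<close>. An assignment \<open>\<sigma>\<close> lets them speak about variables of
  an arbitrary index type.\<close>
definition ev :: "('c, 'f, 'r) fm \<Rightarrow> (nat \<Rightarrow> 'i) \<Rightarrow> ('i \<Rightarrow> 'u) \<Rightarrow> real" where
  "ev \<phi> \<sigma> v = feval M (v \<circ> \<sigma>) \<phi>"

definition definable :: "(('i \<Rightarrow> 'u) \<Rightarrow> real) set" where
  "definable = {ev \<phi> \<sigma> | \<phi> \<sigma>. wf_fm L \<phi>}"

lemma ev_mem: "wf_fm L \<phi> \<Longrightarrow> ev \<phi> \<sigma> \<in> definable"
  by (auto simp: definable_def)

text \<open>Two formulas with assignments \<open>\<sigma>\<close> and \<open>\<tau>\<close> are brought to a common assignment by moving the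
  variables of one to even and those of the other to odd places. Thus the functions that formulas
  define form a vector space.\<close>
definition interleave :: "(nat \<Rightarrow> 'i) \<Rightarrow> (nat \<Rightarrow> 'i) \<Rightarrow> nat \<Rightarrow> 'i" where
  "interleave \<sigma> \<tau> k = (if even k then \<sigma> (k div 2) else \<tau> (k div 2))"

lemma interleave_comp:
  "v \<circ> interleave \<sigma> \<tau> \<circ> (\<lambda>k. 2 * k) = v \<circ> \<sigma>"
  "v \<circ> interleave \<sigma> \<tau> \<circ> (\<lambda>k. 2 * k + 1) = v \<circ> \<tau>"
  by (auto simp: interleave_def fun_eq_iff)

lemma inj_double: "inj (\<lambda>k::nat. 2 * k)" "inj (\<lambda>k::nat. 2 * k + 1)"
  by (auto intro: injI)

lemma function_space_definable: "function_space (definable :: (('i \<Rightarrow> 'u) \<Rightarrow> real) set) vals"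
proof
  show "(\<lambda>_. c) \<in> (definable :: (('i \<Rightarrow> 'u) \<Rightarrow> real) set)" for c
    using ev_mem[of "Num c"] by (simp add: ev_def[abs_def])
next
  fix f g :: "('i \<Rightarrow> 'u) \<Rightarrow> real" assume "f \<in> definable" "g \<in> definable"
  then obtain \<phi> \<sigma> \<psi> \<tau> where fg: "f = ev \<phi> \<sigma>" "g = ev \<psi> \<tau>" "wf_fm L \<phi>" "wf_fm L \<psi>"
    by (auto simp: definable_def)
  have "ev (Add (fren (\<lambda>k. 2 * k) \<phi>) (fren (\<lambda>k. 2 * k + 1) \<psi>)) (interleave \<sigma> \<tau>) \<in> definable"
    using fg by (intro ev_mem) simp
  then show "(\<lambda>x. f x + g x) \<in> definable"
    by (simp add: ev_def[abs_def] fg feval_fren[OF inj_double(1)] feval_fren[OF inj_double(2)] interleave_comp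
      del: One_nat_def add_Suc_right)
next
  fix f :: "('i \<Rightarrow> 'u) \<Rightarrow> real" and c assume "f \<in> definable"
  then obtain \<phi> \<sigma> where f: "f = ev \<phi> \<sigma>" "wf_fm L \<phi>"
    by (auto simp: definable_def)
  then have "ev (Scale c \<phi>) \<sigma> \<in> definable" by (intro ev_mem) simp
  then show "(\<lambda>x. c * f x) \<in> definable" by (simp add: ev_def[abs_def] f)
next
  fix f :: "('i \<Rightarrow> 'u) \<Rightarrow> real" assume "f \<in> definable"
  then obtain \<phi> \<sigma> where f: "f = ev \<phi> \<sigma>" "wf_fm L \<phi>"
    by (auto simp: definable_def)
  then obtain B where "\<forall>v\<in>vals. \<bar>feval M v \<phi>\<bar> \<le> B" using feval_bounded by blast
  then show "\<exists>B. \<forall>x\<in>vals. \<bar>f x\<bar> \<le> B"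
    unfolding f ev_def using vals_comp by blast
qed

lemma dist_mem:
  assumes "wf_trm L s" "wf_trm L t"
  shows "(\<lambda>v. mdist M (teval M (v \<circ> \<sigma>) s) (teval M (v \<circ> \<tau>) t)) \<in> definable"
proof -
  have "ev (Dist (tren (\<lambda>k. 2 * k) s) (tren (\<lambda>k. 2 * k + 1) t)) (interleave \<sigma> \<tau>) \<in> definable"
    using assms by (intro ev_mem) simp
  then show ?thesis
    by (simp add: ev_def[abs_def] interleave_comp del: One_nat_def add_Suc_right)
qed

text \<open>One \<open>\<epsilon>\<close> serves all formulas at once, so that these sets form a chain and functions that become
  small along it are closed under sums.\<close>
definition henkin_vals :: "real \<Rightarrow> (('c, 'f, 'r) fm \<Rightarrow> 'u) set" where
  "henkin_vals \<epsilon> = {v \<in> vals. \<forall>i \<phi> \<sigma>. wf_fm L \<phi> \<longrightarrow>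
     ev (SupF i \<phi>) \<sigma> v \<le> ev \<phi> (\<sigma>(i := witness i \<phi> \<sigma>)) v + \<epsilon>}"

text \<open>The value at \<open>witness i \<phi> \<sigma>\<close> has to meet one requirement only, since the code determines
  \<open>i\<close>, \<open>\<phi>\<close> and the relevant part of \<open>\<sigma>\<close>, and this requirement involves the values at smaller
  indices only.\<close>
lemma henkin_vals_nonempty:
  assumes \<epsilon>: "0 < \<epsilon>"
  shows "henkin_vals \<epsilon> \<noteq> {}"
proof -
  define P where "P f x r \<longleftrightarrow> r \<in> dom M \<and> (\<forall>i \<phi> \<sigma>. wf_fm L \<phi> \<and> x = witness i \<phi> \<sigma> \<longrightarrow>
      feval M (f \<circ> \<sigma>) (SupF i \<phi>) \<le> feval M ((f \<circ> \<sigma>)(i := r)) \<phi> + \<epsilon>)" for f x r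
  have eq: "feval M (f \<circ> \<sigma>) (SupF i \<phi>) = feval M g (SupF i \<phi>)"
    "feval M ((f \<circ> \<sigma>)(i := r)) \<phi> = feval M (g(i := r)) \<phi>"
    if "\<And>k. k < var_bound \<phi> \<Longrightarrow> f (\<sigma> k) = g k"
    for f :: "('c, 'f, 'r) fm \<Rightarrow> 'u" and g \<sigma> i \<phi> r
    using that by (intro feval_cong; auto dest: var_bound)+
  have "\<exists>v. \<forall>x. P v x (v x)"
  proof (rule dependent_wf_choice)
    show "wf (Wellfounded.measure (size :: ('c, 'f, 'r) fm \<Rightarrow> nat))" by simp
  next
    fix f g :: "('c, 'f, 'r) fm \<Rightarrow> 'u" and x :: "('c, 'f, 'r) fm" and r
    assume "\<And>z. (z, x) \<in> Wellfounded.measure size \<Longrightarrow> f z = g z"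
    then have fg: "f (\<sigma> k) = (g \<circ> \<sigma>) k" if "x = witness i \<phi> \<sigma>" "k < var_bound \<phi>" for i \<phi> \<sigma> k
      using size_witness[of k \<phi> \<sigma> i] that by simp
    have "feval M (f \<circ> \<sigma>) (SupF i \<phi>) = feval M (g \<circ> \<sigma>) (SupF i \<phi>)"
      "feval M ((f \<circ> \<sigma>)(i := r)) \<phi> = feval M ((g \<circ> \<sigma>)(i := r)) \<phi>"
      if "x = witness i \<phi> \<sigma>" for i \<phi> \<sigma>
      using eq[of \<phi> f \<sigma> "g \<circ> \<sigma>"] fg[OF that] by blast+
    then show "P f x r = P g x r"
      unfolding P_def by auto
  next
    fix x and f :: "('c, 'f, 'r) fm \<Rightarrow> 'u"
    assume IH: "\<And>y. (y, x) \<in> Wellfounded.measure size \<Longrightarrow> P f y (f y)"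
    obtain a0 where a0: "a0 \<in> dom M" using dom_nonempty by blast
    show "\<exists>r. P f x r"
    proof (cases "\<exists>i \<phi> \<sigma>. wf_fm L \<phi> \<and> x = witness i \<phi> \<sigma>")
      case False
      then show ?thesis using a0 unfolding P_def by blast
    next
      case True
      then obtain i \<phi> \<sigma> where wf: "wf_fm L \<phi>" and x: "x = witness i \<phi> \<sigma>" by blast
      define g where "g k = (if k < var_bound \<phi> then f (\<sigma> k) else a0)" for k
      have "f (\<sigma> k) \<in> dom M" if "k < var_bound \<phi>" for k
        using IH[of "\<sigma> k"] size_witness[OF that, of \<sigma> i] x by (simp add: P_def)
      then have "g \<in> vals" using a0 by (simp add: g_def vals_def)
      have "\<exists>r\<in>dom M. feval M g (SupF i \<phi>) \<le> feval M (g(i := r)) \<phi> + \<epsilon>"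
      proof (rule ccontr)
        assume "\<not> ?thesis"
        then have "feval M g (SupF i \<phi>) \<le> feval M g (SupF i \<phi>) - \<epsilon>"
          by (intro SupF_least) force
        with \<epsilon> show False by simp
      qed
      then obtain r where r: "r \<in> dom M" "feval M g (SupF i \<phi>) \<le> feval M (g(i := r)) \<phi> + \<epsilon>"
        by blast
      have "feval M (f \<circ> \<tau>) (SupF j \<psi>) \<le> feval M ((f \<circ> \<tau>)(j := r)) \<psi> + \<epsilon>"
        if "x = witness j \<psi> \<tau>" for j \<psi> \<tau>
      proof -
        have same: "j = i" "\<psi> = \<phi>" and "\<And>k. k < var_bound \<phi> \<Longrightarrow> \<tau> k = \<sigma> k"
          using witness_inject[of j \<psi> \<tau> i \<phi> \<sigma>] that x by auto
        then have "f (\<tau> k) = g k" if "k < var_bound \<phi>" for k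
          using that by (simp add: g_def)
        then have "feval M (f \<circ> \<tau>) (SupF i \<phi>) = feval M g (SupF i \<phi>)"
          "feval M ((f \<circ> \<tau>)(i := r)) \<phi> = feval M (g(i := r)) \<phi>"
          using eq[of \<phi> f \<tau> g] by blast+
        with r(2) same show ?thesis by simp
      qed
      then show ?thesis using r(1) unfolding P_def by blast
    qed
  qed
  then obtain v where v: "\<And>x. P v x (v x)" by blast
  have "v \<in> vals" using v by (simp add: P_def vals_def)
  moreover have "ev (SupF i \<phi>) \<sigma> v \<le> ev \<phi> (\<sigma>(i := witness i \<phi> \<sigma>)) v + \<epsilon>" if "wf_fm L \<phi>" for i \<phi> \<sigma>
  proof -
    have "(v \<circ> \<sigma>)(i := v (witness i \<phi> \<sigma>)) = v \<circ> \<sigma>(i := witness i \<phi> \<sigma>)"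
      by (auto simp: fun_eq_iff)
    then show ?thesis
      using v[of "witness i \<phi> \<sigma>"] that unfolding P_def ev_def by metis
  qed
  ultimately show ?thesis by (auto simp: henkin_vals_def)
qed

text \<open>The initial cone consists of the functions below a nonnegative function \<open>h\<close> that becomes small
  on valuations with good witnesses. It contains the defects \<open>sup\<^sub>x \<phi> - \<phi>(w)\<close>, so that a state that is
  nonpositive on the cone attains every supremum. As such an \<open>h\<close> belongs to the cone itself, the
  clause of \<open>split_cone\<close> that makes it a face is immediate.\<close>
theorem ex_henkin_state:
  "\<exists>p :: ((('c, 'f, 'r) fm \<Rightarrow> 'u) \<Rightarrow> real) \<Rightarrow> real.
     function_space.state definable vals p \<and> function_space.pure definable vals p \<and>
     (\<forall>i \<phi> \<sigma>. wf_fm L \<phi> \<longrightarrow> (\<exists>w. p (ev (SupF i \<phi>) \<sigma>) \<le> p (ev \<phi> (\<sigma>(i := w)))))"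
proof -
  interpret D: function_space "definable :: ((('c, 'f, 'r) fm \<Rightarrow> 'u) \<Rightarrow> real) set" vals
    by (rule function_space_definable)
  have anti: "henkin_vals \<epsilon> \<subseteq> henkin_vals \<delta>" if "\<epsilon> \<le> \<delta>" for \<epsilon> \<delta>
  proof
    fix v assume v: "v \<in> henkin_vals \<epsilon>"
    have "ev (SupF i \<phi>) \<sigma> v \<le> ev \<phi> (\<sigma>(i := witness i \<phi> \<sigma>)) v + \<delta>" if "wf_fm L \<phi>" for i \<phi> \<sigma>
    proof -
      have "ev (SupF i \<phi>) \<sigma> v \<le> ev \<phi> (\<sigma>(i := witness i \<phi> \<sigma>)) v + \<epsilon>"
        using v that by (simp add: henkin_vals_def)
      with \<open>\<epsilon> \<le> \<delta>\<close> show ?thesis by linarith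
    qed
    with v show "v \<in> henkin_vals \<delta>" by (simp add: henkin_vals_def)
  qed
  define small where "small h \<longleftrightarrow> (\<forall>\<delta>>0. \<exists>\<epsilon>>0. \<forall>v\<in>henkin_vals \<epsilon>. h v \<le> \<delta>)" for h :: "(('c, 'f, 'r) fm \<Rightarrow> 'u) \<Rightarrow> real"
  have small_add: "small (\<lambda>v. g v + h v)" if "small g" "small h" for g h
    unfolding small_def
  proof (intro allI impI)
    fix \<delta> :: real assume \<delta>: "0 < \<delta>"
    obtain \<epsilon>1 where 1: "0 < \<epsilon>1" "\<forall>v\<in>henkin_vals \<epsilon>1. g v \<le> \<delta>/2"
      using \<open>small g\<close> \<delta> unfolding small_def by (meson half_gt_zero)
    obtain \<epsilon>2 where 2: "0 < \<epsilon>2" "\<forall>v\<in>henkin_vals \<epsilon>2. h v \<le> \<delta>/2"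
      using \<open>small h\<close> \<delta> unfolding small_def by (meson half_gt_zero)
    have "\<forall>v\<in>henkin_vals (min \<epsilon>1 \<epsilon>2). g v + h v \<le> \<delta>"
    proof
      fix v assume "v \<in> henkin_vals (min \<epsilon>1 \<epsilon>2)"
      then have "v \<in> henkin_vals \<epsilon>1" "v \<in> henkin_vals \<epsilon>2"
        using anti[of "min \<epsilon>1 \<epsilon>2" \<epsilon>1] anti[of "min \<epsilon>1 \<epsilon>2" \<epsilon>2] by auto
      with 1 2 have "g v \<le> \<delta>/2" "h v \<le> \<delta>/2" by auto
      then show "g v + h v \<le> \<delta>" by simp
    qed
    with 1 2 show "\<exists>\<epsilon>>0. \<forall>v\<in>henkin_vals \<epsilon>. g v + h v \<le> \<delta>"
      by (intro exI[of _ "min \<epsilon>1 \<epsilon>2"]) auto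
  qed
  have small_scale: "small (\<lambda>v. c * h v)" if "small h" "0 \<le> c" for c h
    unfolding small_def
  proof (intro allI impI)
    fix \<delta> :: real assume \<delta>: "0 < \<delta>"
    obtain \<epsilon> where e: "0 < \<epsilon>" "\<forall>v\<in>henkin_vals \<epsilon>. h v \<le> \<delta> / (c + 1)"
      using \<open>small h\<close> \<delta> \<open>0 \<le> c\<close> unfolding small_def
      by (metis add_nonneg_pos divide_pos_pos zero_less_one)
    have "c * h v \<le> \<delta>" if "v \<in> henkin_vals \<epsilon>" for v
    proof -
      have "c * h v \<le> c * (\<delta> / (c + 1))" using e that \<open>0 \<le> c\<close> by (intro mult_left_mono) auto
      also have "\<dots> \<le> \<delta>" using \<open>0 \<le> c\<close> \<delta> by (simp add: field_simps)
      finally show ?thesis .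
    qed
    with e show "\<exists>\<epsilon>>0. \<forall>v\<in>henkin_vals \<epsilon>. c * h v \<le> \<delta>" by blast
  qed
  let ?P = "{f \<in> definable. \<exists>h\<in>definable. (\<forall>v\<in>vals. 0 \<le> h v \<and> f v \<le> h v) \<and> small h}"
  have "D.split_cone ?P"
    unfolding D.split_cone_def
  proof (intro conjI ballI allI impI)
    show "?P \<subseteq> definable" by blast
    have "small (\<lambda>_. 0)" by (auto simp: small_def intro: exI[of _ 1])
    then show "f \<in> ?P" if "f \<in> definable" "\<forall>v\<in>vals. f v \<le> 0" for f
      using that D.const_mem[of 0] by (auto intro!: bexI[of _ "\<lambda>_. 0"])
  next
    fix f g assume "f \<in> ?P" "g \<in> ?P"
    then obtain h k where "f \<in> definable" "g \<in> definable" "h \<in> definable" "k \<in> definable"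
      "\<forall>v\<in>vals. 0 \<le> h v \<and> f v \<le> h v" "\<forall>v\<in>vals. 0 \<le> k v \<and> g v \<le> k v" "small h" "small k" by blast
    then show "(\<lambda>v. f v + g v) \<in> ?P"
      using D.add_mem[of f g] D.add_mem[of h k] small_add[of h k]
      by (auto intro!: bexI[of _ "\<lambda>v. h v + k v"] add_mono)
  next
    fix c :: real and f assume "0 \<le> c" "f \<in> ?P"
    then obtain h where "f \<in> definable" "h \<in> definable" "\<forall>v\<in>vals. 0 \<le> h v \<and> f v \<le> h v" "small h" by blast
    then show "(\<lambda>v. c * f v) \<in> ?P"
      using D.scale_mem[of f c] D.scale_mem[of h c] small_scale[of h c] \<open>0 \<le> c\<close>
      by (auto intro!: bexI[of _ "\<lambda>v. c * h v"] mult_left_mono)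
  next
    fix c :: real assume "(\<lambda>_. c) \<in> ?P"
    then obtain h where h: "\<forall>v\<in>vals. c \<le> h v" "small h" by blast
    show "c \<le> 0"
    proof (rule field_le_epsilon)
      fix \<delta> :: real assume "0 < \<delta>"
      then obtain \<epsilon> where "0 < \<epsilon>" "\<forall>v\<in>henkin_vals \<epsilon>. h v \<le> \<delta>"
        using h(2) by (auto simp: small_def)
      moreover then obtain v where "v \<in> henkin_vals \<epsilon>" using henkin_vals_nonempty by blast
      moreover have "henkin_vals \<epsilon> \<subseteq> vals" by (auto simp: henkin_vals_def)
      ultimately show "c \<le> 0 + \<delta>" using h(1) by force
    qed
  next
    fix f and \<delta> :: real assume "f \<in> ?P" "0 < \<delta>"
    then obtain h where h: "h \<in> definable" "\<forall>v\<in>vals. 0 \<le> h v \<and> f v \<le> h v" "small h" by blast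
    have "(\<lambda>v. h v - \<delta>) \<in> ?P"
      using h \<open>0 < \<delta>\<close> D.diff_mem[OF h(1) D.const_mem[of \<delta>]] by (auto intro!: bexI[of _ h])
    with h show "\<exists>g\<in>definable. (\<forall>v\<in>vals. 0 \<le> g v \<and> f v \<le> g v) \<and> (\<lambda>v. g v - \<delta>) \<in> ?P" by blast
  qed
  from D.ex_pure_state[OF this] obtain p where p: "D.state p" "D.pure p" and le: "\<And>f. f \<in> ?P \<Longrightarrow> p f \<le> 0"
    by blast
  have "p (ev (SupF i \<phi>) \<sigma>) \<le> p (ev \<phi> (\<sigma>(i := witness i \<phi> \<sigma>)))" if wf: "wf_fm L \<phi>" for i \<phi> \<sigma>
  proof -
    let ?f = "ev (SupF i \<phi>) \<sigma>" and ?g = "ev \<phi> (\<sigma>(i := witness i \<phi> \<sigma>))"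
    have mem: "?f \<in> definable" "?g \<in> definable" using wf by (auto intro: ev_mem)
    have "?g v \<le> ?f v" if "v \<in> vals" for v
    proof -
      have "v \<circ> \<sigma>(i := witness i \<phi> \<sigma>) = (v \<circ> \<sigma>)(i := v (witness i \<phi> \<sigma>))" by (auto simp: fun_eq_iff)
      moreover have "feval M ((v \<circ> \<sigma>)(i := v (witness i \<phi> \<sigma>))) \<phi> \<le> feval M (v \<circ> \<sigma>) (SupF i \<phi>)"
        by (intro SupF_upper wf vals_comp vals_mem that)
      ultimately show ?thesis unfolding ev_def by metis
    qed
    moreover have "?f v - ?g v \<le> \<delta>" if "v \<in> henkin_vals \<delta>" for v \<delta>
      using that wf by (simp add: henkin_vals_def diff_le_eq add.commute)
    then have "small (\<lambda>v. ?f v - ?g v)"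
      by (auto simp: small_def)
    ultimately have "(\<lambda>v. ?f v - ?g v) \<in> ?P"
      using D.diff_mem[OF mem] by (auto intro!: bexI[of _ "\<lambda>v. ?f v - ?g v"])
    then have "p (\<lambda>v. ?f v - ?g v) \<le> 0" by (rule le)
    then show ?thesis using D.state_diff[OF p(1) mem] by simp
  qed
  with p show ?thesis by blast
qed

end


section \<open>The model named by a pure type with witnesses\<close>

text \<open>The functional \<open>p\<close> is a complete description of the elements \<open>x\<^sub>i\<close> to be constructed:
  \<open>p (ev \<phi> \<sigma>)\<close> is the future value of \<open>\<phi>\<close> at the elements with indices \<open>\<sigma>\<close>.\<close>
locale henkin_state = lstructure L M
  for L :: "('c, 'f, 'r) language" and M :: "('c, 'f, 'r, 'u) lstruct" +
  fixes p :: "(('i \<Rightarrow> 'u) \<Rightarrow> real) \<Rightarrow> real"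
  assumes state: "function_space.state definable vals p"
    and pure: "function_space.pure definable vals p"
    and SupF_witness: "wf_fm L \<phi> \<Longrightarrow> \<exists>w. p (ev (SupF i \<phi>) \<sigma>) \<le> p (ev \<phi> (\<sigma>(i := w)))"
begin

sublocale D: function_space "definable :: (('i \<Rightarrow> 'u) \<Rightarrow> real) set" vals
  by (rule function_space_definable)

lemmas p_simps = D.state_add[OF state] D.state_scale[OF state] D.state_diff[OF state]
  D.state_const[OF state]
lemmas p_mono = D.state_mono[OF state] and p_sum = D.state_sum[OF state]
  and p_nonneg = D.state_nonneg[OF state]

text \<open>A witness for the infimum of \<open>\<phi>\<close> is one for the supremum of \<open>- \<phi>\<close>.\<close>
lemma InfF_witness:
  assumes wf: "wf_fm L \<phi>"
  shows "\<exists>w. p (ev \<phi> (\<sigma>(i := w))) \<le> p (ev (InfF i \<phi>) \<sigma>)"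
proof -
  let ?\<psi> = "Scale (-1) \<phi>"
  obtain w where w: "p (ev (SupF i ?\<psi>) \<sigma>) \<le> p (ev ?\<psi> (\<sigma>(i := w)))"
    using SupF_witness[of ?\<psi> i \<sigma>] wf by auto
  have "p (ev ?\<psi> (\<sigma>(i := w))) = - p (ev \<phi> (\<sigma>(i := w)))"
    using p_simps(2)[OF ev_mem[OF wf], of "-1"] by (simp add: ev_def[abs_def])
  moreover have "p (\<lambda>v. (-1) * ev (SupF i ?\<psi>) \<sigma> v) \<le> p (ev (InfF i \<phi>) \<sigma>)"
  proof (intro p_mono D.scale_mem ev_mem)
    fix v :: "'i \<Rightarrow> 'u" assume v: "v \<in> vals"
    show "(-1) * ev (SupF i ?\<psi>) \<sigma> v \<le> ev (InfF i \<phi>) \<sigma> v"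
      unfolding ev_def
    proof (rule InfF_greatest)
      fix a assume "a \<in> dom M"
      then have "feval M ((v \<circ> \<sigma>)(i := a)) ?\<psi> \<le> feval M (v \<circ> \<sigma>) (SupF i ?\<psi>)"
        using wf v by (intro SupF_upper vals_comp) auto
      then show "(-1) * feval M (v \<circ> \<sigma>) (SupF i ?\<psi>) \<le> feval M ((v \<circ> \<sigma>)(i := a)) \<phi>" by simp
    qed
  qed (use wf in auto)
  then have "- p (ev (SupF i ?\<psi>) \<sigma>) \<le> p (ev (InfF i \<phi>) \<sigma>)"
    using wf by (subst (asm) p_simps(2)) (auto intro: ev_mem)
  ultimately show ?thesis using w by (intro exI[of _ w]) simp
qed

text \<open>The distance prescribed by \<open>p\<close> between the values of two terms at elements of given indices.\<close>
definition type_dist :: "('c, 'f) trm \<Rightarrow> (nat \<Rightarrow> 'i) \<Rightarrow> ('c, 'f) trm \<Rightarrow> (nat \<Rightarrow> 'i) \<Rightarrow> real" where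
  "type_dist s \<sigma> t \<tau> = p (\<lambda>v. mdist M (teval M (v \<circ> \<sigma>) s) (teval M (v \<circ> \<tau>) t))"

lemma type_dist_commute: "type_dist s \<sigma> t \<tau> = type_dist t \<tau> s \<sigma>"
  unfolding type_dist_def by (subst commute) (rule refl)

lemma type_dist_Var: "type_dist (Var k) \<sigma> t \<tau> = type_dist (Var 0) (\<lambda>_. \<sigma> k) t \<tau>" "type_dist t \<tau> (Var k) \<sigma> = type_dist t \<tau> (Var 0) (\<lambda>_. \<sigma> k)"
  by (simp_all add: type_dist_def)

lemma type_dist_nonneg: "\<lbrakk>wf_trm L s; wf_trm L t\<rbrakk> \<Longrightarrow> 0 \<le> type_dist s \<sigma> t \<tau>"
  unfolding type_dist_def by (intro p_nonneg dist_mem) auto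

lemma type_dist_refl: "wf_trm L t \<Longrightarrow> type_dist t \<sigma> t \<sigma> = 0"
proof -
  assume wf: "wf_trm L t"
  have "type_dist t \<sigma> t \<sigma> \<le> p (\<lambda>_. 0)"
    unfolding type_dist_def using wf by (intro p_mono dist_mem D.const_mem) (simp_all add: teval_mem vals_comp)
  with type_dist_nonneg[OF wf wf, of \<sigma> \<sigma>] p_simps(4)[of 0] show ?thesis by simp
qed

lemma type_dist_le_1: "\<lbrakk>wf_trm L s; wf_trm L t\<rbrakk> \<Longrightarrow> type_dist s \<sigma> t \<tau> \<le> 1"
proof -
  assume wf: "wf_trm L s" "wf_trm L t"
  have "type_dist s \<sigma> t \<tau> \<le> p (\<lambda>_. 1)"
    unfolding type_dist_def using wf by (intro p_mono dist_mem D.const_mem mdist_le_1 teval_mem vals_comp)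
  with p_simps(4)[of 1] show ?thesis by simp
qed

lemma type_dist_triangle:
  assumes "wf_trm L s" "wf_trm L t" "wf_trm L u"
  shows "type_dist s \<sigma> u \<rho> \<le> type_dist s \<sigma> t \<tau> + type_dist t \<tau> u \<rho>"
proof -
  have "type_dist s \<sigma> u \<rho> \<le> p (\<lambda>v. mdist M (teval M (v \<circ> \<sigma>) s) (teval M (v \<circ> \<tau>) t) +
      mdist M (teval M (v \<circ> \<tau>) t) (teval M (v \<circ> \<rho>) u))"
    unfolding type_dist_def using assms
    by (intro p_mono D.add_mem dist_mem triangle teval_mem vals_comp)
  also have "\<dots> = type_dist s \<sigma> t \<tau> + type_dist t \<tau> u \<rho>"
    unfolding type_dist_def using assms by (intro p_simps(1) dist_mem)
  finally show ?thesis .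
qed

lemma weighted_sum:
  assumes "\<And>k. k < n \<Longrightarrow> g k \<in> definable"
  shows "(\<lambda>v. c * (\<Sum>k<n. (1/2) ^ k * g k v)) \<in> definable"
    and "p (\<lambda>v. c * (\<Sum>k<n. (1/2) ^ k * g k v)) = c * (\<Sum>k<n. (1/2) ^ k * p (g k))"
proof -
  have mem: "(\<lambda>v. (1/2) ^ k * g k v) \<in> definable" if "k < n" for k
    using assms[OF that] by (rule D.scale_mem)
  then have sum: "(\<lambda>v. \<Sum>k<n. (1/2) ^ k * g k v) \<in> definable" by (rule D.sum_mem)
  then show "(\<lambda>v. c * (\<Sum>k<n. (1/2) ^ k * g k v)) \<in> definable" by (rule D.scale_mem)
  have "p (\<lambda>v. c * (\<Sum>k<n. (1/2) ^ k * g k v)) = c * p (\<lambda>v. \<Sum>k<n. (1/2) ^ k * g k v)"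
    by (rule p_simps(2)[OF sum])
  also have "p (\<lambda>v. \<Sum>k<n. (1/2) ^ k * g k v) = (\<Sum>k<n. p (\<lambda>v. (1/2) ^ k * g k v))"
    by (rule p_sum[OF mem])
  also have "\<dots> = (\<Sum>k<n. (1/2) ^ k * p (g k))"
    using assms by (intro sum.cong refl p_simps(2)) auto
  finally show "p (\<lambda>v. c * (\<Sum>k<n. (1/2) ^ k * g k v)) = c * (\<Sum>k<n. (1/2) ^ k * p (g k))" .
qed

lemma tdist_map_teval:
  assumes "length ts = n" "length us = n"
  shows "tdist M n (map (teval M (v \<circ> \<sigma>)) ts) (map (teval M (v \<circ> \<tau>)) us) =
    (\<Sum>k<n. (1/2) ^ k * mdist M (teval M (v \<circ> \<sigma>) (ts ! k)) (teval M (v \<circ> \<tau>) (us ! k)))"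
  unfolding tdist_def using assms by (intro sum.cong) auto

lemma type_dist_App:
  assumes wf: "wf_trm L (App F ts)" "wf_trm L (App F us)"
  shows "type_dist (App F ts) \<sigma> (App F us) \<tau> \<le>
    flip L F * (\<Sum>k<farity L F. (1/2) ^ k * type_dist (ts ! k) \<sigma> (us ! k) \<tau>)"
proof -
  let ?n = "farity L F"
  let ?g = "\<lambda>k v. mdist M (teval M (v \<circ> \<sigma>) (ts ! k)) (teval M (v \<circ> \<tau>) (us ! k))"
  have g: "?g k \<in> definable" if "k < ?n" for k
    using wf that by (intro dist_mem) auto
  have "type_dist (App F ts) \<sigma> (App F us) \<tau> \<le> p (\<lambda>v. flip L F * (\<Sum>k<?n. (1/2) ^ k * ?g k v))"
    unfolding type_dist_def
  proof (intro p_mono dist_mem wf weighted_sum(1) g)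
    fix v :: "'i \<Rightarrow> 'u" assume v: "v \<in> vals"
    have "mdist M (fint M F (map (teval M (v \<circ> \<sigma>)) ts)) (fint M F (map (teval M (v \<circ> \<tau>)) us)) \<le>
        flip L F * tdist M ?n (map (teval M (v \<circ> \<sigma>)) ts) (map (teval M (v \<circ> \<tau>)) us)"
      using wf map_teval_mem[of ts "v \<circ> \<sigma>"] map_teval_mem[of us "v \<circ> \<tau>"] vals_comp[OF v]
      by (intro fint_lipschitz) auto
    then show "mdist M (teval M (v \<circ> \<sigma>) (App F ts)) (teval M (v \<circ> \<tau>) (App F us)) \<le>
        flip L F * (\<Sum>k<?n. (1/2) ^ k * ?g k v)"
      using wf by (simp add: tdist_map_teval)
  qed (use wf in auto)
  also have "\<dots> = flip L F * (\<Sum>k<?n. (1/2) ^ k * p (?g k))"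
    by (rule weighted_sum(2)) (rule g)
  finally show ?thesis unfolding type_dist_def .
qed

lemma p_Rel_le:
  assumes wf: "wf_fm L (Rel R ts)" "wf_fm L (Rel R us)"
  shows "p (ev (Rel R ts) \<sigma>) - p (ev (Rel R us) \<tau>) \<le>
    rlip L R * (\<Sum>k<rarity L R. (1/2) ^ k * type_dist (ts ! k) \<sigma> (us ! k) \<tau>)"
proof -
  let ?n = "rarity L R"
  let ?g = "\<lambda>k v. mdist M (teval M (v \<circ> \<sigma>) (ts ! k)) (teval M (v \<circ> \<tau>) (us ! k))"
  have g: "?g k \<in> definable" if "k < ?n" for k
    using wf that by (intro dist_mem) auto
  have "p (\<lambda>v. ev (Rel R ts) \<sigma> v - ev (Rel R us) \<tau> v) \<le> p (\<lambda>v. rlip L R * (\<Sum>k<?n. (1/2) ^ k * ?g k v))"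
  proof (intro p_mono D.diff_mem ev_mem wf weighted_sum(1) g)
    fix v :: "'i \<Rightarrow> 'u" assume v: "v \<in> vals"
    have "\<bar>rint M R (map (teval M (v \<circ> \<sigma>)) ts) - rint M R (map (teval M (v \<circ> \<tau>)) us)\<bar> \<le>
        rlip L R * tdist M ?n (map (teval M (v \<circ> \<sigma>)) ts) (map (teval M (v \<circ> \<tau>)) us)"
      using wf map_teval_mem[of ts "v \<circ> \<sigma>"] map_teval_mem[of us "v \<circ> \<tau>"] vals_comp[OF v]
      by (intro rint_lipschitz) auto
    then show "ev (Rel R ts) \<sigma> v - ev (Rel R us) \<tau> v \<le> rlip L R * (\<Sum>k<?n. (1/2) ^ k * ?g k v)"
      using wf by (simp add: tdist_map_teval ev_def)
  qed (use wf in auto)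
  also have "\<dots> = rlip L R * (\<Sum>k<?n. (1/2) ^ k * p (?g k))"
    by (rule weighted_sum(2)) (rule g)
  finally show ?thesis unfolding type_dist_def
    using D.state_diff[OF state ev_mem[OF wf(1)] ev_mem[OF wf(2)]] by simp
qed

lemma p_Rel_lipschitz:
  assumes wf: "wf_fm L (Rel R ts)" "wf_fm L (Rel R us)"
  shows "\<bar>p (ev (Rel R ts) \<sigma>) - p (ev (Rel R us) \<tau>)\<bar> \<le>
    rlip L R * (\<Sum>k<rarity L R. (1/2) ^ k * type_dist (ts ! k) \<sigma> (us ! k) \<tau>)"
  using p_Rel_le[OF wf, of \<sigma> \<tau>] p_Rel_le[OF wf(2,1), of \<tau> \<sigma>] type_dist_commute
  by (simp add: abs_le_iff)

definition named :: "('c, 'f) trm \<Rightarrow> (nat \<Rightarrow> 'i) \<Rightarrow> 'i \<Rightarrow> bool" where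
  "named t \<sigma> w \<longleftrightarrow> type_dist t \<sigma> (Var 0) (\<lambda>_. w) = 0"

text \<open>The infimum of \<open>d(t, x)\<close> over \<open>x\<close> is \<open>0\<close>, so a witness for it is a variable that the type
  identifies with \<open>t\<close>.\<close>
lemma ex_named:
  assumes wf: "wf_trm L t"
  shows "\<exists>w. named t \<sigma> w"
proof -
  obtain m where m: "m \<notin> tvars t" using ex_new_if_finite[OF infinite_UNIV_nat finite_tvars] by blast
  let ?\<phi> = "Dist t (Var m)"
  obtain w where w: "p (ev ?\<phi> (\<sigma>(m := w))) \<le> p (ev (InfF m ?\<phi>) \<sigma>)"
    using InfF_witness[of ?\<phi> \<sigma> m] wf by auto
  have "teval M (v \<circ> \<sigma>(m := w)) t = teval M (v \<circ> \<sigma>) t" for v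
    by (rule teval_cong) (use m in auto)
  then have "ev ?\<phi> (\<sigma>(m := w)) = (\<lambda>v. mdist M (teval M (v \<circ> \<sigma>) t) (v w))"
    by (simp add: ev_def[abs_def])
  then have "p (ev ?\<phi> (\<sigma>(m := w))) = type_dist t \<sigma> (Var 0) (\<lambda>_. w)"
    by (simp add: type_dist_def)
  moreover have "p (ev (InfF m ?\<phi>) \<sigma>) \<le> p (\<lambda>_. 0)"
  proof (intro p_mono ev_mem D.const_mem)
    fix v :: "'i \<Rightarrow> 'u" assume v: "v \<in> vals"
    let ?a = "teval M (v \<circ> \<sigma>) t"
    have a: "?a \<in> dom M" using wf v by (intro teval_mem vals_comp)
    have "ev (InfF m ?\<phi>) \<sigma> v \<le> feval M ((v \<circ> \<sigma>)(m := ?a)) ?\<phi>"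
      unfolding ev_def using wf v a by (intro InfF_lower vals_comp) auto
    also have "teval M ((v \<circ> \<sigma>)(m := ?a)) t = ?a"
      using m by (intro teval_cong) auto
    then have "feval M ((v \<circ> \<sigma>)(m := ?a)) ?\<phi> = 0" using a by simp
    finally show "ev (InfF m ?\<phi>) \<sigma> v \<le> 0" .
  qed (use wf in auto)
  ultimately have "type_dist t \<sigma> (Var 0) (\<lambda>_. w) = 0"
    using w type_dist_nonneg[OF wf, of "Var 0" \<sigma> "\<lambda>_. w"] p_simps(4)[of 0] by simp
  then show ?thesis by (auto simp: named_def)
qed

end

text \<open>The metric part of the new model is taken as given: a completion of the variables with the
  distance prescribed by \<open>p\<close>.\<close>
locale henkin_completion = henkin_state L M p
  for L :: "('c, 'f, 'r) language" and M :: "('c, 'f, 'r, 'u) lstruct"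
    and p :: "(('i \<Rightarrow> 'u) \<Rightarrow> real) \<Rightarrow> real" +
  fixes Q :: "'u set" and d :: "'u \<Rightarrow> 'u \<Rightarrow> real" and e :: "'i \<Rightarrow> 'u"
  assumes Q_metric: "Metric_space Q d"
    and Q_complete: "Metric_space.mcomplete Q d"
    and e_mem: "e i \<in> Q"
    and d_e: "d (e i) (e j) = type_dist (Var 0) (\<lambda>_. i) (Var 0) (\<lambda>_. j)"
    and e_dense: "\<lbrakk>q \<in> Q; 0 < \<epsilon>\<rbrakk> \<Longrightarrow> \<exists>i. d q (e i) < \<epsilon>"
begin

sublocale Q: Metric_space Q d by (rule Q_metric)

text \<open>This is \<open>tdist\<close> of the structure to be defined, whose operations depend on it.\<close>
definition tuple_dist :: "nat \<Rightarrow> 'u list \<Rightarrow> 'u list \<Rightarrow> real" where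
  "tuple_dist n as bs = (\<Sum>k<n. (1/2) ^ k * d (as ! k) (bs ! k))"

lemma tuple_dist_commute: "tuple_dist n as bs = tuple_dist n bs as"
  unfolding tuple_dist_def using Q.commute by simp

lemma tuple_dist_self: "\<lbrakk>length as = n; set as \<subseteq> Q\<rbrakk> \<Longrightarrow> tuple_dist n as as = 0"
  unfolding tuple_dist_def by (intro sum.neutral) (auto simp: Q.zero[THEN iffD2] subset_iff)

lemma tuple_dist_triangle:
  assumes "length as = n" "set as \<subseteq> Q" "length bs = n" "set bs \<subseteq> Q" "length cs = n" "set cs \<subseteq> Q"
  shows "tuple_dist n as cs \<le> tuple_dist n as bs + tuple_dist n bs cs"
proof -
  have "(1/2) ^ k * d (as ! k) (cs ! k) \<le> (1/2) ^ k * d (as ! k) (bs ! k) + (1/2) ^ k * d (bs ! k) (cs ! k)"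
    if "k < n" for k
  proof -
    have "d (as ! k) (cs ! k) \<le> d (as ! k) (bs ! k) + d (bs ! k) (cs ! k)"
      using assms that by (intro Q.triangle) (auto simp: subset_iff)
    then have "(1/2) ^ k * d (as ! k) (cs ! k) \<le> (1/2) ^ k * (d (as ! k) (bs ! k) + d (bs ! k) (cs ! k))"
      by (intro mult_left_mono) auto
    then show ?thesis by (simp add: distrib_left)
  qed
  then show ?thesis
    unfolding tuple_dist_def sum.distrib[symmetric] by (intro sum_mono) auto
qed

lemma map_e_subset: "set (map e is) \<subseteq> Q"
  using e_mem by auto

lemma tuple_dist_e:
  assumes "length is = n" "length js = n"
  shows "tuple_dist n (map e is) (map e js) = (\<Sum>k<n. (1/2) ^ k * type_dist (Var k) ((!) is) (Var k) ((!) js))"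
  unfolding tuple_dist_def using assms by (intro sum.cong) (simp_all add: d_e type_dist_def)

lemma near_tuple:
  assumes "length as = n" "set as \<subseteq> Q" "0 < \<epsilon>"
  shows "\<exists>is. length is = n \<and> tuple_dist n as (map e is) < \<epsilon>"
proof -
  let ?\<delta> = "\<epsilon> / (real n + 1)"
  have \<delta>: "0 < ?\<delta>" using assms by simp
  have "\<forall>q. \<exists>i. q \<in> Q \<longrightarrow> d q (e i) < ?\<delta>" using e_dense[OF _ \<delta>] by blast
  then obtain f where f: "\<And>q. q \<in> Q \<Longrightarrow> d q (e (f q)) < ?\<delta>" by metis
  have "tuple_dist n as (map e (map f as)) \<le> (\<Sum>k<n. ?\<delta>)"
    unfolding tuple_dist_def
  proof (rule sum_mono)
    fix k assume "k \<in> {..<n}"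
    then have k: "k < length as" "as ! k \<in> Q" using assms by (auto simp: subset_iff)
    have "(1/2) ^ k * d (as ! k) (e (f (as ! k))) \<le> 1 * d (as ! k) (e (f (as ! k)))"
      by (intro mult_right_mono power_le_one) auto
    then show "(1/2) ^ k * d (as ! k) (map e (map f as) ! k) \<le> ?\<delta>"
      using f[OF k(2)] k(1) by simp
  qed
  also have "\<dots> < \<epsilon>" using assms(3) by (simp add: field_simps)
  finally show ?thesis using assms(1) by (intro exI[of _ "map f as"]) simp
qed

definition fterm :: "'f \<Rightarrow> ('c, 'f) trm" where
  "fterm F = App F (map Var [0..<farity L F])"

definition ratom :: "'r \<Rightarrow> ('c, 'f, 'r) fm" where
  "ratom R = Rel R (map Var [0..<rarity L R])"

lemma wf_fterm: "F \<in> fsyms L \<Longrightarrow> wf_trm L (fterm F)"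
  and wf_ratom: "R \<in> rsyms L \<Longrightarrow> wf_fm L (ratom R)"
  by (auto simp: fterm_def ratom_def)

lemma d_named:
  assumes "wf_trm L s" "wf_trm L t" "named s \<sigma> w" "named t \<tau> w'"
  shows "d (e w) (e w') = type_dist s \<sigma> t \<tau>"
proof (rule antisym)
  have 0: "type_dist (Var 0) (\<lambda>_. w) s \<sigma> = 0" "type_dist t \<tau> (Var 0) (\<lambda>_. w') = 0"
    "type_dist s \<sigma> (Var 0) (\<lambda>_. w) = 0" "type_dist (Var 0) (\<lambda>_. w') t \<tau> = 0"
    using assms type_dist_commute by (auto simp: named_def)
  show "d (e w) (e w') \<le> type_dist s \<sigma> t \<tau>"
    using type_dist_triangle[of "Var 0" s "Var 0" "\<lambda>_. w" "\<lambda>_. w'" \<sigma>]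
      type_dist_triangle[of s t "Var 0" \<sigma> "\<lambda>_. w'" \<tau>] assms 0 by (simp add: d_e)
  show "type_dist s \<sigma> t \<tau> \<le> d (e w) (e w')"
    using type_dist_triangle[of s "Var 0" t \<sigma> \<tau> "\<lambda>_. w"]
      type_dist_triangle[of "Var 0" "Var 0" t "\<lambda>_. w" \<tau> "\<lambda>_. w'"] assms 0 by (simp add: d_e)
qed

text \<open>Names of terms that the type identifies become equal in the completion.\<close>
lemma named_unique:
  assumes "wf_trm L s" "wf_trm L t" "named s \<sigma> w" "named t \<tau> w'" "type_dist s \<sigma> t \<tau> = 0"
  shows "e w = e w'"
  using d_named[OF assms(1-4)] assms(5) e_mem by simp

text \<open>The graph of the interpretation of \<open>F\<close> on named elements. It relates indices, so it need not be
  single-valued; any two names of a value are at distance \<open>0\<close>.\<close>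
definition f_names :: "'f \<Rightarrow> ('i list \<times> 'i) set" where
  "f_names F = {(is, w). length is = farity L F \<and> named (fterm F) ((!) is) w}"

lemma f_names_near:
  assumes F: "F \<in> fsyms L" and "length as = farity L F" "set as \<subseteq> Q" "0 < \<epsilon>"
  shows "\<exists>b\<in>f_names F. tuple_dist (farity L F) as (map e (fst b)) < \<epsilon>"
  using near_tuple[OF assms(2-4)] ex_named[OF wf_fterm[OF F]] by (fastforce simp: f_names_def)

lemma f_names_lipschitz:
  assumes F: "F \<in> fsyms L" and b: "b \<in> f_names F" "b' \<in> f_names F"
  shows "d (e (snd b)) (e (snd b')) \<le> flip L F * tuple_dist (farity L F) (map e (fst b)) (map e (fst b'))"
proof -
  obtain "is" w js w' where bs: "b = (is, w)" "b' = (js, w')" by (metis surj_pair)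
  have "d (e w) (e w') = type_dist (fterm F) ((!) is) (fterm F) ((!) js)"
    using b by (intro d_named wf_fterm F) (auto simp: bs f_names_def)
  also have "\<dots> \<le> flip L F * (\<Sum>k<farity L F. (1/2) ^ k *
      type_dist (map Var [0..<farity L F] ! k) ((!) is) (map Var [0..<farity L F] ! k) ((!) js))"
    unfolding fterm_def by (rule type_dist_App) (use wf_fterm[OF F] in \<open>auto simp: fterm_def\<close>)
  also have "\<dots> = flip L F * tuple_dist (farity L F) (map e is) (map e js)"
    using b by (subst tuple_dist_e) (auto simp: bs f_names_def)
  finally show ?thesis by (simp add: bs)
qed

text \<open>The operations are extended from named elements by \<open>lipschitz_limit\<close>.\<close>
definition fN :: "'f \<Rightarrow> 'u list \<Rightarrow> 'u" where
  "fN F as = (SOME y. y \<in> Q \<and>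
     (\<forall>b\<in>f_names F. d y (e (snd b)) \<le> flip L F * tuple_dist (farity L F) as (map e (fst b))))"

lemma fN:
  assumes F: "F \<in> fsyms L" and as: "length as = farity L F" "set as \<subseteq> Q"
  shows "fN F as \<in> Q"
    and "b \<in> f_names F \<Longrightarrow> d (fN F as) (e (snd b)) \<le> flip L F * tuple_dist (farity L F) as (map e (fst b))"
proof -
  have "\<exists>y\<in>Q. \<forall>b\<in>f_names F. d y (e (snd b)) \<le> flip L F * tuple_dist (farity L F) as (map e (fst b))"
  proof (rule Q.lipschitz_limit[OF Q_complete flip_nonneg[OF F] e_mem])
    fix b b' assume b: "b \<in> f_names F" "b' \<in> f_names F"
    have "tuple_dist (farity L F) (map e (fst b)) (map e (fst b')) \<le>
        tuple_dist (farity L F) (map e (fst b)) as + tuple_dist (farity L F) as (map e (fst b'))"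
      using b as by (intro tuple_dist_triangle map_e_subset) (auto simp: f_names_def)
    from mult_left_mono[OF this flip_nonneg[OF F]] f_names_lipschitz[OF F b]
    show "d (e (snd b)) (e (snd b')) \<le>
        flip L F * (tuple_dist (farity L F) as (map e (fst b)) + tuple_dist (farity L F) as (map e (fst b')))"
      unfolding tuple_dist_commute[of _ as "map e (fst b)"] by (rule order_trans[rotated])
  qed (use f_names_near[OF F as] in auto)
  then have "\<exists>y. y \<in> Q \<and> (\<forall>b\<in>f_names F. d y (e (snd b)) \<le> flip L F * tuple_dist (farity L F) as (map e (fst b)))"
    by (simp only: Bex_def)
  from someI_ex[OF this] have *: "fN F as \<in> Q \<and>
      (\<forall>b\<in>f_names F. d (fN F as) (e (snd b)) \<le> flip L F * tuple_dist (farity L F) as (map e (fst b)))"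
    unfolding fN_def .
  then show "fN F as \<in> Q"
    "b \<in> f_names F \<Longrightarrow> d (fN F as) (e (snd b)) \<le> flip L F * tuple_dist (farity L F) as (map e (fst b))"
    by auto
qed

lemma ratom_lipschitz:
  assumes R: "R \<in> rsyms L" and "length is = rarity L R" "length js = rarity L R"
  shows "\<bar>p (ev (ratom R) ((!) is)) - p (ev (ratom R) ((!) js))\<bar> \<le>
    rlip L R * tuple_dist (rarity L R) (map e is) (map e js)"
  using p_Rel_lipschitz[OF wf_ratom[OF R, unfolded ratom_def] wf_ratom[OF R, unfolded ratom_def], of "(!) is" "(!) js"]
    assms by (simp add: tuple_dist_e ratom_def)

definition rN :: "'r \<Rightarrow> 'u list \<Rightarrow> real" where
  "rN R as = (SOME y. \<forall>is\<in>{is. length is = rarity L R}.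
     dist y (p (ev (ratom R) ((!) is))) \<le> rlip L R * tuple_dist (rarity L R) as (map e is))"

lemma rN:
  assumes R: "R \<in> rsyms L" and as: "length as = rarity L R" "set as \<subseteq> Q" and "length is = rarity L R"
  shows "\<bar>rN R as - p (ev (ratom R) ((!) is))\<bar> \<le> rlip L R * tuple_dist (rarity L R) as (map e is)"
proof -
  have "\<exists>y\<in>UNIV. \<forall>is\<in>{is. length is = rarity L R}.
     dist y (p (ev (ratom R) ((!) is))) \<le> rlip L R * tuple_dist (rarity L R) as (map e is)"
  proof (rule Met_TC.lipschitz_limit)
    fix "is" js :: "'i list" assume len: "is \<in> {is. length is = rarity L R}" "js \<in> {is. length is = rarity L R}"
    have "tuple_dist (rarity L R) (map e is) (map e js) \<le> tuple_dist (rarity L R) (map e is) as + tuple_dist (rarity L R) as (map e js)"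
      using len as by (intro tuple_dist_triangle map_e_subset) auto
    from mult_left_mono[OF this rlip_nonneg[OF R]] ratom_lipschitz[OF R, of "is" js] len
    show "dist (p (ev (ratom R) ((!) is))) (p (ev (ratom R) ((!) js))) \<le>
        rlip L R * (tuple_dist (rarity L R) as (map e is) + tuple_dist (rarity L R) as (map e js))"
      unfolding tuple_dist_commute[of _ as "map e is"] dist_real_def by simp
  qed (use rlip_nonneg[OF R] near_tuple[OF as] complete_UNIV in auto)
  then have "\<exists>y. \<forall>is\<in>{is. length is = rarity L R}.
     dist y (p (ev (ratom R) ((!) is))) \<le> rlip L R * tuple_dist (rarity L R) as (map e is)" by simp
  from someI_ex[OF this] have "\<forall>is\<in>{is. length is = rarity L R}.
     dist (rN R as) (p (ev (ratom R) ((!) is))) \<le> rlip L R * tuple_dist (rarity L R) as (map e is)"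
    unfolding rN_def .
  then show ?thesis using assms by (auto simp: dist_real_def)
qed

text \<open>A constant symbol has no variables, so any assignment serves to name it.\<close>
definition N :: "('c, 'f, 'r, 'u) lstruct" where
  "N = \<lparr>dom = Q, mdist = d, cint = \<lambda>c. e (SOME w. named (Cst c) (\<lambda>_. undefined) w),
        fint = fN, rint = rN\<rparr>"

lemma N_simps [simp]:
  "dom N = Q" "mdist N = d" "cint N c = e (SOME w. named (Cst c) (\<lambda>_. undefined) w)"
  "fint N = fN" "rint N = rN" "tdist N = tuple_dist"
  by (simp_all add: N_def tdist_def tuple_dist_def fun_eq_iff)

lemma tuples_N: "as \<in> tuples N n \<longleftrightarrow> length as = n \<and> set as \<subseteq> Q"
  by (simp add: tuples_def)

lemma d_le_1: "\<lbrakk>x \<in> Q; y \<in> Q\<rbrakk> \<Longrightarrow> d x y \<le> 1"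
proof (rule field_le_epsilon)
  fix \<epsilon> :: real assume xy: "x \<in> Q" "y \<in> Q" and "0 < \<epsilon>"
  then obtain i j where ij: "d x (e i) < \<epsilon>/2" "d y (e j) < \<epsilon>/2"
    using e_dense half_gt_zero by metis
  have "d x y \<le> d x (e i) + d (e i) y" "d (e i) y \<le> d (e i) (e j) + d (e j) y"
    using xy e_mem by (auto intro: Q.triangle)
  moreover have "d (e i) (e j) \<le> 1" unfolding d_e by (intro type_dist_le_1) auto
  ultimately show "d x y \<le> 1 + \<epsilon>" using ij Q.commute[of y] by simp
qed

lemma is_structure_N: "is_structure L N"
  unfolding is_structure_def N_simps tuples_N
proof (intro conjI ballI)
  show "Q \<noteq> {}" using e_mem by blast
  show "d (fN F as) (fN F bs) \<le> flip L F * tuple_dist (farity L F) as bs"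
    if "F \<in> fsyms L" "as \<in> tuples N (farity L F)" "bs \<in> tuples N (farity L F)" for F as bs
  proof (rule Q.lipschitz_limits_dist[where B = "f_names F" and G = "\<lambda>b. e (snd b)"
        and c = "\<lambda>b. tuple_dist (farity L F) as (map e (fst b))" and c' = "\<lambda>b. tuple_dist (farity L F) bs (map e (fst b))"])
    fix b assume "b \<in> f_names F"
    then show "tuple_dist (farity L F) bs (map e (fst b)) \<le> tuple_dist (farity L F) as bs + tuple_dist (farity L F) as (map e (fst b))"
      using that tuple_dist_triangle[of bs _ as "map e (fst b)"] map_e_subset tuple_dist_commute[of _ bs as]
      by (auto simp: f_names_def tuples_N)
  qed (use that fN[of F as] fN[of F bs] flip_nonneg[of F] e_mem f_names_near[of F as] in \<open>auto simp: tuples_N\<close>)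
  show "\<bar>rN R as\<bar> \<le> 1" if "R \<in> rsyms L" "as \<in> tuples N (rarity L R)" for R as
  proof (rule field_le_epsilon)
    fix \<epsilon> :: real assume "0 < \<epsilon>"
    then have "0 < \<epsilon> / (rlip L R + 1)" using rlip_nonneg[OF that(1)] by (intro divide_pos_pos) auto
    then have "\<exists>is. length is = rarity L R \<and> tuple_dist (rarity L R) as (map e is) < \<epsilon> / (rlip L R + 1)"
      using that by (intro near_tuple) (auto simp: tuples_N)
    then obtain "is" where "is": "length is = rarity L R" "tuple_dist (rarity L R) as (map e is) < \<epsilon> / (rlip L R + 1)"
      by blast
    have "rlip L R * tuple_dist (rarity L R) as (map e is) \<le> rlip L R * (\<epsilon> / (rlip L R + 1))"
      using "is" rlip_nonneg[OF that(1)] by (intro mult_left_mono) auto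
    also have "\<dots> \<le> \<epsilon>" using rlip_nonneg[OF that(1)] \<open>0 < \<epsilon>\<close> by (simp add: field_simps)
    finally have 1: "\<bar>rN R as - p (ev (ratom R) ((!) is))\<bar> \<le> \<epsilon>"
      using rN[OF that(1) _ _ "is"(1), of as] that by (auto simp: tuples_N)
    have bound: "\<bar>ev (ratom R) ((!) is) v\<bar> \<le> 1" if "v \<in> vals" for v
    proof -
      have "map (teval M (v \<circ> (!) is)) (map Var [0..<rarity L R]) \<in> tuples M (rarity L R)"
        using that by (auto simp: tuples_def vals_mem)
      then show ?thesis
        unfolding ev_def ratom_def feval.simps
        by (rule rint_bounded[OF \<open>R \<in> rsyms L\<close>])
    qed
    have "p (ev (ratom R) ((!) is)) \<le> p (\<lambda>_. 1)" "p (\<lambda>_. -1) \<le> p (ev (ratom R) ((!) is))"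
      using bound by (intro p_mono ev_mem wf_ratom that D.const_mem; force simp: abs_le_iff)+
    then show "\<bar>rN R as\<bar> \<le> 1 + \<epsilon>" using 1 p_simps(4)[of 1] p_simps(4)[of "-1"] by linarith
  qed
  show "\<bar>rN R as - rN R bs\<bar> \<le> rlip L R * tuple_dist (rarity L R) as bs"
    if "R \<in> rsyms L" "as \<in> tuples N (rarity L R)" "bs \<in> tuples N (rarity L R)" for R as bs
    unfolding dist_real_def[symmetric]
  proof (rule Met_TC.lipschitz_limits_dist[where B = "{is. length is = rarity L R}" and G = "\<lambda>is. p (ev (ratom R) ((!) is))"
        and c = "\<lambda>is. tuple_dist (rarity L R) as (map e is)" and c' = "\<lambda>is. tuple_dist (rarity L R) bs (map e is)"])
    fix "is" :: "'i list" assume "is \<in> {is. length is = rarity L R}"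
    then show "tuple_dist (rarity L R) bs (map e is) \<le> tuple_dist (rarity L R) as bs + tuple_dist (rarity L R) as (map e is)"
      using that tuple_dist_triangle[of bs _ as "map e is"] map_e_subset tuple_dist_commute[of _ bs as]
      by (auto simp: tuples_N)
  qed (use that rN[of R as] rN[of R bs] rlip_nonneg[of R] near_tuple[of as] in \<open>auto simp: tuples_N dist_real_def\<close>)
qed (use fN Q_metric Q_complete d_le_1 e_mem in \<open>auto simp: tuples_N\<close>)

sublocale N: lstructure L N
  using language is_structure_N by unfold_locales

lemma teval_N:
  assumes "wf_trm L t" "named t \<sigma> w"
  shows "teval N (e \<circ> \<sigma>) t = e w"
  using assms
proof (induction t arbitrary: w)
  case (Var k)
  have "named (Var k) \<sigma> (\<sigma> k)"
    unfolding named_def type_dist_Var(1)[of k] by (rule type_dist_refl) simp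
  then show ?case
    using named_unique[OF _ _ _ Var.prems(2), of "Var k" \<sigma> "\<sigma> k"] type_dist_refl[of "Var k" \<sigma>] by simp
next
  case (Cst c)
  have "named (Cst c) (\<lambda>_. undefined) (SOME w. named (Cst c) (\<lambda>_. undefined) w)"
    using someI_ex[OF ex_named[OF Cst.prems(1)]] .
  moreover have "type_dist (Cst c) (\<lambda>_. undefined) (Cst c) \<sigma> = 0"
    using type_dist_refl[OF Cst.prems(1), of \<sigma>] by (simp add: type_dist_def)
  ultimately show ?case
    using named_unique[OF Cst.prems(1) Cst.prems(1) _ Cst.prems(2)] by simp
next
  case (App F ts)
  then have F: "F \<in> fsyms L" "length ts = farity L F" and ts: "\<And>t. t \<in> set ts \<Longrightarrow> wf_trm L t" by auto
  define g where "g t = (SOME w. named t \<sigma> w)" for t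
  have g: "named t \<sigma> (g t)" if "t \<in> set ts" for t
    unfolding g_def using someI_ex[OF ex_named[OF ts[OF that]]] .
  let ?is = "map g ts"
  obtain w' where w': "named (fterm F) ((!) ?is) w'" using ex_named[OF wf_fterm[OF F(1)]] by blast
  have "teval N (e \<circ> \<sigma>) t = e (g t)" if "t \<in> set ts" for t
    by (rule App.IH[OF that ts[OF that] g[OF that]])
  then have "map (teval N (e \<circ> \<sigma>)) ts = map e ?is"
    by (simp only: map_map map_eq_conv comp_apply) blast
  moreover have "fN F (map e ?is) = e w'"
  proof -
    have "d (fN F (map e ?is)) (e w') \<le> flip L F * tuple_dist (farity L F) (map e ?is) (map e ?is)"
      using fN(2)[OF F(1) _ map_e_subset, of ?is "(?is, w')"] w' F(2) by (simp add: f_names_def)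
    also have "tuple_dist (farity L F) (map e ?is) (map e ?is) = 0"
      using F(2) by (intro tuple_dist_self map_e_subset) simp
    finally have "d (fN F (map e ?is)) (e w') \<le> 0" by (simp only: mult_zero_right)
    then have "d (fN F (map e ?is)) (e w') = 0" by (rule antisym) (rule Q.nonneg)
    then show ?thesis
      using fN(1)[OF F(1) _ map_e_subset, of ?is] F(2) e_mem by simp
  qed
  moreover have "e w' = e w"
  proof (rule named_unique[OF wf_fterm[OF F(1)] App.prems(1) w' App.prems(2)])
    have "type_dist (fterm F) ((!) ?is) (App F ts) \<sigma> \<le>
        flip L F * (\<Sum>k<farity L F. (1/2) ^ k * type_dist (map Var [0..<farity L F] ! k) ((!) ?is) (ts ! k) \<sigma>)"
      unfolding fterm_def
      by (rule type_dist_App) (use App.prems wf_fterm[OF F(1)] in \<open>auto simp: fterm_def\<close>)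
    also have "(\<Sum>k<farity L F. (1/2) ^ k * type_dist (map Var [0..<farity L F] ! k) ((!) ?is) (ts ! k) \<sigma>) = 0"
    proof (rule sum.neutral, rule ballI)
      fix k assume k: "k \<in> {..<farity L F}"
      then have "type_dist (Var k) ((!) ?is) (ts ! k) \<sigma> = type_dist (ts ! k) \<sigma> (Var 0) (\<lambda>_. g (ts ! k))"
        using F(2) by (simp add: type_dist_Var(1)[of k] type_dist_commute[of "ts ! k"])
      then show "(1/2) ^ k * type_dist (map Var [0..<farity L F] ! k) ((!) ?is) (ts ! k) \<sigma> = 0"
        using g[of "ts ! k"] k F(2) by (simp add: named_def)
    qed
    finally show "type_dist (fterm F) ((!) ?is) (App F ts) \<sigma> = 0"
      using type_dist_nonneg[OF wf_fterm[OF F(1)] App.prems(1), of "(!) ?is" \<sigma>] by simp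
  qed
  ultimately show ?case by (simp only: teval.simps N_simps)
qed

lemma comp_upd: "(e \<circ> \<sigma>)(i := e j) = e \<circ> \<sigma>(i := j)"
  by (auto simp: fun_eq_iff)

lemma e_vals: "e \<circ> \<sigma> \<in> N.vals"
  using e_mem by (simp add: N.vals_def)

text \<open>Quantifiers over \<open>N\<close> may be restricted to named elements, because formulas are continuous.\<close>
lemma feval_N_near:
  assumes wf: "wf_fm L \<phi>" and a: "a \<in> Q" and \<epsilon>: "0 < \<epsilon>"
  shows "\<exists>j. \<bar>feval N ((e \<circ> \<sigma>)(i := a)) \<phi> - feval N (e \<circ> \<sigma>(i := j)) \<phi>\<bar> \<le> \<epsilon>"
proof -
  obtain C where C: "0 \<le> C" "\<And>v w \<delta>. \<lbrakk>v \<in> N.vals; w \<in> N.vals; 0 \<le> \<delta>; \<forall>k\<in>fvars \<phi>. d (v k) (w k) \<le> \<delta>\<rbrakk> \<Longrightarrow>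
      feval N v \<phi> \<le> feval N w \<phi> + C * \<delta>"
    using N.feval_lipschitz[OF wf] by auto
  let ?\<delta> = "\<epsilon> / (C + 1)"
  have \<delta>: "0 < ?\<delta>" using C(1) \<epsilon> by (intro divide_pos_pos) auto
  obtain j where j: "d a (e j) < ?\<delta>" using e_dense[OF a \<delta>] by blast
  have vals: "(e \<circ> \<sigma>)(i := a) \<in> N.vals" "e \<circ> \<sigma>(i := j) \<in> N.vals"
    using a by (auto intro!: N.vals_upd e_vals)
  have close: "d (((e \<circ> \<sigma>)(i := a)) k) ((e \<circ> \<sigma>(i := j)) k) \<le> ?\<delta>" for k
    using j \<delta> e_mem by (cases "k = i") (auto simp: less_imp_le)
  have "C * ?\<delta> \<le> \<epsilon>" using C(1) \<epsilon> by (simp add: field_simps)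
  then show ?thesis
    using C(2)[OF vals less_imp_le[OF \<delta>]] C(2)[OF vals(2,1) less_imp_le[OF \<delta>]] close Q.commute
    by (intro exI[of _ j]) (force simp: abs_le_iff)
qed

text \<open>Suprema and infima over named elements are the prescribed ones by the choice of witnesses.\<close>
theorem feval_N: "wf_fm L \<phi> \<Longrightarrow> feval N (e \<circ> \<sigma>) \<phi> = p (ev \<phi> \<sigma>)"
proof (induction \<phi> arbitrary: \<sigma>)
  case (Num r)
  show ?case using p_simps(4)[of r] by (simp add: ev_def[abs_def])
next
  case (Dist s t)
  then have wf: "wf_trm L s" "wf_trm L t" by auto
  obtain w w' where w: "named s \<sigma> w" "named t \<sigma> w'" using ex_named wf by metis
  have "feval N (e \<circ> \<sigma>) (Dist s t) = d (e w) (e w')"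
    by (simp only: feval.simps N_simps teval_N[OF wf(1) w(1)] teval_N[OF wf(2) w(2)])
  also have "\<dots> = type_dist s \<sigma> t \<sigma>" by (rule d_named[OF wf w])
  also have "\<dots> = p (ev (Dist s t) \<sigma>)" by (simp add: type_dist_def ev_def[abs_def])
  finally show ?case .
next
  case (Rel R ts)
  then have R: "R \<in> rsyms L" "length ts = rarity L R" and ts: "\<And>t. t \<in> set ts \<Longrightarrow> wf_trm L t" by auto
  define g where "g t = (SOME w. named t \<sigma> w)" for t
  have g: "named t \<sigma> (g t)" if "t \<in> set ts" for t
    unfolding g_def using someI_ex[OF ex_named[OF ts[OF that]]] .
  let ?is = "map g ts"
  have "map (teval N (e \<circ> \<sigma>)) ts = map e ?is"
    using teval_N ts g by simp
  moreover have "rN R (map e ?is) = p (ev (ratom R) ((!) ?is))"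
    using rN[OF R(1) _ map_e_subset, of ?is ?is] tuple_dist_self[OF _ map_e_subset, of ?is "rarity L R"] R(2) by simp
  moreover have "p (ev (ratom R) ((!) ?is)) = p (ev (Rel R ts) \<sigma>)"
  proof -
    have "\<bar>p (ev (ratom R) ((!) ?is)) - p (ev (Rel R ts) \<sigma>)\<bar> \<le>
        rlip L R * (\<Sum>k<rarity L R. (1/2) ^ k * type_dist (map Var [0..<rarity L R] ! k) ((!) ?is) (ts ! k) \<sigma>)"
      unfolding ratom_def
      by (rule p_Rel_lipschitz) (use Rel.prems wf_ratom[OF R(1)] in \<open>auto simp: ratom_def\<close>)
    also have "(\<Sum>k<rarity L R. (1/2) ^ k * type_dist (map Var [0..<rarity L R] ! k) ((!) ?is) (ts ! k) \<sigma>) = 0"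
    proof (rule sum.neutral, rule ballI)
      fix k assume k: "k \<in> {..<rarity L R}"
      then have "type_dist (Var k) ((!) ?is) (ts ! k) \<sigma> = type_dist (ts ! k) \<sigma> (Var 0) (\<lambda>_. g (ts ! k))"
        using R(2) by (simp add: type_dist_Var(1)[of k] type_dist_commute[of "ts ! k"])
      then show "(1/2) ^ k * type_dist (map Var [0..<rarity L R] ! k) ((!) ?is) (ts ! k) \<sigma> = 0"
        using g[of "ts ! k"] k R(2) by (simp add: named_def)
    qed
    finally show ?thesis by simp
  qed
  ultimately show ?case by (simp only: feval.simps N_simps)
next
  case (Scale r \<phi>)
  then show ?case using p_simps(2)[OF ev_mem[of \<phi> \<sigma>], of r] by (simp add: ev_def[abs_def])
next
  case (Add \<phi> \<psi>)
  then show ?case using p_simps(1)[OF ev_mem[of \<phi> \<sigma>] ev_mem[of \<psi> \<sigma>]] by (simp add: ev_def[abs_def])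
next
  case (SupF i \<phi>)
  then have wf: "wf_fm L \<phi>" by simp
  show ?case
  proof (rule antisym)
    show "feval N (e \<circ> \<sigma>) (SupF i \<phi>) \<le> p (ev (SupF i \<phi>) \<sigma>)"
    proof (rule N.SupF_least, rule field_le_epsilon)
      fix a and \<epsilon> :: real assume "a \<in> dom N" "0 < \<epsilon>"
      then obtain j where "\<bar>feval N ((e \<circ> \<sigma>)(i := a)) \<phi> - feval N (e \<circ> \<sigma>(i := j)) \<phi>\<bar> \<le> \<epsilon>"
        using feval_N_near[OF wf, of a \<epsilon> \<sigma> i] by auto
      moreover have "feval N (e \<circ> \<sigma>(i := j)) \<phi> = p (ev \<phi> (\<sigma>(i := j)))" by (rule SupF.IH[OF wf])
      moreover have "p (ev \<phi> (\<sigma>(i := j))) \<le> p (ev (SupF i \<phi>) \<sigma>)"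
      proof (intro p_mono ev_mem)
        fix v :: "'i \<Rightarrow> 'u" assume "v \<in> vals"
        then have "feval M ((v \<circ> \<sigma>)(i := v j)) \<phi> \<le> feval M (v \<circ> \<sigma>) (SupF i \<phi>)"
          by (intro SupF_upper wf vals_comp vals_mem)
        moreover have "(v \<circ> \<sigma>)(i := v j) = v \<circ> \<sigma>(i := j)" by (auto simp: fun_eq_iff)
        ultimately show "ev \<phi> (\<sigma>(i := j)) v \<le> ev (SupF i \<phi>) \<sigma> v" unfolding ev_def by metis
      qed (use SupF.prems in auto)
      ultimately show "feval N ((e \<circ> \<sigma>)(i := a)) \<phi> \<le> p (ev (SupF i \<phi>) \<sigma>) + \<epsilon>" by linarith
    qed
    obtain w where "p (ev (SupF i \<phi>) \<sigma>) \<le> p (ev \<phi> (\<sigma>(i := w)))" using SupF_witness[OF wf] by blast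
    also have "\<dots> = feval N ((e \<circ> \<sigma>)(i := e w)) \<phi>" unfolding comp_upd by (rule SupF.IH[OF wf, symmetric])
    also have "\<dots> \<le> feval N (e \<circ> \<sigma>) (SupF i \<phi>)" by (intro N.SupF_upper wf e_vals) (simp add: e_mem)
    finally show "p (ev (SupF i \<phi>) \<sigma>) \<le> feval N (e \<circ> \<sigma>) (SupF i \<phi>)" .
  qed
next
  case (InfF i \<phi>)
  then have wf: "wf_fm L \<phi>" by simp
  show ?case
  proof (rule antisym)
    show "p (ev (InfF i \<phi>) \<sigma>) \<le> feval N (e \<circ> \<sigma>) (InfF i \<phi>)"
    proof (rule N.InfF_greatest, rule field_le_epsilon)
      fix a and \<epsilon> :: real assume "a \<in> dom N" "0 < \<epsilon>"
      then obtain j where "\<bar>feval N ((e \<circ> \<sigma>)(i := a)) \<phi> - feval N (e \<circ> \<sigma>(i := j)) \<phi>\<bar> \<le> \<epsilon>"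
        using feval_N_near[OF wf, of a \<epsilon> \<sigma> i] by auto
      moreover have "feval N (e \<circ> \<sigma>(i := j)) \<phi> = p (ev \<phi> (\<sigma>(i := j)))" by (rule InfF.IH[OF wf])
      moreover have "p (ev (InfF i \<phi>) \<sigma>) \<le> p (ev \<phi> (\<sigma>(i := j)))"
      proof (intro p_mono ev_mem)
        fix v :: "'i \<Rightarrow> 'u" assume "v \<in> vals"
        then have "feval M (v \<circ> \<sigma>) (InfF i \<phi>) \<le> feval M ((v \<circ> \<sigma>)(i := v j)) \<phi>"
          by (intro InfF_lower wf vals_comp vals_mem)
        moreover have "(v \<circ> \<sigma>)(i := v j) = v \<circ> \<sigma>(i := j)" by (auto simp: fun_eq_iff)
        ultimately show "ev (InfF i \<phi>) \<sigma> v \<le> ev \<phi> (\<sigma>(i := j)) v" unfolding ev_def by metis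
      qed (use InfF.prems in auto)
      ultimately show "p (ev (InfF i \<phi>) \<sigma>) \<le> feval N ((e \<circ> \<sigma>)(i := a)) \<phi> + \<epsilon>" by linarith
    qed
    obtain w where w: "p (ev \<phi> (\<sigma>(i := w))) \<le> p (ev (InfF i \<phi>) \<sigma>)" using InfF_witness[OF wf] by blast
    have "feval N (e \<circ> \<sigma>) (InfF i \<phi>) \<le> feval N ((e \<circ> \<sigma>)(i := e w)) \<phi>"
      by (intro N.InfF_lower wf e_vals) (simp add: e_mem)
    also have "\<dots> = p (ev \<phi> (\<sigma>(i := w)))" unfolding comp_upd by (rule InfF.IH[OF wf])
    also note w
    finally show "feval N (e \<circ> \<sigma>) (InfF i \<phi>) \<le> p (ev (InfF i \<phi>) \<sigma>)" .
  qed
qed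

end


section \<open>Types realized in the model are extreme\<close>

lemma fms_closure [simp]:
  "Num r \<in> fms L n" "Add \<phi> \<psi> \<in> fms L n \<longleftrightarrow> \<phi> \<in> fms L n \<and> \<psi> \<in> fms L n"
  "Scale r \<phi> \<in> fms L n \<longleftrightarrow> \<phi> \<in> fms L n"
  by (auto simp: fms_def)

lemma fms_wf: "\<phi> \<in> fms L n \<Longrightarrow> wf_fm L \<phi>"
  by (simp add: fms_def)

lemma fval_eq_feval:
  assumes "\<phi> \<in> fms L n" "\<And>k. k < n \<Longrightarrow> as ! k = v k"
  shows "fval M \<phi> as = feval M v \<phi>"
  unfolding fval_def using assms by (intro feval_cong) (auto simp: fms_def)

lemma member_le_sum_list_real:
  fixes f :: "'a \<Rightarrow> real"
  assumes "\<And>x. x \<in> set xs \<Longrightarrow> 0 \<le> f x" "y \<in> set xs"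
  shows "f y \<le> (\<Sum>x\<leftarrow>xs. f x)"
  using assms
proof (induction xs)
  case (Cons x xs)
  have "0 \<le> (\<Sum>x\<leftarrow>xs. f x)" using Cons.prems by (intro sum_list_nonneg) auto
  with Cons show ?case by (auto intro: add_increasing)
qed simp

text \<open>It measures how far a valuation is from giving equal values to variables that an assignment \<open>\<tau>\<close>
  identifies.\<close>
definition penalty :: "(nat \<Rightarrow> 'i) \<Rightarrow> nat \<Rightarrow> ('c, 'f, 'r) fm" where
  "penalty \<tau> K = sum_fm (map (\<lambda>(a, b). Dist (Var a) (Var b))
     (filter (\<lambda>(a, b). \<tau> a = \<tau> b) (List.product [0..<K] [0..<K])))"

lemma wf_penalty [simp]: "wf_fm L (penalty \<tau> K)"
  by (auto simp: penalty_def)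

lemma fvars_penalty: "fvars (penalty \<tau> K) \<subseteq> {..<K}"
  by (auto simp: penalty_def)

lemma feval_penalty:
  "feval M u (penalty \<tau> K) =
    (\<Sum>(a, b)\<leftarrow>filter (\<lambda>(a, b). \<tau> a = \<tau> b) (List.product [0..<K] [0..<K]). mdist M (u a) (u b))"
  by (simp add: penalty_def comp_def case_prod_unfold)

context lstructure
begin

lemma fval_as_feval:
  assumes "as \<in> tuples M n"
  obtains v where "v \<in> vals" "\<And>k. k < n \<Longrightarrow> as ! k = v k"
proof -
  obtain a where a: "a \<in> dom M" using dom_nonempty by blast
  have "(\<lambda>k. if k < n then as ! k else a) \<in> vals"
    using assms a by (auto simp: vals_def tuples_def subset_iff)
  then show thesis by (rule that) simp
qed

lemma tuple_of_val: "v \<in> vals \<Longrightarrow> map v [0..<n] \<in> tuples M n"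
  by (auto simp: tuples_def vals_mem)

lemma penalty_ge:
  assumes "a < K" "b < K" "\<tau> a = \<tau> b"
  shows "mdist M (u a) (u b) \<le> feval M u (penalty \<tau> K)"
  unfolding feval_penalty
  using member_le_sum_list_real[of "filter (\<lambda>(a, b). \<tau> a = \<tau> b) (List.product [0..<K] [0..<K])"
      "\<lambda>(a, b). mdist M (u a) (u b)" "(a, b)"] assms by auto

lemma penalty_nonneg: "0 \<le> feval M u (penalty \<tau> K)"
  unfolding feval_penalty by (intro sum_list_nonneg) auto

lemma penalty_zero:
  assumes "v \<in> vals"
  shows "feval M (v \<circ> \<tau>) (penalty \<tau> K) = 0"
proof -
  let ?ps = "filter (\<lambda>(a, b). \<tau> a = \<tau> b) (List.product [0..<K] [0..<K])"
  have "map (\<lambda>(a, b). mdist M ((v \<circ> \<tau>) a) ((v \<circ> \<tau>) b)) ?ps = map (\<lambda>_. 0) ?ps"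
    using assms by (intro map_cong) (auto simp: vals_mem)
  then show ?thesis unfolding feval_penalty by (simp only: sum_list_0)
qed

text \<open>Moving a tuple to one with the identifications prescribed by \<open>\<tau>\<close> changes a formula by at most
  its Lipschitz constant times the penalty. Hence nonnegativity at the tuples with these
  identifications extends to all tuples once a multiple of the penalty is added. As the penalty
  vanishes at the tuples of interest, this replaces substituting equal variables in the formula.\<close>
lemma nonneg_with_penalty:
  assumes wf: "wf_fm L \<phi>" and bound: "fvars \<phi> \<subseteq> {..<K}"
    and nonneg: "\<And>v. v \<in> vals \<Longrightarrow> 0 \<le> ev \<phi> \<tau> v"
  shows "\<exists>C\<ge>0. \<forall>u\<in>vals. 0 \<le> feval M u \<phi> + C * feval M u (penalty \<tau> K)"
proof -
  obtain C where C: "0 \<le> C" "\<And>v w \<delta>. \<lbrakk>v \<in> vals; w \<in> vals; 0 \<le> \<delta>; \<forall>k\<in>fvars \<phi>. mdist M (v k) (w k) \<le> \<delta>\<rbrakk> \<Longrightarrow>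
      feval M v \<phi> \<le> feval M w \<phi> + C * \<delta>"
    using feval_lipschitz[OF wf] by blast
  have "0 \<le> feval M u \<phi> + C * feval M u (penalty \<tau> K)" if u: "u \<in> vals" for u
  proof -
    \<comment> \<open>All variables with the same value of \<open>\<tau>\<close> receive the value that one of them has under \<open>u\<close>.\<close>
    define v where "v i = (if \<exists>a<K. \<tau> a = i then u (SOME a. a < K \<and> \<tau> a = i) else u 0)" for i
    have v: "v \<in> vals" using u by (simp add: v_def vals_def)
    have "mdist M ((v \<circ> \<tau>) k) (u k) \<le> feval M u (penalty \<tau> K)" if "k \<in> fvars \<phi>" for k
    proof -
      have k: "k < K" using that bound by auto
      let ?a = "SOME a. a < K \<and> \<tau> a = \<tau> k"
      have "?a < K \<and> \<tau> ?a = \<tau> k" by (rule someI[of _ k]) (simp add: k)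
      moreover have "(v \<circ> \<tau>) k = u ?a" using k by (auto simp: v_def)
      ultimately show ?thesis using penalty_ge[of ?a K k \<tau> u] k by simp
    qed
    then have "feval M (v \<circ> \<tau>) \<phi> \<le> feval M u \<phi> + C * feval M u (penalty \<tau> K)"
      by (intro C(2) vals_comp v u penalty_nonneg) blast
    with nonneg[OF v] show ?thesis unfolding ev_def by (rule order_trans)
  qed
  with C(1) show ?thesis by blast
qed

end

context henkin_completion
begin

text \<open>Purity of the type of every tuple of \<open>N\<close>, including tuples of limits. From the function \<open>g\<close> that
  purity of \<open>p\<close> yields at a nearby named tuple, a formula in the variables of the given tuple is
  obtained as the infimum over \<open>y\<close> and \<open>z\<close> of \<open>g(y, z) + C d(x, y)\<close> plus a penalty, where \<open>x\<close> and \<open>y\<close>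
  stand for the given and the nearby tuple and \<open>z\<close> for the other elements that \<open>g\<close> involves.\<close>
theorem tuples_pure:
  assumes \<phi>: "\<phi> \<in> fms L n" and as: "as \<in> tuples N n" and zero: "fval N \<phi> as = 0" and \<epsilon>: "0 < \<epsilon>"
  shows "\<exists>g\<in>fms L n. (\<forall>bs\<in>tuples M n. 0 \<le> fval M g bs \<and> fval M \<phi> bs \<le> fval M g bs) \<and> fval N g as \<le> \<epsilon>"
proof -
  note wf = fms_wf[OF \<phi>]
  have fvars: "fvars \<phi> \<subseteq> {..<n}" using \<phi> by (simp add: fms_def)
  have len: "length as = n" and asQ: "\<And>k. k < n \<Longrightarrow> as ! k \<in> Q"
    using as by (auto simp: tuples_N subset_iff)
  obtain C1 where C1: "0 \<le> C1" "\<And>v w \<delta>. \<lbrakk>v \<in> vals; w \<in> vals; 0 \<le> \<delta>; \<forall>k\<in>fvars \<phi>. mdist M (v k) (w k) \<le> \<delta>\<rbrakk> \<Longrightarrow>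
      feval M v \<phi> \<le> feval M w \<phi> + C1 * \<delta>"
    using feval_lipschitz[OF wf] by blast
  obtain C2 where C2: "0 \<le> C2" "\<And>v w \<delta>. \<lbrakk>v \<in> N.vals; w \<in> N.vals; 0 \<le> \<delta>; \<forall>k\<in>fvars \<phi>. d (v k) (w k) \<le> \<delta>\<rbrakk> \<Longrightarrow>
      feval N v \<phi> \<le> feval N w \<phi> + C2 * \<delta>"
    using N.feval_lipschitz[OF wf] by auto
  define C where "C = C1 + C2"
  have C: "0 \<le> C" "C1 \<le> C" "C2 \<le> C" using C1(1) C2(1) by (auto simp: C_def)
  define \<delta> where "\<delta> = \<epsilon> / (2 * ((C + 1) * (real n + 1)))"
  have \<delta>: "0 < \<delta>" unfolding \<delta>_def using C(1) \<epsilon> by (intro divide_pos_pos mult_pos_pos) auto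
  have small: "C * (real n * \<delta>) + C * \<delta> \<le> \<epsilon> / 2"
  proof -
    have "(C + 1) * (real n + 1) \<noteq> 0" using C(1) by (simp add: add_nonneg_eq_0_iff)
    then have "(C + 1) * (real n + 1) * \<delta> = \<epsilon> / 2" by (simp add: \<delta>_def)
    moreover have "(C + 1) * (real n + 1) * \<delta> = C * (real n * \<delta>) + C * \<delta> + real n * \<delta> + \<delta>"
      by (simp add: algebra_simps)
    moreover have "0 \<le> real n * \<delta>" using \<delta> by simp
    ultimately show ?thesis using \<delta> by linarith
  qed
  \<comment> \<open>Only named elements are described by \<open>p\<close>, so the tuple is replaced by a nearby named one.\<close>
  have "\<forall>k. \<exists>i. k < n \<longrightarrow> d (as ! k) (e i) < \<delta>" using e_dense[OF asQ \<delta>] by blast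
  then obtain \<iota> where \<iota>: "\<And>k. k < n \<Longrightarrow> d (as ! k) (e (\<iota> k)) < \<delta>" by metis
  have p\<phi>: "p (ev \<phi> \<iota>) \<le> C * \<delta>"
  proof -
    let ?u = "\<lambda>k. if k < n then as ! k else e (\<iota> k)"
    have u: "?u \<in> N.vals" using asQ e_mem by (simp add: N.vals_def)
    have "feval N (e \<circ> \<iota>) \<phi> \<le> feval N ?u \<phi> + C2 * \<delta>"
    proof (intro C2(2) e_vals u ballI)
      fix k assume "k \<in> fvars \<phi>"
      then have "k < n" using fvars by auto
      then show "d ((e \<circ> \<iota>) k) (?u k) \<le> \<delta>"
        using \<iota>[of k] Q.commute[of "as ! k"] by simp
    qed (use \<delta> in simp)
    also have "feval N ?u \<phi> = 0"
      using zero fval_eq_feval[OF \<phi>, of as ?u N] by simp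
    also have "C2 * \<delta> \<le> C * \<delta>" using C \<delta> by (intro mult_right_mono) auto
    finally show ?thesis by (simp only: feval_N[OF wf] add_0)
  qed
  \<comment> \<open>Purity of \<open>p\<close>, in more variables than the tuple has entries.\<close>
  have "\<exists>g\<in>definable. (\<forall>v\<in>vals. 0 \<le> g v \<and> ev \<phi> \<iota> v - p (ev \<phi> \<iota>) \<le> g v) \<and> p g \<le> \<epsilon> / 2"
  proof -
    have mem: "(\<lambda>v. ev \<phi> \<iota> v - p (ev \<phi> \<iota>)) \<in> definable"
      by (intro D.diff_mem ev_mem wf D.const_mem)
    have "p (\<lambda>v. ev \<phi> \<iota> v - p (ev \<phi> \<iota>)) = 0"
      using D.state_diff[OF state ev_mem[OF wf] D.const_mem] p_simps(4) by simp
    with mem show ?thesis using pure half_gt_zero[OF \<epsilon>] unfolding D.pure_def by blast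
  qed
  then obtain \<gamma> \<rho> where \<gamma>: "wf_fm L \<gamma>" and G0: "\<And>v. v \<in> vals \<Longrightarrow> 0 \<le> ev \<gamma> \<rho> v"
    and G: "\<And>v. v \<in> vals \<Longrightarrow> ev \<phi> \<iota> v - p (ev \<phi> \<iota>) \<le> ev \<gamma> \<rho> v" and pG: "p (ev \<gamma> \<rho>) \<le> \<epsilon> / 2"
    by (auto simp: definable_def)
  obtain m where m: "fvars \<gamma> \<subseteq> {..<m}" using ex_fvars_bound by blast
  let ?s = "\<lambda>k. k + n"
  have inj: "inj ?s" by (simp add: inj_def)
  define K where "K = n + m"
  \<comment> \<open>The named tuple occupies the first \<open>n\<close> variables, those of \<open>\<gamma>\<close> follow.\<close>
  define \<tau> where "\<tau> k = (if k < n then \<iota> k else \<rho> (k - n))" for k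
  define \<gamma>' where "\<gamma>' = fren ?s \<gamma>"
  have \<gamma>': "wf_fm L \<gamma>'" "fvars \<gamma>' \<subseteq> {..<K}"
    using \<gamma> m by (auto simp: \<gamma>'_def fvars_fren[OF inj] K_def)
  have "v \<circ> \<tau> \<circ> ?s = v \<circ> \<rho>" for v :: "'i \<Rightarrow> 'u" by (auto simp: \<tau>_def fun_eq_iff)
  then have ev\<gamma>': "ev \<gamma>' \<tau> = ev \<gamma> \<rho>"
    by (simp add: ev_def[abs_def] \<gamma>'_def feval_fren[OF inj])
  have ev\<phi>: "ev \<phi> \<tau> v = ev \<phi> \<iota> v" for v
    unfolding ev_def by (rule feval_cong) (use fvars in \<open>auto simp: \<tau>_def\<close>)
  define \<kappa> where "\<kappa> = Add \<gamma>' (Add (Num (C * \<delta>)) (Scale (-1) \<phi>))"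
  have \<kappa>: "wf_fm L \<kappa>" "fvars \<kappa> \<subseteq> {..<K}"
    using \<gamma>' wf fvars by (auto simp: \<kappa>_def K_def)
  have \<kappa>0: "0 \<le> ev \<kappa> \<tau> v" if "v \<in> vals" for v
  proof -
    have "ev \<kappa> \<tau> v = ev \<gamma>' \<tau> v + (C * \<delta> - ev \<phi> \<tau> v)" by (simp add: \<kappa>_def ev_def)
    then show ?thesis using G[OF that] p\<phi> by (simp add: ev\<gamma>' ev\<phi>)
  qed
  obtain A1 where A1: "0 \<le> A1" "\<And>u. u \<in> vals \<Longrightarrow> 0 \<le> feval M u \<gamma>' + A1 * feval M u (penalty \<tau> K)"
    using nonneg_with_penalty[OF \<gamma>', of \<tau>] G0 by (auto simp: ev\<gamma>')
  obtain A2 where A2: "0 \<le> A2" "\<And>u. u \<in> vals \<Longrightarrow> 0 \<le> feval M u \<kappa> + A2 * feval M u (penalty \<tau> K)"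
    using nonneg_with_penalty[OF \<kappa> \<kappa>0] by blast
  define \<psi> where "\<psi> = Add \<gamma>' (Scale (A1 + A2) (penalty \<tau> K))"
  have \<psi>: "wf_fm L \<psi>" "fvars \<psi> \<subseteq> {..<K}"
    using \<gamma>' fvars_penalty[of \<tau> K] by (auto simp: \<psi>_def)
  have \<psi>0: "0 \<le> feval M u \<psi>" and \<psi>\<phi>: "feval M u \<phi> \<le> feval M u \<psi> + C * \<delta>" if "u \<in> vals" for u
  proof -
    have "0 \<le> A1 * feval M u (penalty \<tau> K)" "0 \<le> A2 * feval M u (penalty \<tau> K)"
      by (intro mult_nonneg_nonneg A1(1) A2(1) penalty_nonneg)+
    then show "0 \<le> feval M u \<psi>" "feval M u \<phi> \<le> feval M u \<psi> + C * \<delta>"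
      using A1(2)[OF that] A2(2)[OF that] by (auto simp: \<psi>_def \<kappa>_def distrib_right)
  qed
  define S :: "('c, 'f, 'r) fm" where "S = sum_fm (map (\<lambda>k. Dist (Var k) (Var (k + n))) [0..<n])"
  \<comment> \<open>All these variables are shifted by \<open>n\<close> to make room for the variables of \<open>\<phi>\<close>.\<close>
  define \<theta> where "\<theta> = Add (fren ?s \<psi>) (Add (Scale C S) (Num (C * \<delta>)))"
  define g where "g = foldr InfF [n..<n + K] \<theta>"
  have \<theta>: "wf_fm L \<theta>" "fvars \<theta> \<subseteq> {..<n + K}"
    using \<psi> by (auto simp: \<theta>_def S_def fvars_fren[OF inj] K_def)
  then have g: "g \<in> fms L n"
    by (auto simp: g_def fms_def)
  have feval_S: "feval M' u S = (\<Sum>k\<leftarrow>[0..<n]. mdist M' (u k) (u (k + n)))" for M' :: "('c, 'f, 'r, 'u) lstruct" and u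
    by (simp add: S_def comp_def)
  have feval_\<theta>: "feval M' u \<theta> = feval M' (u \<circ> ?s) \<psi> + C * feval M' u S + C * \<delta>"
    for M' :: "('c, 'f, 'r, 'u) lstruct" and u
    by (simp add: \<theta>_def feval_fren[OF inj])
  have above: "0 \<le> feval M v g \<and> feval M v \<phi> \<le> feval M v g" if v: "v \<in> vals" for v
  proof -
    have "0 \<le> feval M u \<theta> \<and> feval M v \<phi> \<le> feval M u \<theta>"
      if u: "u \<in> vals" and uv: "\<And>k. k \<notin> set [n..<n + K] \<Longrightarrow> u k = v k" for u
    proof -
      have us: "u \<circ> ?s \<in> vals" by (rule vals_comp[OF u])
      have S0: "0 \<le> feval M u S" unfolding feval_S by (intro sum_list_nonneg) auto
      have "mdist M (u k) ((u \<circ> ?s) k) \<le> feval M u S" if "k \<in> fvars \<phi>" for k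
        using member_le_sum_list_real[of "[0..<n]" "\<lambda>k. mdist M (u k) (u (k + n))" k] that fvars
        by (auto simp: feval_S)
      then have "feval M u \<phi> \<le> feval M (u \<circ> ?s) \<phi> + C1 * feval M u S"
        by (intro C1(2) u us S0) blast
      moreover have "C1 * feval M u S \<le> C * feval M u S" using C S0 by (intro mult_right_mono) auto
      moreover have "feval M u \<phi> = feval M v \<phi>"
        using uv fvars by (intro feval_cong) auto
      moreover have "0 \<le> C * feval M u S" "0 \<le> C * \<delta>"
        using C(1) S0 \<delta> by (intro mult_nonneg_nonneg; simp)+
      ultimately show ?thesis
        using \<psi>0[OF us] \<psi>\<phi>[OF us] unfolding feval_\<theta> by linarith
    qed
    then show ?thesis unfolding g_def using v by (auto intro!: foldr_InfF_greatest)
  qed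
  have "fval N g as \<le> \<epsilon>"
  proof -
    define u where "u k = (if k < n then as ! k else e (\<tau> (k - n)))" for k
    have u: "u \<in> N.vals" using asQ e_mem by (simp add: N.vals_def u_def)
    have "fval N g as = feval N u g" by (rule fval_eq_feval[OF g]) (simp add: u_def)
    also have "\<dots> \<le> feval N u \<theta>"
      unfolding g_def by (rule N.foldr_InfF_lower[OF \<theta>(1) u u]) simp
    also have "u \<circ> ?s = e \<circ> \<tau>" by (auto simp: u_def fun_eq_iff)
    then have "feval N u \<theta> = feval N (e \<circ> \<tau>) \<psi> + C * feval N u S + C * \<delta>"
      by (simp only: feval_\<theta>)
    also have "feval N (e \<circ> \<tau>) \<psi> = p (ev \<gamma> \<rho>)"
    proof -
      have "e \<in> N.vals" using e_mem by (simp add: N.vals_def)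
      then have "feval N (e \<circ> \<tau>) (penalty \<tau> K) = 0" by (rule N.penalty_zero)
      moreover have "feval N (e \<circ> \<tau>) \<gamma>' = p (ev \<gamma> \<rho>)" by (simp only: feval_N[OF \<gamma>'(1)] ev\<gamma>')
      ultimately show ?thesis by (simp only: \<psi>_def feval.simps mult_zero_right add_0_right)
    qed
    also have "feval N u S \<le> real n * \<delta>"
    proof -
      have "feval N u S \<le> (\<Sum>k\<leftarrow>[0..<n]. \<delta>)"
        unfolding feval_S
      proof (rule sum_list_mono)
        fix k assume "k \<in> set [0..<n]"
        then show "mdist N (u k) (u (k + n)) \<le> \<delta>"
          using \<iota>[of k] by (simp add: u_def \<tau>_def)
      qed
      then show ?thesis by (simp add: sum_list_triv)
    qed
    then have "C * feval N u S \<le> C * (real n * \<delta>)" using C(1) by (rule mult_left_mono)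
    finally show ?thesis using pG small by linarith
  qed
  moreover have "0 \<le> fval M g bs \<and> fval M \<phi> bs \<le> fval M g bs" if "bs \<in> tuples M n" for bs
  proof -
    obtain v where "v \<in> vals" "\<And>k. k < n \<Longrightarrow> bs ! k = v k" using fval_as_feval[OF \<open>bs \<in> tuples M n\<close>] by blast
    then show ?thesis
      using above[of v] fval_eq_feval[OF g, of bs v] fval_eq_feval[OF \<phi>, of bs v] by simp
  qed
  ultimately show ?thesis using g by blast
qed

lemma fval_sentence_N:
  assumes \<phi>: "\<phi> \<in> fms L 0"
  shows "fval N \<phi> [] = fval M \<phi> []"
proof -
  have wf: "wf_fm L \<phi>" using \<phi> by (rule fms_wf)
  fix \<sigma> :: "nat \<Rightarrow> 'i"
  have "fval N \<phi> [] = p (ev \<phi> \<sigma>)"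
    using fval_eq_feval[OF \<phi>, of "[]" "e \<circ> \<sigma>" N] by (simp only: feval_N[OF wf])
  also have "ev \<phi> \<sigma> = (\<lambda>_. fval M \<phi> [])"
    using fval_eq_feval[OF \<phi>, of "[]" _ M] by (auto simp: ev_def fun_eq_iff)
  finally show ?thesis using p_simps(4) by simp
qed

end

text \<open>The infimum of \<open>\<psi> - \<phi>\<close> is a sentence, so in a complete theory all models agree on its sign.\<close>
lemma entails_le_if_in_model:
  fixes M :: "('c, 'f, 'r, 'u) lstruct"
  assumes lang: "is_language L" and complete: "complete_theory TYPE('u) L T" and M: "M \<in> models L T"
    and \<phi>: "\<phi> \<in> fms L n" and \<psi>: "\<psi> \<in> fms L n"
    and le: "\<And>as. as \<in> tuples M n \<Longrightarrow> fval M \<phi> as \<le> fval M \<psi> as"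
  shows "entails_le TYPE('u) L T n \<phi> \<psi>"
proof -
  let ?\<kappa> = "Add \<psi> (Scale (-1) \<phi>)"
  let ?\<theta> = "foldr InfF [0..<n] ?\<kappa>"
  have \<kappa>: "wf_fm L ?\<kappa>" and \<theta>: "?\<theta> \<in> fms L 0" using \<phi> \<psi> by (auto simp: fms_def)
  obtain r where r: "entails_eq TYPE('u) L T 0 ?\<theta> (Num r)"
    using complete \<theta> unfolding complete_theory_def by blast
  have val: "fval M' ?\<theta> [] = r" if "M' \<in> models L T" for M' :: "('c, 'f, 'r, 'u) lstruct"
  proof -
    have "[] \<in> tuples M' 0" by (simp add: tuples_def)
    then have "fval M' ?\<theta> [] \<le> fval M' (Num r) []" "fval M' (Num r) [] \<le> fval M' ?\<theta> []"
      using r that unfolding entails_eq_def entails_le_def by blast+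
    then show ?thesis by (simp add: fval_def)
  qed
  interpret M: lstructure L M
    using lang M by unfold_locales (auto simp: models_def)
  have "0 \<le> r"
  proof -
    obtain v :: "nat \<Rightarrow> 'u" where v: "v \<in> M.vals" using M.vals_nonempty by blast
    have "0 \<le> feval M u ?\<kappa>" if "u \<in> M.vals" for u
      using le[OF M.tuple_of_val[OF that]] fval_eq_feval[OF \<phi>, of "map u [0..<n]" u M]
        fval_eq_feval[OF \<psi>, of "map u [0..<n]" u M] by simp
    then have "0 \<le> feval M v ?\<theta>" using v by (intro M.foldr_InfF_greatest) auto
    then show ?thesis using val[OF M] fval_eq_feval[OF \<theta>, of "[]" v M] by simp
  qed
  show ?thesis
    unfolding entails_le_def
  proof (intro allI impI ballI)
    fix M' :: "('c, 'f, 'r, 'u) lstruct" and as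
    assume M': "M' \<in> models L T" and as: "as \<in> tuples M' n"
    interpret M': lstructure L M'
      using lang M' by unfold_locales (auto simp: models_def)
    obtain v where v: "v \<in> M'.vals" "\<And>k. k < n \<Longrightarrow> as ! k = v k"
      using M'.fval_as_feval[OF as] by blast
    have "0 \<le> fval M' ?\<theta> []" using val[OF M'] \<open>0 \<le> r\<close> by simp
    also have "\<dots> = feval M' v ?\<theta>" by (rule fval_eq_feval[OF \<theta>]) simp
    also have "\<dots> \<le> feval M' v ?\<kappa>" by (rule M'.foldr_InfF_lower[OF \<kappa> v(1) v(1)]) simp
    finally show "fval M' \<phi> as \<le> fval M' \<psi> as"
      using fval_eq_feval[OF \<phi>, of as v M'] fval_eq_feval[OF \<psi>, of as v M'] v(2) by simp
  qed
qed

lemma S_spaceD: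
  assumes "t \<in> S_space U L T n"
  shows S_space_outside: "X \<notin> D_space U L T n \<Longrightarrow> t X = 0"
    and S_space_Add: "\<lbrakk>\<phi> \<in> fms L n; \<psi> \<in> fms L n\<rbrakk> \<Longrightarrow>
      t (fclass U L T n (Add \<phi> \<psi>)) = t (fclass U L T n \<phi>) + t (fclass U L T n \<psi>)"
    and S_space_Scale: "\<phi> \<in> fms L n \<Longrightarrow> t (fclass U L T n (Scale r \<phi>)) = r * t (fclass U L T n \<phi>)"
    and S_space_nonneg: "\<lbrakk>\<phi> \<in> fms L n; entails_le U L T n (Num 0) \<phi>\<rbrakk> \<Longrightarrow> 0 \<le> t (fclass U L T n \<phi>)"
    and S_space_one: "t (fclass U L T n (Num 1)) = 1"
  using assms unfolding S_space_def by simp_all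

text \<open>A component \<open>t\<close> of weight \<open>c\<close> of a pure type equals that type.\<close>
lemma dominated_type_eq:
  fixes M N :: "('c, 'f, 'r, 'u) lstruct"
  assumes lang: "is_language L" and complete: "complete_theory TYPE('u) L T" and M: "M \<in> models L T"
    and pure: "\<And>\<phi> \<epsilon>. \<lbrakk>\<phi> \<in> fms L n; fval N \<phi> as = 0; 0 < \<epsilon>\<rbrakk> \<Longrightarrow>
      \<exists>g\<in>fms L n. (\<forall>bs\<in>tuples M n. 0 \<le> fval M g bs \<and> fval M \<phi> bs \<le> fval M g bs) \<and> fval N g as \<le> \<epsilon>"
    and t: "t \<in> S_space TYPE('u) L T n" and c: "0 < c"
    and dom: "\<And>g. \<lbrakk>g \<in> fms L n; entails_le TYPE('u) L T n (Num 0) g\<rbrakk> \<Longrightarrow>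
      c * t (fclass TYPE('u) L T n g) \<le> fval N g as"
    and \<phi>: "\<phi> \<in> fms L n"
  shows "t (fclass TYPE('u) L T n \<phi>) = fval N \<phi> as"
proof -
  let ?t = "\<lambda>\<phi>. t (fclass TYPE('u) L T n \<phi>)"
  note entails = entails_le_if_in_model[OF lang complete M]
  have le: "?t \<phi> \<le> fval N \<phi> as" if \<phi>: "\<phi> \<in> fms L n" for \<phi>
  proof (rule field_le_epsilon)
    fix \<epsilon> :: real assume \<epsilon>: "0 < \<epsilon>"
    let ?r = "fval N \<phi> as"
    let ?\<phi>' = "Add \<phi> (Scale (- ?r) (Num 1))"
    have \<phi>': "?\<phi>' \<in> fms L n" using \<phi> by simp
    have "fval N ?\<phi>' as = 0" by (simp add: fval_def)
    from pure[OF \<phi>' this mult_pos_pos[OF c \<epsilon>]] obtain g where g: "g \<in> fms L n"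
      and above: "\<And>bs. bs \<in> tuples M n \<Longrightarrow> 0 \<le> fval M g bs \<and> fval M ?\<phi>' bs \<le> fval M g bs"
      and small: "fval N g as \<le> c * \<epsilon>" by blast
    have "entails_le TYPE('u) L T n (Num 0) g"
      using above g by (intro entails) (auto simp: fval_def)
    then have "c * ?t g \<le> c * \<epsilon>" using dom[OF g] small by simp
    then have "?t g \<le> \<epsilon>" using c by simp
    have "fval M (Num 0) bs \<le> fval M (Add g (Scale (-1) ?\<phi>')) bs" if "bs \<in> tuples M n" for bs
      using above[OF that] by (simp add: fval_def)
    then have "entails_le TYPE('u) L T n (Num 0) (Add g (Scale (-1) ?\<phi>'))"
      using g \<phi> by (intro entails) auto
    then have "0 \<le> ?t (Add g (Scale (-1) ?\<phi>'))"
      using g \<phi> by (intro S_space_nonneg[OF t]) auto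
    moreover have "?t (Add g (Scale (-1) ?\<phi>')) = ?t g + ?t (Scale (-1) ?\<phi>')"
      using \<phi>' by (intro S_space_Add[OF t g]) simp
    moreover have "?t (Scale (-1) ?\<phi>') = (-1) * ?t ?\<phi>'"
      by (rule S_space_Scale[OF t \<phi>'])
    ultimately have "?t ?\<phi>' \<le> ?t g" by linarith
    moreover note \<open>?t g \<le> \<epsilon>\<close>
    moreover have "?t ?\<phi>' = ?t \<phi> - ?r"
      using \<phi> by (simp add: S_space_Add[OF t] S_space_Scale[OF t] S_space_one[OF t])
    ultimately show "?t \<phi> \<le> ?r + \<epsilon>" by simp
  qed
  from le[OF \<phi>] le[of "Scale (-1) \<phi>"] \<phi> show ?thesis
    by (simp add: S_space_Scale[OF t] fval_def)
qed

theorem theorem4p3: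
  fixes L :: "('c, 'f, 'r) language" and T :: "('c, 'f, 'r) thy"
  assumes "is_language L"
    and "large_universe TYPE('u) L"
    and "complete_theory TYPE('u) L T"
  shows "\<exists>M :: ('c, 'f, 'r, 'u) lstruct. M \<in> models L T \<and>
    (\<forall>n\<ge>1. \<forall>p\<in>S_space TYPE('u) L T n.
       \<not> p extreme_point_of S_space TYPE('u) L T n \<longrightarrow> omits L T n M p)"
proof -
  obtain M :: "('c, 'f, 'r, 'u) lstruct" where M: "M \<in> models L T"
    using assms(3) unfolding complete_theory_def by blast
  interpret M: lstructure L M
    using assms(1) M by unfold_locales (auto simp: models_def)
  obtain p :: "((('c, 'f, 'r) fm \<Rightarrow> 'u) \<Rightarrow> real) \<Rightarrow> real" where
    p: "function_space.state M.definable M.vals p" "function_space.pure M.definable M.vals p"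
    and witness: "\<And>i \<phi> \<sigma>. wf_fm L \<phi> \<Longrightarrow> \<exists>w. p (M.ev (SupF i \<phi>) \<sigma>) \<le> p (M.ev \<phi> (\<sigma>(i := w)))"
    using M.ex_henkin_state by blast
  interpret H: henkin_state L M p
    using p witness by unfold_locales
  obtain j :: "(nat \<Rightarrow> ('c, 'f, 'r) fm) \<Rightarrow> 'u" where j: "inj j"
    using assms(2) unfolding large_universe_def by blast
  let ?D = "\<lambda>i j. H.type_dist (Var 0) (\<lambda>_. i) (Var 0) (\<lambda>_. j)"
  obtain Q d e where "henkin_completion L M p Q d e"
  proof (rule metric_completion_embedded[of ?D j])
    show "?D x x = 0" "0 \<le> ?D x y" "?D x y = ?D y x" "?D x z \<le> ?D x y + ?D y z" for x y z
      by (intro H.type_dist_refl H.type_dist_nonneg H.type_dist_commute H.type_dist_triangle; simp)+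
    show "inj j" by (rule j)
    fix Q d and e :: "('c, 'f, 'r) fm \<Rightarrow> 'u"
    assume "Metric_space Q d" "Metric_space.mcomplete Q d" "\<And>x. e x \<in> Q" "\<And>x y. d (e x) (e y) = ?D x y"
      "\<And>q \<epsilon>. \<lbrakk>q \<in> Q; 0 < \<epsilon>\<rbrakk> \<Longrightarrow> \<exists>x. d q (e x) < \<epsilon>"
    then have "henkin_completion L M p Q d e"
      by (intro henkin_completion.intro H.henkin_state_axioms henkin_completion_axioms.intro)
    then show thesis by (rule that)
  qed
  then interpret C: henkin_completion L M p Q d e .
  have "fval C.N \<phi> [] \<le> fval C.N \<psi> []" if "(\<phi>, \<psi>) \<in> T" for \<phi> \<psi>
  proof -
    have "\<phi> \<in> fms L 0" "\<psi> \<in> fms L 0"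
      using that assms(3) by (auto simp: complete_theory_def is_theory_def)
    moreover have "fval M \<phi> [] \<le> fval M \<psi> []"
      using that M by (auto simp: models_def)
    ultimately show ?thesis by (simp add: C.fval_sentence_N)
  qed
  then have "C.N \<in> models L T"
    using C.is_structure_N by (auto simp: models_def)
  moreover have "omits L T n C.N q"
    if q: "q \<in> S_space TYPE('u) L T n" and not_ext: "\<not> q extreme_point_of S_space TYPE('u) L T n" for n q
    unfolding omits_def
  proof
    assume "\<exists>as\<in>tuples C.N n. realizes L T n C.N as q"
    then obtain as where as: "as \<in> tuples C.N n"
      and real: "\<And>\<phi>. \<phi> \<in> fms L n \<Longrightarrow> q (fclass TYPE('u) L T n \<phi>) = fval C.N \<phi> as"
      by (auto simp: realizes_def)
    obtain a b where ab: "a \<in> S_space TYPE('u) L T n" "b \<in> S_space TYPE('u) L T n" "q \<in> open_segment a b"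
      using q not_ext unfolding extreme_point_of_def by blast
    then obtain u where u: "0 < u" "u < 1" "a \<noteq> b" and "q = (1 - u) *\<^sub>R a + u *\<^sub>R b"
      by (auto simp: in_segment)
    then have q_eq: "q X = (1 - u) * a X + u * b X" for X
      by (simp add: plus_fun_def scaleR_fun_def)
    note eq = dominated_type_eq[OF assms(1,3) M C.tuples_pure[OF _ as]]
    have a_eq: "a (fclass TYPE('u) L T n \<phi>) = fval C.N \<phi> as" if "\<phi> \<in> fms L n" for \<phi>
    proof (rule eq[OF _ _ _ ab(1) _ _ that, of "1 - u"])
      fix g assume g: "g \<in> fms L n" "entails_le TYPE('u) L T n (Num 0) g"
      show "(1 - u) * a (fclass TYPE('u) L T n g) \<le> fval C.N g as"
        using mult_nonneg_nonneg[OF less_imp_le[OF u(1)] S_space_nonneg[OF ab(2) g]] real[OF g(1)]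
        unfolding q_eq by linarith
    qed (use u in auto)
    have b_eq: "b (fclass TYPE('u) L T n \<phi>) = fval C.N \<phi> as" if "\<phi> \<in> fms L n" for \<phi>
    proof (rule eq[OF _ _ _ ab(2) _ _ that, of u])
      fix g assume g: "g \<in> fms L n" "entails_le TYPE('u) L T n (Num 0) g"
      show "u * b (fclass TYPE('u) L T n g) \<le> fval C.N g as"
        using mult_nonneg_nonneg[OF _ S_space_nonneg[OF ab(1) g], of "1 - u"] u(2) real[OF g(1)]
        unfolding q_eq by linarith
    qed (use u in auto)
    have "a X = b X" for X
    proof (cases "X \<in> D_space TYPE('u) L T n")
      case True
      then obtain \<phi> where "\<phi> \<in> fms L n" "X = fclass TYPE('u) L T n \<phi>"
        by (auto simp: D_space_def fclass_def quotient_def)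
      then show ?thesis
        by (simp add: a_eq b_eq)
    next
      case False
      then show ?thesis using S_space_outside[OF ab(1)] S_space_outside[OF ab(2)] by simp
    qed
    with \<open>a \<noteq> b\<close> show False by blast
  qed
  ultimately show ?thesis by blast
qed

end
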